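(* Let $\lambda\in\mathbb{R}$ and let $V=V_1+V_2$ be a Kato-Rellich potential on $\mathbb{R}^N$, i.e. $V_1\in L^p(\mathbb{R}^N)$, $V_2\in L^\infty(\mathbb{R}^N)$, with $p=2$ if $N\le 3$ and $p>\frac N2$ if $N\ge 4$. Assume $g\in C(\mathbb{R},\mathbb{R})$ and that there exists $C>0$ with $|g(t)|\le C|t|$ for all $t\in\mathbb{R}$. Suppose $u$ is a weak nontrivial solution of $$-\Delta u+V(x)u=\lambda u+g(u)\ \text{ in }\mathbb{R}^N,\qquad u(x)\to 0\ \text{ as }|x|\to\infty .$$ (i) If $V_1=0$ a.e. on $\mathbb{R}^N$, then $u\in C_B^1(\mathbb{R}^N)$. (ii) Let $\|V_1\|_{L^p}>0$. If $p>N\ge 4$, or $p=2$ and $N=1$, then $u\in C_B^1(\mathbb{R}^N)$. If $\frac N2<p\le N$ with $N\ge 4$, or $p=2$ and $N=3$, then $u\in C_B^0(\mathbb{R}^N)$. If $p=N=2$, then $u\in L^q(\mathbb{R}^N)$ for all $q\in[2,\infty)$.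
   Context: Potentials are real-valued. A weak solution is a function $u\in H^1(\mathbb{R}^N)$ such that $\int_{\mathbb{R}^N}\nabla u\cdot\nabla\varphi+Vu\varphi\,dx=\int_{\mathbb{R}^N}(\lambda u+g(u))\varphi\,dx$ for all $\varphi\in H^1(\mathbb{R}^N)$; nontrivial means $u\neq 0$. For $j\in\mathbb{N}\cup\{0\}$, $$C_B^j(\mathbb{R}^N):=\{u\in C^j(\mathbb{R}^N):\ \nabla^\alpha u\text{ is bounded on }\mathbb{R}^N\text{ for all multi-indices }|\alpha|\le j\}.$$ *)

theory Defs
  imports "HOL-Analysis.Analysis"
begin

text \<open>Elements of \<open>L\<^sup>p\<close> and \<open>H\<^sup>1\<close> are represented by functions; statements about an
  equivalence class, such as membership in a space of continuous functions, are read as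
  statements about some function in the class.\<close>

definition has_representative_in ::
    "('a::euclidean_space \<Rightarrow> real) \<Rightarrow> ('a \<Rightarrow> real) set \<Rightarrow> bool" where
  "has_representative_in u A \<longleftrightarrow> (\<exists>v\<in>A. AE x in lebesgue. v x = u x)"

definition Lp :: "real \<Rightarrow> ('a::euclidean_space \<Rightarrow> real) set" where
  "Lp p = {f \<in> borel_measurable lebesgue. integrable lebesgue (\<lambda>x. \<bar>f x\<bar> powr p)}"

definition Lp_norm :: "real \<Rightarrow> ('a::euclidean_space \<Rightarrow> real) \<Rightarrow> real" where
  "Lp_norm p f = (\<integral>x. \<bar>f x\<bar> powr p \<partial>lebesgue) powr (1 / p)"

definition Linfty :: "('a::euclidean_space \<Rightarrow> real) set" where
  "Linfty = {f \<in> borel_measurable lebesgue. \<exists>M. AE x in lebesgue. \<bar>f x\<bar> \<le> M}"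

definition partial_deriv ::
    "'a::euclidean_space \<Rightarrow> ('a \<Rightarrow> real) \<Rightarrow> 'a \<Rightarrow> real" where
  "partial_deriv b f = (\<lambda>x. frechet_derivative f (at x) b)"

text \<open>A list \<open>bs\<close> of standard basis vectors plays the role of a multi-index of order
  \<open>length bs\<close>; for the functions in \<open>C_k j\<close> the order of differentiation is immaterial
  up to \<open>length bs \<le> j\<close>.\<close>

definition partial_derivs ::
    "'a::euclidean_space list \<Rightarrow> ('a \<Rightarrow> real) \<Rightarrow> 'a \<Rightarrow> real" where
  "partial_derivs bs f = foldr partial_deriv bs f"

definition C_k :: "nat \<Rightarrow> ('a::euclidean_space \<Rightarrow> real) set" where
  "C_k j = {f.
     (\<forall>bs. set bs \<subseteq> Basis \<and> length bs < j \<longrightarrow> partial_derivs bs f differentiable_on UNIV) \<and>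
     (\<forall>bs. set bs \<subseteq> Basis \<and> length bs \<le> j \<longrightarrow> continuous_on UNIV (partial_derivs bs f))}"

definition C_B :: "nat \<Rightarrow> ('a::euclidean_space \<Rightarrow> real) set" where
  "C_B j = {f \<in> C_k j.
     \<forall>bs. set bs \<subseteq> Basis \<and> length bs \<le> j \<longrightarrow> bounded (range (partial_derivs bs f))}"

definition test_functions :: "('a::euclidean_space \<Rightarrow> real) set" where
  "test_functions = {\<phi>. (\<forall>j. \<phi> \<in> C_k j) \<and> compact (closure {x. \<phi> x \<noteq> 0})}"

definition has_weak_gradient ::
    "('a::euclidean_space \<Rightarrow> real) \<Rightarrow> ('a \<Rightarrow> 'a) \<Rightarrow> bool" where
  "has_weak_gradient u G \<longleftrightarrow>
     (\<forall>K. compact K \<longrightarrow> u absolutely_integrable_on K \<and> G absolutely_integrable_on K) \<and>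
     (\<forall>\<phi>\<in>test_functions. \<forall>b\<in>Basis.
        (\<integral>x. u x * partial_deriv b \<phi> x \<partial>lebesgue) = - (\<integral>x. (G x \<bullet> b) * \<phi> x \<partial>lebesgue))"

definition H1 :: "('a::euclidean_space \<Rightarrow> real) set" where
  "H1 = {u \<in> Lp 2. \<exists>G. has_weak_gradient u G \<and> (\<forall>b\<in>Basis. (\<lambda>x. G x \<bullet> b) \<in> Lp 2)}"

text \<open>Weak gradients are unique up to null sets, so quantifying over all of them is the same
  as choosing one.  If \<open>V\<close> is a Kato--Rellich potential and \<open>g\<close> is continuous with linear
  growth, both integrands are integrable for all \<open>u\<close> and \<open>\<phi>\<close> in \<open>H1\<close>, so the value of the
  integral on non-integrable functions plays no role.\<close>

definition weak_solution ::
    "('a::euclidean_space \<Rightarrow> real) \<Rightarrow> real \<Rightarrow> (real \<Rightarrow> real) \<Rightarrow> ('a \<Rightarrow> real) \<Rightarrow> bool" where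
  "weak_solution V l g u \<longleftrightarrow> u \<in> H1 \<and>
     (\<forall>\<phi>\<in>H1. \<forall>Du D\<phi>. has_weak_gradient u Du \<and> has_weak_gradient \<phi> D\<phi> \<longrightarrow>
        (\<integral>x. Du x \<bullet> D\<phi> x + V x * u x * \<phi> x \<partial>lebesgue)
          = (\<integral>x. (l * u x + g (u x)) * \<phi> x \<partial>lebesgue))"

end

theory Submission
  imports Defs
begin

text \<open>Let \<open>\<theta>\<^sub>t\<close> and \<open>\<psi>\<^sub>t\<close> be the dilations (with the factor \<open>t\<close> to the power \<open>- N\<close>) of two radial bumps with
  \<open>\<partial>\<^sub>t \<theta>\<^sub>t = t \<Delta>\<psi>\<^sub>t\<close>. A solution of \<open>- \<Delta>u = f\<close> then satisfies
  \<open>u * \<theta>\<^sub>s = u * \<theta>\<^sub>t + \<integral>\<^sub>s\<^sup>t \<tau> (f * \<psi>\<^sub>\<tau>) d\<tau>\<close>, which replaces the fundamental solution.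
  Here \<open>f = \<lambda>u + g(u) - Vu\<close>, so \<open>\<bar>f\<bar> \<le> Q \<bar>u\<bar>\<close> with \<open>Q = c + \<bar>V\<^sub>1\<bar>\<close>, and \<open>Q\<close> has mass \<open>O(r\<close> to the power
  \<open>N - N/p)\<close> on balls of radius \<open>r\<close>.

  Boundedness: letting \<open>s \<rightarrow> 0\<close> gives \<open>m \<bar>u\<bar> \<le> B + T(Q \<bar>u\<bar>)\<close>, where \<open>m\<close> is the mass of \<open>\<theta>\<close> and \<open>T\<close> is convolution
  with \<open>\<integral>\<^sub>0\<^sup>t \<tau> \<psi>\<^sub>\<tau> d\<tau>\<close>. As \<open>p > N/2\<close>, \<open>TQ \<le> m/2\<close> for small \<open>t\<close>, so \<open>w = max 0 (\<bar>u\<bar> - M)\<close> satisfies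
  \<open>m w \<le> T(Q w)\<close> once \<open>M\<close> is large. Since \<open>T\<close> is symmetric, integrating against \<open>Q\<close> yields
  \<open>\<integral> Q w \<le> 1/2 \<integral> Q w < \<infinity>\<close>, hence \<open>w = 0\<close>.

  Regularity: now \<open>f\<close> obeys the same mass bound as \<open>Q\<close>, so the formula shows that \<open>u * \<theta>\<^sub>s\<close> converges
  uniformly as \<open>s \<rightarrow> 0\<close> if \<open>p > N/2\<close>, and its gradient as well if \<open>p > N\<close>.\<close>

text \<open>The kernel identity is conservation of mass under dilation. For theta_t(z) = t^(-N)
  theta(z/t), t times the t-derivative is - div(z theta_t); if grad psi = - z theta, then grad psi_t
  = - (z / t^2) theta_t, so this divergence is t^2 times the Laplacian of psi_t. Here psi = exp(-1 /
  (1 - |z|^2)) on the unit ball is chosen first and theta is read off from its gradient.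

  The obstacle is the term V_1 u: for u in L^2 it is a product of two unbounded functions, a priori
  only locally integrable. The boundedness argument therefore stays in L^1 with weight Q. Truncation
  at a level M >= 1 makes the weighted integral finite, because where |u| > 1 the product |V_1| |u|
  is at most u^2 + |V_1|^p; finiteness is what permits the final absorption.

  The thresholds on p come from counting powers. At scale tau the potential term has size tau *
  tau^(-N) * tau^(N - N/p) = tau^(1 - N/p), which is integrable at 0 exactly for p > N/2. A
  derivative costs one more factor 1/tau, hence p > N.\<close>

subsection \<open>Smooth bumps\<close>

text \<open>The exponent \<open>k\<close> makes the family closed under differentiation.\<close>

definition flat_exp :: "nat \<Rightarrow> real \<Rightarrow> real" where
  "flat_exp k r = (if r > 0 then exp (- 1 / r) / r ^ k else 0)"

lemma flat_exp_nonneg: "0 \<le> flat_exp k r"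
  by (simp add: flat_exp_def)

lemma flat_exp_eq_0: "r \<le> 0 \<Longrightarrow> flat_exp k r = 0"
  by (simp add: flat_exp_def)

lemma flat_exp_pos: "r > 0 \<Longrightarrow> flat_exp k r > 0"
  by (simp add: flat_exp_def)

text \<open>With s = 1/r the right-hand limit is the decay of s^k exp(-s) at infinity; to the left
  of 0 the function is constantly 0.\<close>

lemma flat_exp_tendsto_0: "(flat_exp k \<longlongrightarrow> 0) (at 0)"
proof -
  have "((\<lambda>r. inverse r ^ k / exp (inverse r)) \<longlongrightarrow> (0::real)) (at_right 0)"
    by (rule filterlim_compose[OF tendsto_power_div_exp_0 filterlim_inverse_at_top_right])
  moreover have "eventually (\<lambda>r::real. inverse r ^ k / exp (inverse r) = flat_exp k r) (at_right 0)"
    unfolding eventually_at_right_field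
    by (intro exI[of _ 1]) (auto simp: flat_exp_def exp_minus field_simps power_inverse)
  ultimately have R: "(flat_exp k \<longlongrightarrow> 0) (at_right 0)"
    by (rule Lim_transform_eventually)
  have "eventually (\<lambda>r::real. 0 = flat_exp k r) (at_left 0)"
    unfolding eventually_at_left_field
    by (intro exI[of _ "-1"]) (auto simp: flat_exp_def)
  then have L: "(flat_exp k \<longlongrightarrow> 0) (at_left 0)"
    by (rule Lim_transform_eventually[OF tendsto_const])
  show ?thesis using L R by (simp add: filterlim_split_at)
qed

lemma DERIV_flat_exp: "(flat_exp k has_real_derivative (flat_exp (k+2) r - real k * flat_exp (k+1) r)) (at r)"
proof -
  consider "r > 0" | "r < 0" | "r = 0" by linarith
  then show ?thesis
  proof cases
    case 1
    have "((\<lambda>r. exp (- 1 / r) / r ^ k) has_real_derivative (flat_exp (k+2) r - real k * flat_exp (k+1) r)) (at r)"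
    \<comment> \<open>Splitting off k = 0 avoids the truncated exponent k - 1 in the derivative of
      the power.\<close>
    proof (cases k)
      case 0
      then show ?thesis using 1
        by (auto intro!: derivative_eq_intros simp: flat_exp_def power2_eq_square)
    next
      case (Suc m)
      have pow: "((\<lambda>r. r ^ Suc m) has_real_derivative real (Suc m) * r ^ m) (at r)"
        using DERIV_pow[of "Suc m" r] by simp
      have "((\<lambda>r. exp (- 1 / r)) has_real_derivative exp (- 1 / r) / r\<^sup>2) (at r)"
        using 1 by (auto intro!: derivative_eq_intros simp: power2_eq_square)
      from DERIV_divide[OF this pow] 1 have
        "((\<lambda>r. exp (- 1 / r) / r ^ Suc m) has_real_derivative
          (exp (- 1 / r) / r\<^sup>2 * r ^ Suc m - exp (- 1 / r) * (real (Suc m) * r ^ m)) / (r ^ Suc m * r ^ Suc m)) (at r)"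
        by simp
      then show ?thesis unfolding Suc
        by (rule DERIV_cong) (use 1 in \<open>simp add: flat_exp_def field_simps power2_eq_square\<close>)
    qed
    then show ?thesis
      by (rule has_field_derivative_transform_within_open[where S="{0<..}"]) (use 1 in \<open>auto simp: flat_exp_def\<close>)
  next
    case 2
    have "((\<lambda>r. 0) has_real_derivative (flat_exp (k+2) r - real k * flat_exp (k+1) r)) (at r)"
      using 2 by (simp add: flat_exp_eq_0)
    then show ?thesis
      by (rule has_field_derivative_transform_within_open[where S="{..<0}"]) (use 2 in \<open>auto simp: flat_exp_def\<close>)
  next
    case 3
    \<comment> \<open>At the origin the difference quotient of \<open>flat_exp k\<close> is
      \<open>flat_exp (k+1)\<close> itself, so the limit already proved, one exponent higher, is the
      derivative.\<close>
    have "eventually (\<lambda>h::real. flat_exp (k+1) h = (flat_exp k (0 + h) - flat_exp k 0) / h) (at 0)"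
      by (auto simp: flat_exp_def eventually_at_filter field_simps intro!: always_eventually)
    then have "((\<lambda>h. (flat_exp k (0 + h) - flat_exp k 0) / h) \<longlongrightarrow> 0) (at 0)"
      by (rule Lim_transform_eventually[OF flat_exp_tendsto_0])
    then show ?thesis using 3 by (simp add: DERIV_def flat_exp_eq_0)
  qed
qed

lemmas DERIV_flat_exp' [derivative_intros] = DERIV_chain2[OF DERIV_flat_exp]

lemma isCont_flat_exp: "isCont (flat_exp k) r"
  using DERIV_flat_exp DERIV_isCont by blast

lemma continuous_on_flat_exp [continuous_intros]:
  "continuous_on S f \<Longrightarrow> continuous_on S (\<lambda>x. flat_exp k (f x))"
  using continuous_on_compose2[of UNIV "flat_exp k" S f] isCont_flat_exp
  by (simp add: continuous_at_imp_continuous_on)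

lemma flat_exp_measurable [measurable]: "flat_exp k \<in> borel_measurable borel"
  by (intro borel_measurable_continuous_onI continuous_intros)

text \<open>Only arguments 1 - |z|^2 / t^2 occur later, and these never exceed 1; compactness of
  [0,1] then suffices.\<close>

lemma flat_exp_bounded: "\<exists>B. \<forall>r\<le>1. \<bar>flat_exp k r\<bar> \<le> B"
proof -
  have "compact (flat_exp k ` {0..1})"
    by (intro compact_continuous_image continuous_intros) auto
  then obtain B where B: "\<And>r. r \<in> {0..1} \<Longrightarrow> \<bar>flat_exp k r\<bar> \<le> B"
    by (metis bounded_iff compact_imp_bounded image_eqI real_norm_def)
  then have "\<bar>flat_exp k r\<bar> \<le> B" if "r \<le> 1" for r
    using B[of r] B[of 0] that by (cases "r \<ge> 0") (auto simp: flat_exp_eq_0)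
  then show ?thesis by blast
qed

lemma partial_deriv_eq: "(f has_derivative D) (at x) \<Longrightarrow> partial_deriv b f x = D b"
  unfolding partial_deriv_def using frechet_derivative_at by metis

text \<open>This algebra is closed under partial derivatives, so all its members are smooth.\<close>

inductive_set smooth_gen :: "('a::euclidean_space \<Rightarrow> real) set" where
  const: "(\<lambda>_. c) \<in> smooth_gen"
| coord: "(\<lambda>x. x \<bullet> b) \<in> smooth_gen"
| bump: "(\<lambda>x. flat_exp k (1 - c * (norm (a - x))\<^sup>2)) \<in> smooth_gen"
| add: "f \<in> smooth_gen \<Longrightarrow> g \<in> smooth_gen \<Longrightarrow> (\<lambda>x. f x + g x) \<in> smooth_gen"
| mult: "f \<in> smooth_gen \<Longrightarrow> g \<in> smooth_gen \<Longrightarrow> (\<lambda>x. f x * g x) \<in> smooth_gen"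

lemma has_derivative_flat_exp_norm:
  fixes a :: "'a::euclidean_space"
  shows "((\<lambda>x. flat_exp k (1 - c * (norm (a - x))\<^sup>2)) has_derivative
    (\<lambda>h. (flat_exp (k+2) (1 - c * (norm (a - x))\<^sup>2) - real k * flat_exp (k+1) (1 - c * (norm (a - x))\<^sup>2))
        * (2 * c * ((a - x) \<bullet> h)))) (at x)"
proof -
  have "((\<lambda>x. 1 - c * (norm (a - x))\<^sup>2) has_derivative (\<lambda>h. 2 * c * ((a - x) \<bullet> h))) (at x)"
    unfolding power2_norm_eq_inner
    by (auto intro!: derivative_eq_intros simp: inner_commute algebra_simps)
  from has_derivative_compose[OF this DERIV_flat_exp[unfolded has_field_derivative_def]]
  show ?thesis by (simp add: algebra_simps)
qed

lemma smooth_gen_deriv: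
  assumes "f \<in> smooth_gen"
  shows "\<exists>D. \<forall>x. (f has_derivative D x) (at x) \<and> (\<forall>b. (\<lambda>x. D x b) \<in> smooth_gen)"
  using assms
proof induction
  case (const c)
  show ?case by (intro exI[of _ "\<lambda>_ _. 0"]) (auto intro: smooth_gen.const)
next
  case (coord b)
  show ?case by (intro exI[of _ "\<lambda>_ h. h \<bullet> b"]) (auto intro!: derivative_eq_intros smooth_gen.const)
next
  case (bump k c a)
  \<comment> \<open>Differences are rewritten as sums with factors - k and -1, so that the
    generating rules of the algebra apply literally.\<close>
  have "(\<lambda>x. (flat_exp (k+2) (1 - c * (norm (a - x))\<^sup>2) + (- real k) * flat_exp (k+1) (1 - c * (norm (a - x))\<^sup>2))
        * (2 * c * (a \<bullet> b + (-1) * (x \<bullet> b)))) \<in> smooth_gen" for b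
    by (intro smooth_gen.intros)
  then have "(\<lambda>x. (flat_exp (k+2) (1 - c * (norm (a - x))\<^sup>2) - real k * flat_exp (k+1) (1 - c * (norm (a - x))\<^sup>2))
        * (2 * c * ((a - x) \<bullet> b))) \<in> smooth_gen" for b
    by (simp add: inner_diff_left)
  then show ?case
    using has_derivative_flat_exp_norm[of k c a] by (intro exI allI conjI)
next
  case (add f g)
  then obtain D E where "\<forall>x. (f has_derivative D x) (at x) \<and> (\<forall>b. (\<lambda>x. D x b) \<in> smooth_gen)"
    "\<forall>x. (g has_derivative E x) (at x) \<and> (\<forall>b. (\<lambda>x. E x b) \<in> smooth_gen)" by metis
  then show ?case
    by (intro exI[of _ "\<lambda>x h. D x h + E x h"]) (auto intro!: has_derivative_add smooth_gen.add)
next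
  case (mult f g)
  then obtain D E where "\<forall>x. (f has_derivative D x) (at x) \<and> (\<forall>b. (\<lambda>x. D x b) \<in> smooth_gen)"
    "\<forall>x. (g has_derivative E x) (at x) \<and> (\<forall>b. (\<lambda>x. E x b) \<in> smooth_gen)" by metis
  with mult.hyps show ?case
    by (intro exI[of _ "\<lambda>x h. f x * E x h + D x h * g x"]) 
      (auto intro!: has_derivative_mult smooth_gen.add smooth_gen.mult)
qed

lemma smooth_gen_differentiable: "f \<in> smooth_gen \<Longrightarrow> f differentiable at x"
  using smooth_gen_deriv differentiable_def by metis

lemma smooth_gen_partial_deriv:
  assumes "f \<in> smooth_gen" shows "partial_deriv b f \<in> smooth_gen"
proof -
  obtain D where D: "\<forall>x. (f has_derivative D x) (at x) \<and> (\<forall>b. (\<lambda>x. D x b) \<in> smooth_gen)"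
    using smooth_gen_deriv[OF assms] ..
  then have "partial_deriv b f = (\<lambda>x. D x b)" by (auto simp: partial_deriv_eq)
  with D show ?thesis by simp
qed

lemma smooth_gen_partial_derivs: "f \<in> smooth_gen \<Longrightarrow> partial_derivs bs f \<in> smooth_gen"
  by (induction bs) (auto simp: partial_derivs_def smooth_gen_partial_deriv)

lemma smooth_gen_C_k: "f \<in> smooth_gen \<Longrightarrow> f \<in> C_k j"
  unfolding C_k_def
  by (auto simp: differentiable_on_def intro!: differentiable_at_withinI smooth_gen_differentiable
    smooth_gen_partial_derivs differentiable_imp_continuous_on)

subsection \<open>The two kernels\<close>

text \<open>The profiles are chosen so that \<open>\<partial>\<^sub>t mollifier t = t \<cdot> \<Delta> (potential t)\<close>: the gradient of
  \<open>potential 1\<close> at \<open>z\<close> is \<open>- mollifier 1 z\<close> times \<open>z\<close>.\<close>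

definition mollifier :: "real \<Rightarrow> 'a::euclidean_space \<Rightarrow> real" where
  "mollifier t z = 2 / t ^ DIM('a) * flat_exp 2 (1 - (norm z)\<^sup>2 / t\<^sup>2)"

definition potential :: "real \<Rightarrow> 'a::euclidean_space \<Rightarrow> real" where
  "potential t z = flat_exp 0 (1 - (norm z)\<^sup>2 / t\<^sup>2) / t ^ DIM('a)"

text \<open>The common value of the two sides of the kernel identity, computed separately in
  \<open>DERIV_mollifier\<close> and \<open>potential_laplacian\<close>. The explicit formula makes
  joint measurability and joint continuity in t and z immediate.\<close>

definition mollifier_deriv :: "real \<Rightarrow> 'a::euclidean_space \<Rightarrow> real" where
  "mollifier_deriv t z = (4 * (norm z)\<^sup>2 / t ^ 3 * (flat_exp 4 (1 - (norm z)\<^sup>2 / t\<^sup>2) - 2 * flat_exp 3 (1 - (norm z)\<^sup>2 / t\<^sup>2))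
     - 2 * DIM('a) / t * flat_exp 2 (1 - (norm z)\<^sup>2 / t\<^sup>2)) / t ^ DIM('a)"

lemma DERIV_mollifier:
  assumes "t > 0"
  shows "((\<lambda>t. mollifier t (z::'a::euclidean_space)) has_real_derivative mollifier_deriv t z) (at t)"
proof -
  have "((\<lambda>t. 1 - (norm z)\<^sup>2 / t\<^sup>2) has_real_derivative 2 * (norm z)\<^sup>2 / t ^ 3) (at t)"
    using assms by (auto intro!: derivative_eq_intros simp: field_simps eval_nat_numeral)
  from DERIV_flat_exp'[OF this, of 2]
  have 1: "((\<lambda>t. flat_exp 2 (1 - (norm z)\<^sup>2 / t\<^sup>2)) has_real_derivative
    (flat_exp 4 (1 - (norm z)\<^sup>2 / t\<^sup>2) - 2 * flat_exp 3 (1 - (norm z)\<^sup>2 / t\<^sup>2)) * (2 * (norm z)\<^sup>2 / t ^ 3)) (at t)"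
    by (simp add: mult.commute)
  have 2: "((\<lambda>t. 2 / t ^ DIM('a)) has_real_derivative - 2 * real DIM('a) / t / t ^ DIM('a)) (at t)"
  proof -
    obtain m where m: "DIM('a) = Suc m" using DIM_positive[where 'a='a] gr0_implies_Suc by blast
    have "((\<lambda>t. t ^ Suc m) has_real_derivative real (Suc m) * t ^ m) (at t)"
      using DERIV_pow[of "Suc m" t] by simp
    from DERIV_divide[OF DERIV_const[of 2] this] assms have
      "((\<lambda>t. 2 / t ^ Suc m) has_real_derivative
        (0 * t ^ Suc m - 2 * (real (Suc m) * t ^ m)) / (t ^ Suc m * t ^ Suc m)) (at t)"
      by simp
    then show ?thesis unfolding m
      by (rule DERIV_cong) (use assms in \<open>simp add: field_simps\<close>)
  qed
  show ?thesis unfolding mollifier_def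
    by (rule DERIV_cong[OF DERIV_mult[OF 2 1]]) (use assms in \<open>simp add: mollifier_deriv_def field_simps\<close>)
qed

text \<open>For exponent 0 the second term in the derivative of \<open>flat_exp\<close> drops out,
  which leaves the profile \<open>flat_exp 2\<close> of \<open>mollifier\<close>; its factor 2 comes
  from differentiating the squared norm.\<close>

lemma potential_partial:
  "partial_deriv b (\<lambda>y. potential t (x - y)) y
     = 2 / t\<^sup>2 / t ^ DIM('a) * flat_exp 2 (1 - (norm (x - y))\<^sup>2 / t\<^sup>2) * ((x - y) \<bullet> (b::'a::euclidean_space))"
proof -
  have "((\<lambda>y. potential t (x - y)) has_derivative (\<lambda>h. inverse (t ^ DIM('a)) *
      (flat_exp 2 (1 - inverse (t\<^sup>2) * (norm (x - y))\<^sup>2) * (2 * inverse (t\<^sup>2) * ((x - y) \<bullet> h))))) (at y)"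
    using has_derivative_mult_right[OF has_derivative_flat_exp_norm[of 0 "inverse (t\<^sup>2)" x y], of "inverse (t ^ DIM('a))"]
    unfolding potential_def by (simp add: field_simps numeral_2_eq_2)
  from partial_deriv_eq[OF this, of b] show ?thesis by (simp add: field_simps)
qed

lemma potential_partial2:
  fixes x y b :: "'a::euclidean_space"
  shows "partial_deriv b (partial_deriv b (\<lambda>y. potential t (x - y))) y = 2 / t\<^sup>2 / t ^ DIM('a) *
    ((flat_exp 4 (1 - (norm (x - y))\<^sup>2 / t\<^sup>2) - 2 * flat_exp 3 (1 - (norm (x - y))\<^sup>2 / t\<^sup>2)) * (2 / t\<^sup>2 * ((x - y) \<bullet> b)\<^sup>2)
     - flat_exp 2 (1 - (norm (x - y))\<^sup>2 / t\<^sup>2) * (b \<bullet> b))"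
proof -
  let ?c = "inverse (t\<^sup>2)"
  have four: "Suc (Suc (Suc (Suc 0))) = 4" by simp
  have eq: "partial_deriv b (\<lambda>y. potential t (x - y)) = (\<lambda>y. 2 / t\<^sup>2 / t ^ DIM('a) *
     (flat_exp 2 (1 - ?c * (norm (x - y))\<^sup>2) * ((x - y) \<bullet> b)))"
    by (auto simp: potential_partial field_simps)
  have "((\<lambda>y. (x - y) \<bullet> b) has_derivative (\<lambda>h. - (h \<bullet> b))) (at y)"
    by (auto intro!: derivative_eq_intros)
  from partial_deriv_eq[OF has_derivative_mult_right[OF has_derivative_mult[OF has_derivative_flat_exp_norm[of 2 ?c x y] this], of "2 / t\<^sup>2 / t ^ DIM('a)"], of b]
  show ?thesis unfolding eq by (simp add: field_simps power2_eq_square numeral_3_eq_3 four)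
qed

lemma potential_laplacian:
  fixes x y :: "'a::euclidean_space"
  assumes "t > 0"
  shows "t * (\<Sum>b\<in>Basis. partial_deriv b (partial_deriv b (\<lambda>y. potential t (x - y))) y) = mollifier_deriv t (x - y)"
proof -
  let ?A = "flat_exp 4 (1 - (norm (x - y))\<^sup>2 / t\<^sup>2) - 2 * flat_exp 3 (1 - (norm (x - y))\<^sup>2 / t\<^sup>2)"
  let ?B = "flat_exp 2 (1 - (norm (x - y))\<^sup>2 / t\<^sup>2)"
  have n: "(\<Sum>b\<in>Basis. ((x - y) \<bullet> b)\<^sup>2) = (norm (x - y))\<^sup>2"
    unfolding power2_norm_eq_inner by (subst euclidean_inner) (simp add: power2_eq_square)
  have "(\<Sum>b\<in>Basis. partial_deriv b (partial_deriv b (\<lambda>y. potential t (x - y))) y)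
      = (\<Sum>b\<in>Basis. 2 / t\<^sup>2 / t ^ DIM('a) * (?A * (2 / t\<^sup>2)) * ((x - y) \<bullet> b)\<^sup>2 - 2 / t\<^sup>2 / t ^ DIM('a) * ?B)"
    by (intro sum.cong refl) (simp add: potential_partial2 algebra_simps)
  also have "\<dots> = 2 / t\<^sup>2 / t ^ DIM('a) * (?A * (2 / t\<^sup>2)) * (norm (x - y))\<^sup>2 - DIM('a) * (2 / t\<^sup>2 / t ^ DIM('a) * ?B)"
    unfolding sum_subtractf sum_distrib_left[symmetric] n by simp
  finally have *: "(\<Sum>b\<in>Basis. partial_deriv b (partial_deriv b (\<lambda>y. potential t (x - y))) y) = \<dots>" .
  \<comment> \<open>Stated for arbitrary reals so that clearing denominators does not touch the bump
    functions.\<close>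
  have alg: "t * (2 / t\<^sup>2 / T * (A * (2 / t\<^sup>2)) * n - N * (2 / t\<^sup>2 / T * B))
      = (4 * n / t ^ 3 * A - 2 * N / t * B) / T" if "T \<noteq> 0" for A B T N n :: real
    using assms that by (simp add: field_simps eval_nat_numeral)
  show ?thesis unfolding * mollifier_deriv_def of_nat_mult of_nat_numeral by (rule alg) (use assms in simp)
qed

lemma bump_argument_nonpos: "0 < t \<Longrightarrow> t \<le> norm z \<Longrightarrow> 1 - (norm z)\<^sup>2 / t\<^sup>2 \<le> 0"
  by (simp add: field_simps)

lemma mollifier_eq_0: "0 < t \<Longrightarrow> t \<le> norm z \<Longrightarrow> mollifier t z = 0"
  and potential_eq_0: "0 < t \<Longrightarrow> t \<le> norm z \<Longrightarrow> potential t z = 0"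
  and mollifier_deriv_eq_0: "0 < t \<Longrightarrow> t \<le> norm z \<Longrightarrow> mollifier_deriv t z = 0"
  using bump_argument_nonpos[of t z] by (auto simp: mollifier_def potential_def mollifier_deriv_def flat_exp_eq_0)

lemma mollifier_nonneg: "0 < t \<Longrightarrow> 0 \<le> mollifier t z"
  and potential_nonneg: "0 < t \<Longrightarrow> 0 \<le> potential t z"
  by (auto simp: mollifier_def potential_def flat_exp_nonneg)

lemma potential_smooth: "(\<lambda>y. potential t (x - y)) \<in> smooth_gen"
proof -
  have "(\<lambda>y. inverse (t ^ DIM('a)) * flat_exp 0 (1 - inverse (t\<^sup>2) * (norm (x - y))\<^sup>2)) \<in> smooth_gen"
    by (intro smooth_gen.intros)
  then show ?thesis by (simp add: potential_def field_simps)
qed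

lemma mollifier_smooth: "mollifier t \<in> smooth_gen"
proof -
  have "(\<lambda>y::'a. (2 * inverse (t ^ DIM('a))) * flat_exp 2 (1 - inverse (t\<^sup>2) * (norm (0 - y))\<^sup>2)) \<in> smooth_gen"
    by (intro smooth_gen.intros)
  then show ?thesis by (simp add: mollifier_def[abs_def] field_simps)
qed

lemma compact_supportI:
  assumes "\<And>y. r \<le> norm (x - y) \<Longrightarrow> f y = 0"
  shows "compact (closure {y::'a::euclidean_space. f y \<noteq> 0})"
proof -
  have "{y. f y \<noteq> 0} \<subseteq> cball x r" using assms by (force simp: dist_norm)
  then show ?thesis
    by (meson bounded_cball bounded_subset compact_closure)
qed

lemma potential_test_function: "t > 0 \<Longrightarrow> (\<lambda>y. potential t (x - y)) \<in> test_functions"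
  unfolding test_functions_def
  by (auto intro!: smooth_gen_C_k potential_smooth compact_supportI[of t x] potential_eq_0 simp del: compact_closure)

subsection \<open>Convolution with compactly supported kernels\<close>

text \<open>Borel rather than Lebesgue measurability, because translations and Fubini are carried
  out on \<open>lborel\<close>; \<open>Lp_borel\<close> supplies suitable representatives.\<close>

definition loc_integrable :: "('a::euclidean_space \<Rightarrow> real) \<Rightarrow> bool" where
  "loc_integrable w \<longleftrightarrow> w \<in> borel_measurable borel \<and> (\<forall>x r. set_integrable lborel (cball x r) w)"

text \<open>Regularity of the right-hand side enters only through the growth of this quantity as r
  tends to 0, a Morrey-type condition.\<close>

definition ball_mass :: "('a::euclidean_space \<Rightarrow> real) \<Rightarrow> 'a \<Rightarrow> real \<Rightarrow> real" where
  "ball_mass w x r = (LINT y:cball x r|lborel. \<bar>w y\<bar>)"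

definition convolve :: "('a::euclidean_space \<Rightarrow> real) \<Rightarrow> ('a \<Rightarrow> real) \<Rightarrow> 'a \<Rightarrow> real" where
  "convolve k w x = (\<integral>y. k (x - y) * w y \<partial>lborel)"

lemma loc_integrable_measurable: "loc_integrable w \<Longrightarrow> w \<in> borel_measurable borel"
  by (simp add: loc_integrable_def)

lemma loc_integrable_1: "loc_integrable (\<lambda>_. 1)"
  unfolding loc_integrable_def set_integrable_def
  by (auto intro!: integrable_real_indicator emeasure_lborel_cball_finite)

lemma loc_integrable_abs: "loc_integrable w \<Longrightarrow> set_integrable lborel (cball x r) (\<lambda>y. \<bar>w y\<bar>)"
  unfolding loc_integrable_def by (simp add: set_integrable_abs)

lemma ball_mass_nonneg: "0 \<le> ball_mass w x r"
  unfolding ball_mass_def set_lebesgue_integral_def by simp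

lemma ball_mass_mono:
  assumes "loc_integrable w" "r \<le> s" shows "ball_mass w x r \<le> ball_mass w x s"
  unfolding ball_mass_def set_lebesgue_integral_def
  using loc_integrable_abs[OF assms(1)] assms(2) unfolding set_integrable_def
  by (intro integral_mono) (auto simp: indicator_def)

text \<open>A kernel supported at scale r sees only the ball of radius r around x. All pointwise
  estimates of real-valued convolutions with locally integrable functions below reduce to this
  one.\<close>

lemma convolve_integrable_bound:
  assumes k[measurable]: "k \<in> borel_measurable borel" and B: "\<And>z. \<bar>k z\<bar> \<le> B"
    and r: "\<And>z. r < norm z \<Longrightarrow> k z = 0" and w: "loc_integrable w"
  shows "integrable lborel (\<lambda>y. k (x - y) * w y)" "\<bar>convolve k w x\<bar> \<le> B * ball_mass w x r"
proof -
  note [measurable] = loc_integrable_measurable[OF w]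
  have i: "integrable lborel (\<lambda>y. B * (indicator (cball x r) y *\<^sub>R \<bar>w y\<bar>))"
    using loc_integrable_abs[OF w, of x r] unfolding set_integrable_def by (intro integrable_mult_right)
  have le: "\<bar>k (x - y) * w y\<bar> \<le> B * (indicator (cball x r) y *\<^sub>R \<bar>w y\<bar>)" for y
    using B[of "x - y"] r[of "x - y"]
    by (auto simp: indicator_def abs_mult dist_norm mult_right_mono not_le)
  show int: "integrable lborel (\<lambda>y. k (x - y) * w y)"
  proof (rule Bochner_Integration.integrable_bound[OF i])
    show "AE y in lborel. norm (k (x - y) * w y) \<le> norm (B * (indicator (cball x r) y *\<^sub>R \<bar>w y\<bar>))"
      using le by (intro AE_I2) (metis abs_ge_self order_trans real_norm_def)
  qed measurable
  have "\<bar>convolve k w x\<bar> \<le> (\<integral>y. \<bar>k (x - y) * w y\<bar> \<partial>lborel)"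
    unfolding convolve_def using integral_norm_bound[of lborel "\<lambda>y. k (x - y) * w y"] by simp
  also have "\<dots> \<le> (\<integral>y. B * (indicator (cball x r) y *\<^sub>R \<bar>w y\<bar>) \<partial>lborel)"
    using int i le by (intro integral_mono) auto
  also have "\<dots> = B * ball_mass w x r"
    unfolding ball_mass_def set_lebesgue_integral_def by (rule integral_mult_right_zero)
  finally show "\<bar>convolve k w x\<bar> \<le> B * ball_mass w x r" .
qed

lemma bounded_of_compact_support:
  fixes k :: "'a::euclidean_space \<Rightarrow> real"
  assumes k: "continuous_on UNIV k" and r: "\<And>z. r < norm z \<Longrightarrow> k z = 0"
  obtains B where "\<And>z. \<bar>k z\<bar> \<le> B" "0 \<le> B"
proof -
  have "compact (k ` cball 0 r)"
    by (intro compact_continuous_image continuous_on_subset[OF k]) auto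
  then obtain B where B: "0 < B" "\<And>z. z \<in> cball 0 r \<Longrightarrow> \<bar>k z\<bar> \<le> B"
    by (metis bounded_pos compact_imp_bounded image_eqI real_norm_def)
  have "\<bar>k z\<bar> \<le> B" for z
    using B r[of z] by (cases "r < norm z") (auto simp: not_less)
  with B that show ?thesis by force
qed

lemma integrable_compact_support:
  fixes k :: "'a::euclidean_space \<Rightarrow> real"
  assumes k: "continuous_on UNIV k" and r: "\<And>z. r < norm z \<Longrightarrow> k z = 0"
  shows "integrable lborel k"
proof -
  have "integrable lborel (\<lambda>x. indicator (cball 0 r) x *\<^sub>R k x)"
    by (intro borel_integrable_compact continuous_on_subset[OF k]) auto
  moreover have "(\<lambda>x. indicator (cball 0 r) x *\<^sub>R k x) = k"
  proof
    fix x show "indicator (cball 0 r) x *\<^sub>R k x = k x"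
      using r[of x] by (cases "r < norm x") auto
  qed
  ultimately show ?thesis by simp
qed

lemma gradient_support:
  fixes k :: "'a::euclidean_space \<Rightarrow> real"
  assumes d: "(k has_derivative (\<lambda>h. g z \<bullet> h)) (at z)" and r: "\<And>z. r < norm z \<Longrightarrow> k z = 0" and z: "r < norm z"
  shows "g z = 0"
proof -
  have "open {z::'a. r < norm z}" by (intro open_Collect_less continuous_intros)
  then have "(k has_derivative (\<lambda>h. 0)) (at z)"
    by (intro has_derivative_transform_within_open[OF has_derivative_const[of 0]]) (use z r in auto)
  then have "(\<lambda>h. g z \<bullet> h) = (\<lambda>h. 0)" by (rule has_derivative_unique[OF d])
  then show ?thesis by (metis inner_eq_zero_iff)
qed

text \<open>Mean value inequality with the modulus of continuity of the gradient. The point is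
  uniformity in z: the error can then be integrated against a merely locally integrable
  function.\<close>

lemma uniform_linearization:
  fixes k :: "'a::euclidean_space \<Rightarrow> real"
  assumes d: "\<And>z. (k has_derivative (\<lambda>h. g z \<bullet> h)) (at z)" and g: "continuous_on UNIV g"
    and r: "\<And>z. r < norm z \<Longrightarrow> k z = 0" and e: "e > 0"
  obtains \<delta> where "\<delta> > 0" "\<And>z h. norm h < \<delta> \<Longrightarrow> \<bar>k (z + h) - k z - g z \<bullet> h\<bar> \<le> e * norm h"
proof -
  \<comment> \<open>This ball contains every point within distance 1 of some z with norm at most r +
    1; for larger z both z and z + h lie outside the support.\<close>
  have "uniformly_continuous_on (cball 0 (r + 2)) g"
    by (intro compact_uniformly_continuous continuous_on_subset[OF g]) auto
  then obtain d' where d': "d' > 0"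
    "\<And>x y. x \<in> cball 0 (r + 2) \<Longrightarrow> y \<in> cball 0 (r + 2) \<Longrightarrow> dist y x < d' \<Longrightarrow> dist (g y) (g x) < e"
    using e unfolding uniformly_continuous_on_def by metis
  have "\<bar>k (z + h) - k z - g z \<bullet> h\<bar> \<le> e * norm h" if h: "norm h < min d' 1" for z h
  proof (cases "norm z \<le> r + 1")
    case True
    let ?S = "ball z (min d' 1)"
    have "norm (k (z + h) - k z - g z \<bullet> (z + h - z)) \<le> norm (z + h - z) * e"
    proof (rule differentiable_bound_linearization[where S="?S" and f'="\<lambda>x h. g x \<bullet> h" and ?x0.0=z])
      show "z + t *\<^sub>R (z + h - z) \<in> ?S" if "t \<in> {0..1}" for t
      proof -
        have "norm (t *\<^sub>R h) \<le> norm h" using that by (auto simp: mult_left_le_one_le)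
        then show ?thesis using h by (simp add: dist_norm del: norm_scaleR)
      qed
      show "(k has_derivative (\<bullet>) (g x)) (at x within ?S)" for x
        using d[of x] by (rule has_derivative_at_withinI)
      show "onorm ((\<bullet>) (g x) - (\<bullet>) (g z)) \<le> e" if "x \<in> ?S" for x
      proof (rule onorm_le)
        fix v
        have "norm x \<le> norm z + 1" using that norm_triangle_ineq2[of x z] by (auto simp: dist_norm norm_minus_commute)
        then have "dist (g x) (g z) < e" using True that by (intro d') (auto simp: dist_commute)
        then have "\<bar>(g x - g z) \<bullet> v\<bar> \<le> e * norm v"
          using Cauchy_Schwarz_ineq2[of "g x - g z" v]
          by (smt (verit) dist_norm mult_right_mono norm_ge_zero)
        then show "norm (((\<bullet>) (g x) - (\<bullet>) (g z)) v) \<le> e * norm v"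
          by (simp add: inner_diff_left)
      qed
      show "z \<in> ?S" using d' by simp
    qed
    then show ?thesis by (simp add: mult.commute)
  next
    case False
    then have "r < norm z" "r < norm (z + h)"
      using h norm_triangle_ineq2[of z "-h"] by auto
    moreover have "g z = 0"
      using \<open>r < norm z\<close> by (intro gradient_support[of k g z r] d r)
    ultimately show ?thesis using r e by simp
  qed
  then show ?thesis using that[of "min d' 1"] d' by auto
qed

text \<open>Makes the dependence on h an explicit sum over \<open>Basis\<close>, which is visibly
  bounded linear.\<close>

lemma convolve_inner:
  assumes g: "continuous_on UNIV g" and r: "\<And>z. r < norm z \<Longrightarrow> g z = 0" and w: "loc_integrable w"
  shows "convolve (\<lambda>z. g z \<bullet> h) w x = (\<Sum>b\<in>Basis. convolve (\<lambda>z. g z \<bullet> b) w x * (h \<bullet> b))"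
proof -
  have i: "integrable lborel (\<lambda>y. (g (x - y) \<bullet> b) * w y)" for b
  proof -
    obtain B where "\<And>z. \<bar>g z \<bullet> b\<bar> \<le> B" "0 \<le> B"
    proof (rule bounded_of_compact_support[of "\<lambda>z. g z \<bullet> b" r])
      show "continuous_on UNIV (\<lambda>z. g z \<bullet> b)" by (intro continuous_intros g)
    qed (auto simp: r)
    then show ?thesis
      by (intro convolve_integrable_bound(1)[where r=r and B=B] w borel_measurable_continuous_onI continuous_intros g)
        (auto simp: r)
  qed
  have "(g z \<bullet> h) * c = (\<Sum>b\<in>Basis. (g z \<bullet> b) * c * (h \<bullet> b))" for z c
    using euclidean_inner[of "g z" h] by (simp add: sum_distrib_left sum_distrib_right mult.commute mult.left_commute)
  then have "convolve (\<lambda>z. g z \<bullet> h) w x = (\<integral>y. (\<Sum>b\<in>Basis. (g (x - y) \<bullet> b) * w y * (h \<bullet> b)) \<partial>lborel)"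
    unfolding convolve_def by simp
  then show ?thesis
    by (simp add: convolve_def i)
qed

text \<open>The derivative falls on the kernel, so w may be rough. The linearization error is itself
  a kernel, small relative to |h| and supported in radius r + 1, to which
  \<open>convolve_integrable_bound\<close> applies.\<close>

lemma convolve_has_derivative:
  fixes k w :: "'a::euclidean_space \<Rightarrow> real"
  assumes d: "\<And>z. (k has_derivative (\<lambda>h. g z \<bullet> h)) (at z)" and g: "continuous_on UNIV g"
    and r: "\<And>z. r < norm z \<Longrightarrow> k z = 0" and w: "loc_integrable w"
  shows "(convolve k w has_derivative (\<lambda>h. \<Sum>b\<in>Basis. convolve (\<lambda>z. g z \<bullet> b) w x * (h \<bullet> b))) (at x)"
  unfolding has_derivative_at_alt
proof (intro conjI allI impI)
  show "bounded_linear (\<lambda>h. \<Sum>b\<in>Basis. convolve (\<lambda>z. g z \<bullet> b) w x * (h \<bullet> b))"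
    by (intro bounded_linear_intros)
  fix e :: real assume e: "e > 0"
  let ?m = "ball_mass w x (r + 1)"
  have gr: "g z = 0" if "r < norm z" for z using that by (intro gradient_support[of k g z r] d r)
  \<comment> \<open>The mass is enlarged by 1 so that the division is legitimate even when it
    vanishes.\<close>
  obtain \<delta> where \<delta>: "\<delta> > 0" "\<And>z h. norm h < \<delta> \<Longrightarrow> \<bar>k (z + h) - k z - g z \<bullet> h\<bar> \<le> e / (?m + 1) * norm h"
  proof (rule uniform_linearization[of k g r "e / (?m + 1)"])
    show "0 < e / (?m + 1)" using e ball_mass_nonneg[of w x "r+1"] by simp
  qed (use d g r in auto)
  have k: "continuous_on UNIV k"
    using d by (meson differentiable_def differentiable_imp_continuous_on differentiable_on_def has_derivative_at_withinI)
  have "\<bar>convolve k w y - convolve k w x - (\<Sum>b\<in>Basis. convolve (\<lambda>z. g z \<bullet> b) w x * ((y - x) \<bullet> b))\<bar> \<le> e * norm (y - x)"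
    if y: "norm (y - x) < min \<delta> 1" for y
  proof -
    define h where "h = y - x"
    let ?K = "\<lambda>z. k (z + h) - k z - g z \<bullet> h"
    have hr: "r < norm (z + h)" if "r + 1 < norm z" for z
      using y[folded h_def] that norm_diff_ineq[of z h] by simp
    obtain B1 where "\<And>z. \<bar>k z\<bar> \<le> B1" using bounded_of_compact_support[of k r] k r by blast
    then have i1: "integrable lborel (\<lambda>y. k (x + h - y) * w y)" "integrable lborel (\<lambda>y. k (x - y) * w y)"
      by (intro convolve_integrable_bound(1)[where r=r and B=B1] w borel_measurable_continuous_onI k; auto simp: r)+
    obtain B2 where "\<And>z. \<bar>g z \<bullet> h\<bar> \<le> B2"
    proof (rule bounded_of_compact_support[of "\<lambda>z. g z \<bullet> h" r])
      show "continuous_on UNIV (\<lambda>z. g z \<bullet> h)" by (intro continuous_intros g)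
    qed (auto simp: gr)
    then have i2: "integrable lborel (\<lambda>y. (g (x - y) \<bullet> h) * w y)"
      by (intro convolve_integrable_bound(1)[where r=r and B=B2] w borel_measurable_continuous_onI continuous_intros g)
        (auto simp: gr)
    have "convolve ?K w x = convolve k w (x + h) - convolve k w x - convolve (\<lambda>z. g z \<bullet> h) w x"
      unfolding convolve_def using i1 i2 by (simp add: left_diff_distrib algebra_simps)
    also have "\<dots> = convolve k w y - convolve k w x - (\<Sum>b\<in>Basis. convolve (\<lambda>z. g z \<bullet> b) w x * ((y - x) \<bullet> b))"
      using convolve_inner[of g r w h x] g gr w by (simp add: h_def)
    finally have eq: "convolve ?K w x = \<dots>" .
    have "?K \<in> borel_measurable borel"
      by (intro borel_measurable_continuous_onI continuous_intros g continuous_on_compose2[OF k]) auto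
    then have "\<bar>convolve ?K w x\<bar> \<le> (e / (?m + 1) * norm h) * ?m"
      by (rule convolve_integrable_bound(2)) (use \<delta> y w r gr hr in \<open>auto simp: h_def\<close>)
    also have "\<dots> = (e * norm h) * (?m / (?m + 1))" by simp
    also have "\<dots> \<le> e * norm h"
      using e ball_mass_nonneg[of w x "r+1"] by (intro mult_left_le) (auto simp: field_simps)
    finally have "\<bar>convolve ?K w x\<bar> \<le> e * norm h" .
    then show ?thesis unfolding eq unfolding h_def .
  qed
  then show "\<exists>d>0. \<forall>y. norm (y - x) < d \<longrightarrow> norm (convolve k w y - convolve k w x -
      (\<Sum>b\<in>Basis. convolve (\<lambda>z. g z \<bullet> b) w x * ((y - x) \<bullet> b))) \<le> e * norm (y - x)"
    using \<delta> by (intro exI[of _ "min \<delta> 1"]) auto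
qed

text \<open>Uniform continuity of the kernel weighed by the mass of w on a slightly larger ball. It
  is applied to the mollifiers and to the components of their gradients.\<close>

lemma convolve_continuous:
  assumes k: "continuous_on UNIV k" and r: "\<And>z. r < norm z \<Longrightarrow> k z = 0" and w: "loc_integrable w"
  shows "continuous_on UNIV (convolve k w)"
proof -
  have "isCont (convolve k w) x" for x
    unfolding isCont_def
  proof (rule LIM_I)
    fix e :: real assume e: "e > 0"
    let ?m = "ball_mass w x (r + 1)"
    have "uniformly_continuous_on (cball 0 (r + 2)) k"
      by (intro compact_uniformly_continuous continuous_on_subset[OF k]) auto
    moreover have "e / (?m + 1) > 0" using e ball_mass_nonneg[of w x "r+1"] by simp
    ultimately obtain d' where d': "d' > 0"
      "\<And>x y. x \<in> cball 0 (r + 2) \<Longrightarrow> y \<in> cball 0 (r + 2) \<Longrightarrow> dist y x < d' \<Longrightarrow> dist (k y) (k x) < e / (?m + 1)"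
      unfolding uniformly_continuous_on_def by metis
    have "\<bar>convolve k w y - convolve k w x\<bar> < e" if y: "norm (y - x) < min d' 1" for y
    proof -
      define h where "h = y - x"
      let ?K = "\<lambda>z. k (z + h) - k z"
      have hr: "r < norm (z + h)" if "r + 1 < norm z" for z
        using y[folded h_def] that norm_diff_ineq[of z h] by simp
      have "\<bar>?K z\<bar> \<le> e / (?m + 1)" for z
      proof (cases "norm z \<le> r + 1")
        case True
        then have "norm (z + h) \<le> r + 2" using y norm_triangle_ineq[of z h] by (auto simp: h_def)
        with d'(2)[of z "z + h"] True y[folded h_def] have "\<bar>?K z\<bar> < e / (?m + 1)"
          by (simp add: dist_norm mem_cball_0 del: mem_cball)
        then show ?thesis by simp
      next
        case False
        then show ?thesis using hr[of z] r \<open>e / (?m + 1) > 0\<close> by simp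
      qed
      moreover have "?K \<in> borel_measurable borel"
        by (intro borel_measurable_continuous_onI continuous_intros continuous_on_compose2[OF k]) auto
      ultimately have "\<bar>convolve ?K w x\<bar> \<le> (e / (?m + 1)) * ?m"
        by (intro convolve_integrable_bound(2)) (use w r hr in auto)
      also have "\<dots> < e" using e ball_mass_nonneg[of w x "r+1"] by (auto simp: field_simps)
      finally have *: "\<bar>convolve ?K w x\<bar> < e" .
      obtain B1 where "\<And>z. \<bar>k z\<bar> \<le> B1" using bounded_of_compact_support[of k r] k r by blast
      then have i1: "integrable lborel (\<lambda>y. k (x + h - y) * w y)" "integrable lborel (\<lambda>y. k (x - y) * w y)"
        by (intro convolve_integrable_bound(1)[where r=r and B=B1] w borel_measurable_continuous_onI k; auto simp: r)+
      have "convolve ?K w x = convolve k w (x + h) - convolve k w x"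
        unfolding convolve_def using i1 by (simp add: left_diff_distrib algebra_simps)
      with * show ?thesis by (simp add: h_def)
    qed
    then show "\<exists>s>0. \<forall>y. y \<noteq> x \<and> norm (y - x) < s \<longrightarrow> norm (convolve k w y - convolve k w x) < e"
      using d' by (intro exI[of _ "min d' 1"]) auto
  qed
  then show ?thesis by (simp add: continuous_at_imp_continuous_on)
qed

text \<open>By translation invariance \<open>convolve k 1\<close> is constant, so its derivative vanishes.\<close>

lemma integral_gradient_0:
  fixes k :: "'a::euclidean_space \<Rightarrow> real"
  assumes d: "\<And>z. (k has_derivative (\<lambda>h. g z \<bullet> h)) (at z)" and g: "continuous_on UNIV g"
    and r: "\<And>z. r < norm z \<Longrightarrow> k z = 0" and b: "b \<in> Basis"
  shows "(\<integral>y. g y \<bullet> b \<partial>lborel) = 0"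
proof -
  \<comment> \<open>The reflection compensates the sign in k (x - y): at x = 0 the derivative of the
    convolution with 1 is, up to sign, the integral of the gradient of k.\<close>
  have d': "((\<lambda>z. k (- z)) has_derivative (\<lambda>h. - g (- z) \<bullet> h)) (at z)" for z
    using has_derivative_compose[OF has_derivative_minus[OF has_derivative_ident] d, of z] by simp
  have k: "continuous_on UNIV k"
    using d by (meson differentiable_def differentiable_imp_continuous_on differentiable_on_def has_derivative_at_withinI)
  have "convolve (\<lambda>z. k (- z)) (\<lambda>_. 1) x = (\<integral>y. k y \<partial>lborel)" for x
  proof -
    have "(\<integral>y. k y \<partial>lborel) = (\<integral>y. k y \<partial>distr lborel borel ((+) (- x)))"
      by (simp add: lborel_distr_plus)
    also have "\<dots> = (\<integral>y. k (- x + y) \<partial>lborel)"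
      by (intro integral_distr) (auto intro: borel_measurable_continuous_onI k)
    finally show ?thesis by (simp add: convolve_def)
  qed
  then have "convolve (\<lambda>z. k (- z)) (\<lambda>_. 1) = (\<lambda>x. (\<integral>y. k y \<partial>lborel))" by auto
  then have "(convolve (\<lambda>z. k (- z)) (\<lambda>_. 1) has_derivative (\<lambda>h. 0)) (at 0)" by simp
  moreover have "(convolve (\<lambda>z. k (- z)) (\<lambda>_. 1) has_derivative
      (\<lambda>h. \<Sum>b\<in>Basis. convolve (\<lambda>z. - g (- z) \<bullet> b) (\<lambda>_. 1) 0 * (h \<bullet> b))) (at 0)"
    by (rule convolve_has_derivative[OF d' _ _ loc_integrable_1, where r=r])
      (auto intro!: continuous_intros continuous_on_compose2[OF g] r)
  ultimately have "(\<lambda>h. \<Sum>b\<in>Basis. convolve (\<lambda>z. - g (- z) \<bullet> b) (\<lambda>_. 1) 0 * (h \<bullet> b)) = (\<lambda>h. 0)"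
    by (intro has_derivative_unique)
  then have "(\<Sum>i\<in>Basis. convolve (\<lambda>z. - g (- z) \<bullet> i) (\<lambda>_. 1) 0 * (b \<bullet> i)) = 0" by metis
  then have "convolve (\<lambda>z. - g (- z) \<bullet> b) (\<lambda>_. 1) 0 = 0"
    using b by (simp add: inner_Basis if_distrib sum.delta' cong: if_cong)
  then show ?thesis by (simp add: convolve_def)
qed

subsection \<open>Testing the equation\<close>

definition grad :: "('a::euclidean_space \<Rightarrow> real) \<Rightarrow> 'a \<Rightarrow> 'a" where
  "grad f x = (\<Sum>b\<in>Basis. partial_deriv b f x *\<^sub>R b)"

lemma grad_inner: "b \<in> Basis \<Longrightarrow> grad f x \<bullet> b = partial_deriv b f x"
  unfolding grad_def by (simp add: inner_sum_left inner_Basis if_distrib cong: if_cong)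

lemma C_k_0_continuous: "f \<in> C_k j \<Longrightarrow> continuous_on UNIV f"
  unfolding C_k_def by (auto simp: partial_derivs_def dest!: spec[of _ "[]"])

lemma C_k_partial_continuous:
  assumes "f \<in> C_k (Suc j)" "b \<in> Basis" shows "continuous_on UNIV (partial_deriv b f)"
proof -
  have "continuous_on UNIV (partial_derivs [b] f)"
    using assms unfolding C_k_def by (auto dest!: spec[of _ "[b]"])
  then show ?thesis by (simp add: partial_derivs_def)
qed

lemma C_1_has_gradient:
  assumes f: "f \<in> C_k 1"
  shows "(f has_derivative (\<lambda>h. grad f x \<bullet> h)) (at x)" "continuous_on UNIV (grad f)"
proof -
  have "f differentiable_on UNIV"
    using f unfolding C_k_def by (auto simp: partial_derivs_def dest!: spec[of _ "[]"])
  then have d: "(f has_derivative frechet_derivative f (at x)) (at x)"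
    by (simp add: differentiable_on_def frechet_derivative_works[symmetric])
  interpret L: bounded_linear "frechet_derivative f (at x)"
    using d by (rule has_derivative_bounded_linear)
  have "frechet_derivative f (at x) h = grad f x \<bullet> h" for h
  proof -
    have "frechet_derivative f (at x) h = frechet_derivative f (at x) (\<Sum>b\<in>Basis. (h \<bullet> b) *\<^sub>R b)"
      by (simp add: euclidean_representation)
    also have "\<dots> = grad f x \<bullet> h"
      unfolding grad_def partial_deriv_def
      by (simp add: L.sum L.scaleR inner_sum_left inner_commute[of h] mult.commute)
    finally show ?thesis .
  qed
  then have "frechet_derivative f (at x) = (\<lambda>h. grad f x \<bullet> h)" by blast
  with d show "(f has_derivative (\<lambda>h. grad f x \<bullet> h)) (at x)" by simp
  show "continuous_on UNIV (grad f)"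
    unfolding grad_def[abs_def] using C_k_partial_continuous[of f 0] f
    by (intro continuous_intros) auto
qed

lemma C_k_partial_deriv:
  assumes "f \<in> C_k (Suc j)" "b \<in> Basis" shows "partial_deriv b f \<in> C_k j"
proof -
  have "partial_derivs bs (partial_deriv b f) = partial_derivs (bs @ [b]) f" for bs
    by (simp add: partial_derivs_def)
  then show ?thesis using assms unfolding C_k_def by auto
qed

lemma test_functionsD:
  assumes "f \<in> test_functions"
  obtains r where "f \<in> C_k j" "\<And>x. r < norm x \<Longrightarrow> f x = 0"
proof -
  have "bounded (closure {x. f x \<noteq> 0})" using assms by (simp add: test_functions_def compact_imp_bounded del: compact_closure)
  then obtain r where "\<And>x. x \<in> closure {x. f x \<noteq> 0} \<Longrightarrow> norm x \<le> r" unfolding bounded_iff by blast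
  then have "r < norm x \<Longrightarrow> f x = 0" for x
    using closure_subset[of "{x. f x \<noteq> 0}"] by force
  with assms that show ?thesis unfolding test_functions_def by auto
qed

lemma test_functions_partial_deriv:
  assumes f: "f \<in> test_functions" and b: "b \<in> Basis"
  shows "partial_deriv b f \<in> test_functions"
proof -
  obtain r where r: "f \<in> C_k 1" "\<And>x. r < norm x \<Longrightarrow> f x = 0"
    using test_functionsD[OF f] by blast
  have "partial_deriv b f x = 0" if "r + 1 \<le> norm (0 - x)" for x
    using that b gradient_support[of f "grad f" x r] C_1_has_gradient[OF r(1)] r(2)
    by (simp add: grad_inner[symmetric])
  then have "compact (closure {x. partial_deriv b f x \<noteq> 0})" by (rule compact_supportI)
  then show ?thesis
    using f b C_k_partial_deriv by (auto simp: test_functions_def simp del: compact_closure)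
qed

text \<open>The product f h has compact support, so each component of its gradient integrates to
  0.\<close>

lemma test_functions_integrate_by_parts:
  assumes f: "f \<in> test_functions" and h: "h \<in> test_functions" and b: "b \<in> Basis"
  shows "(\<integral>x. f x * partial_deriv b h x \<partial>lborel) = - (\<integral>x. partial_deriv b f x * h x \<partial>lborel)"
proof -
  obtain r where r: "f \<in> C_k 1" "\<And>x. r < norm x \<Longrightarrow> f x = 0" using test_functionsD[OF f] by blast
  obtain s where s: "h \<in> C_k 1" "\<And>x. s < norm x \<Longrightarrow> h x = 0" using test_functionsD[OF h] by blast
  note cont = C_k_0_continuous[OF r(1)] C_k_0_continuous[OF s(1)]
    C_k_partial_continuous[OF r(1)[unfolded One_nat_def] b] C_k_partial_continuous[OF s(1)[unfolded One_nat_def] b]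
  let ?g = "\<lambda>x. f x *\<^sub>R grad h x + h x *\<^sub>R grad f x"
  have "(\<integral>y. ?g y \<bullet> b \<partial>lborel) = 0"
  proof (rule integral_gradient_0[where k="\<lambda>x. f x * h x"])
    show "((\<lambda>x. f x * h x) has_derivative (\<lambda>v. ?g z \<bullet> v)) (at z)" for z
      using has_derivative_mult[OF C_1_has_gradient(1)[OF r(1)] C_1_has_gradient(1)[OF s(1)], of z]
      by (simp add: inner_add_left mult.commute)
    show "continuous_on UNIV ?g"
      by (intro continuous_intros cont C_1_has_gradient r s)
  qed (use r b in auto)
  moreover have "?g y \<bullet> b = f y * partial_deriv b h y + partial_deriv b f y * h y" for y
    using b by (simp add: inner_add_left grad_inner)
  moreover have "integrable lborel (\<lambda>y. f y * partial_deriv b h y)"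
    by (rule integrable_compact_support[where r=r]) (auto intro!: continuous_intros cont simp: r)
  moreover have "integrable lborel (\<lambda>y. partial_deriv b f y * h y)"
    by (rule integrable_compact_support[where r=s]) (auto intro!: continuous_intros cont simp: s)
  ultimately show ?thesis by simp
qed

lemma borel_measurable_continuous_UNIV: "continuous_on UNIV f \<Longrightarrow> f \<in> borel_measurable lborel"
  by (simp add: borel_measurable_continuous_onI)

lemma absolutely_integrable_on_compact:
  fixes F :: "'a::euclidean_space \<Rightarrow> 'b::euclidean_space"
  assumes "continuous_on UNIV F" "compact K"
  shows "F absolutely_integrable_on K"
  unfolding set_integrable_def using assms
  by (subst integrable_completion) (auto intro!: borel_integrable_compact 
    borel_measurable_continuous_on_indicator borel_compact intro: continuous_on_subset)

text \<open>Admits test functions in \<open>weak_solution\<close>, with the classical gradient in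
  the role of the weak one.\<close>

lemma test_functions_H1:
  assumes f: "f \<in> test_functions"
  shows "has_weak_gradient f (grad f)" "f \<in> H1"
proof -
  obtain r where r: "f \<in> C_k 1" "\<And>x. r < norm x \<Longrightarrow> f x = 0" using test_functionsD[OF f] by blast
  have L2: "h \<in> Lp 2" if h: "h \<in> test_functions" for h :: "'a \<Rightarrow> real"
  proof -
    obtain s where s: "h \<in> C_k 1" "\<And>x. s < norm x \<Longrightarrow> h x = 0" using test_functionsD[OF h] by blast
    have "integrable lborel (\<lambda>x. (h x)\<^sup>2)"
      by (rule integrable_compact_support[where r=s])
        (auto intro!: continuous_intros C_k_0_continuous[OF s(1)] simp: s)
    moreover have "(\<lambda>x. \<bar>h x\<bar> powr 2) = (\<lambda>x. (h x)\<^sup>2)" by (simp add: fun_eq_iff)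
    ultimately have "integrable lebesgue (\<lambda>x. \<bar>h x\<bar> powr 2)"
      using C_k_0_continuous[OF s(1)] 
      by (simp add: integrable_completion borel_measurable_continuous_UNIV continuous_intros)
    then show ?thesis unfolding Lp_def
      using measurable_completion[OF borel_measurable_continuous_UNIV[OF C_k_0_continuous[OF s(1)]]] by simp
  qed
  show *: "has_weak_gradient f (grad f)"
    unfolding has_weak_gradient_def
  proof (intro conjI allI impI ballI)
    fix K :: "'a set" assume K: "compact K"
    show "f absolutely_integrable_on K" "grad f absolutely_integrable_on K"
      using C_k_0_continuous[OF r(1)] C_1_has_gradient(2)[OF r(1)] K
      by (auto intro!: absolutely_integrable_on_compact)
  next
    fix h :: "'a \<Rightarrow> real" and b :: 'a assume h: "h \<in> test_functions" and b: "b \<in> Basis"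
    obtain s where s: "h \<in> C_k 1" using test_functionsD[OF h] by blast
    note cont = C_k_0_continuous[OF r(1)] C_k_0_continuous[OF s(1)]
      C_k_partial_continuous[OF r(1)[unfolded One_nat_def] b] C_k_partial_continuous[OF s(1)[unfolded One_nat_def] b]
    show "(\<integral>x. f x * partial_deriv b h x \<partial>lebesgue) = - (\<integral>x. grad f x \<bullet> b * h x \<partial>lebesgue)"
      using test_functions_integrate_by_parts[OF f h b] b
      by (subst (1 2) integral_completion)
        (auto simp: grad_inner intro!: borel_measurable_continuous_onI continuous_intros cont)
  qed
  show "f \<in> H1" unfolding H1_def
    using L2[OF f] * L2[OF test_functions_partial_deriv[OF f]] by (auto simp: grad_inner intro!: exI[of _ "grad f"])
qed

text \<open>A continuous k of compact support is bounded, so the product is dominated by a multiple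
  of F on a single ball.\<close>

lemma integrable_times_compact_support:
  fixes F k :: "'a::euclidean_space \<Rightarrow> real"
  assumes F: "\<And>R. set_integrable lebesgue (cball 0 R) F"
    and k: "continuous_on UNIV k" and r: "\<And>x. r < norm x \<Longrightarrow> k x = 0"
  shows "integrable lebesgue (\<lambda>x. F x * k x)"
proof -
  obtain B where B: "\<And>z. \<bar>k z\<bar> \<le> B" using bounded_of_compact_support[of k r] k r by blast
  have "integrable lebesgue (\<lambda>x. (indicator (cball 0 r) x *\<^sub>R F x) * k x)"
  proof (rule Bochner_Integration.integrable_bound)
    show "integrable lebesgue (\<lambda>x. B * (indicator (cball 0 r) x *\<^sub>R F x))"
      using F[of r] unfolding set_integrable_def by (intro integrable_mult_right)
    show "AE x in lebesgue. norm ((indicator (cball 0 r) x *\<^sub>R F x) * k x) \<le> norm (B * (indicator (cball 0 r) x *\<^sub>R F x))"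
    proof (rule AE_I2)
      fix x
      have "\<bar>k x\<bar> * \<bar>indicator (cball 0 r) x *\<^sub>R F x\<bar> \<le> \<bar>B\<bar> * \<bar>indicator (cball 0 r) x *\<^sub>R F x\<bar>"
        using B[of x] by (intro mult_right_mono) auto
      then show "norm ((indicator (cball 0 r) x *\<^sub>R F x) * k x) \<le> norm (B * (indicator (cball 0 r) x *\<^sub>R F x))"
        by (simp only: real_norm_def abs_mult mult.commute)
    qed
    show "(\<lambda>x. (indicator (cball 0 r) x *\<^sub>R F x) * k x) \<in> borel_measurable lebesgue"
      using F[of r] measurable_completion[OF borel_measurable_continuous_UNIV[OF k]] unfolding set_integrable_def by measurable
  qed
  moreover have "(\<lambda>x. (indicator (cball 0 r) x *\<^sub>R F x) * k x) = (\<lambda>x. F x * k x)"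
  proof
    fix x show "(indicator (cball 0 r) x *\<^sub>R F x) * k x = F x * k x"
      using r[of x] by (cases "r < norm x") auto
  qed
  ultimately show ?thesis by (simp only:)
qed

text \<open>The definition of the weak gradient is applied to the partial derivatives of f, which
  are again test functions; this moves both derivatives onto f. Local integrability of V u and of
  the nonlinearity allows the integrals to be split into their terms.\<close>

lemma weak_solution_test:
  fixes u V :: "'a::euclidean_space \<Rightarrow> real"
  assumes sol: "weak_solution V l g u"
    and Vu: "\<And>R. set_integrable lebesgue (cball 0 R) (\<lambda>x. V x * u x)"
    and gu: "\<And>R. set_integrable lebesgue (cball 0 R) (\<lambda>x. l * u x + g (u x))"
    and f: "f \<in> test_functions"
  shows "(\<integral>x. u x * (\<Sum>b\<in>Basis. partial_deriv b (partial_deriv b f) x) \<partial>lebesgue)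
    = - (\<integral>x. (l * u x + g (u x) - V x * u x) * f x \<partial>lebesgue)"
proof -
  obtain r where r: "f \<in> C_k 1" "\<And>x. r < norm x \<Longrightarrow> f x = 0" using test_functionsD[OF f] by blast
  obtain Du where Du: "has_weak_gradient u Du" "\<forall>b\<in>Basis. (\<lambda>x. Du x \<bullet> b) \<in> Lp 2"
    using sol unfolding weak_solution_def H1_def by auto
  have eq: "(\<integral>x. Du x \<bullet> grad f x + V x * u x * f x \<partial>lebesgue) = (\<integral>x. (l * u x + g (u x)) * f x \<partial>lebesgue)"
    using sol Du test_functions_H1[OF f] unfolding weak_solution_def by blast
  have loc: "set_integrable lebesgue (cball 0 R) u" "set_integrable lebesgue (cball 0 R) Du" for R
    using Du(1) unfolding has_weak_gradient_def by auto
  have locb: "set_integrable lebesgue (cball 0 R) (\<lambda>x. Du x \<bullet> b)" for R b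
  proof -
    have "integrable lebesgue (\<lambda>x. (indicator (cball 0 R) x *\<^sub>R Du x) \<bullet> b)"
      using loc(2)[of R] unfolding set_integrable_def by (intro integrable_inner_left)
    then show ?thesis by (simp add: set_integrable_def)
  qed
  have i1: "integrable lebesgue (\<lambda>x. (Du x \<bullet> b) * partial_deriv b f x)"
    and i2: "integrable lebesgue (\<lambda>x. u x * partial_deriv b (partial_deriv b f) x)"
    and e2: "(\<integral>x. (Du x \<bullet> b) * partial_deriv b f x \<partial>lebesgue) = - (\<integral>x. u x * partial_deriv b (partial_deriv b f) x \<partial>lebesgue)"
    if b: "b \<in> Basis" for b
  proof -
    note t1 = test_functions_partial_deriv[OF f b]
    note t2 = test_functions_partial_deriv[OF t1 b]
    obtain r1 where "partial_deriv b f \<in> C_k 0" "\<And>x. r1 < norm x \<Longrightarrow> partial_deriv b f x = 0"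
      using test_functionsD[OF t1] by blast
    then show "integrable lebesgue (\<lambda>x. (Du x \<bullet> b) * partial_deriv b f x)"
      by (intro integrable_times_compact_support[where r=r1] locb C_k_0_continuous)
    obtain r2 where "partial_deriv b (partial_deriv b f) \<in> C_k 0" "\<And>x. r2 < norm x \<Longrightarrow> partial_deriv b (partial_deriv b f) x = 0"
      using test_functionsD[OF t2] by blast
    then show "integrable lebesgue (\<lambda>x. u x * partial_deriv b (partial_deriv b f) x)"
      by (intro integrable_times_compact_support[where r=r2] loc C_k_0_continuous)
    show "(\<integral>x. (Du x \<bullet> b) * partial_deriv b f x \<partial>lebesgue) = - (\<integral>x. u x * partial_deriv b (partial_deriv b f) x \<partial>lebesgue)"
      using Du(1) t1 b unfolding has_weak_gradient_def by auto
  qed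
  have exp: "Du x \<bullet> grad f x = (\<Sum>b\<in>Basis. (Du x \<bullet> b) * partial_deriv b f x)" for x
    using euclidean_inner[of "Du x" "grad f x"] by (simp add: grad_inner)
  have i3: "integrable lebesgue (\<lambda>x. V x * u x * f x)" "integrable lebesgue (\<lambda>x. (l * u x + g (u x)) * f x)"
    using r by (intro integrable_times_compact_support[where r=r] Vu gu C_k_0_continuous; auto)+
  have "(\<integral>x. u x * (\<Sum>b\<in>Basis. partial_deriv b (partial_deriv b f) x) \<partial>lebesgue)
      = (\<Sum>b\<in>Basis. \<integral>x. u x * partial_deriv b (partial_deriv b f) x \<partial>lebesgue)"
    using i2 by (simp add: sum_distrib_left)
  also have "\<dots> = - (\<integral>x. Du x \<bullet> grad f x \<partial>lebesgue)"
    unfolding exp using i1 e2 by (simp add: sum_negf)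
  also have "(\<integral>x. Du x \<bullet> grad f x \<partial>lebesgue) = (\<integral>x. (l * u x + g (u x)) * f x \<partial>lebesgue) - (\<integral>x. V x * u x * f x \<partial>lebesgue)"
    using eq i1 i3 by (simp add: exp)
  also have "\<dots> = (\<integral>x. (l * u x + g (u x) - V x * u x) * f x \<partial>lebesgue)"
    using i3 by (simp add: left_diff_distrib)
  finally show ?thesis .
qed

subsection \<open>The mollification formula\<close>

lemma mollifier_measurable [measurable]: "(\<lambda>(t, z). mollifier t z) \<in> borel_measurable (borel \<Otimes>\<^sub>M borel)"
  and potential_measurable [measurable]: "(\<lambda>(t, z). potential t z) \<in> borel_measurable (borel \<Otimes>\<^sub>M borel)"
  and mollifier_deriv_measurable [measurable]: "(\<lambda>(t, z). mollifier_deriv t z) \<in> borel_measurable (borel \<Otimes>\<^sub>M borel)"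
  unfolding mollifier_def[abs_def] potential_def[abs_def] mollifier_deriv_def[abs_def] by measurable

lemma mollifier_continuous: "continuous_on UNIV (mollifier t)"
  using smooth_gen_C_k[OF mollifier_smooth] C_k_0_continuous by blast

lemma mollifier_borel_measurable [measurable]: "mollifier t \<in> borel_measurable borel"
  by (intro borel_measurable_continuous_onI mollifier_continuous)

lemma potential_continuous: "t > 0 \<Longrightarrow> continuous_on UNIV (potential t)"
  unfolding potential_def[abs_def] by (intro continuous_intros) auto

lemma mollifier_bounded: "\<exists>B\<ge>0. \<forall>t>0. \<forall>z::'a::euclidean_space. mollifier t z \<le> B / t ^ DIM('a)"
proof -
  obtain B where B: "\<And>r. r \<le> 1 \<Longrightarrow> \<bar>flat_exp 2 r\<bar> \<le> B" using flat_exp_bounded by blast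
  have "mollifier t z \<le> 2 * B / t ^ DIM('a)" if "t > 0" for t and z :: 'a
    using B[of "1 - (norm z)\<^sup>2 / t\<^sup>2"] that by (simp add: mollifier_def divide_right_mono)
  moreover have "0 \<le> B" using B[of 0] by simp
  ultimately show ?thesis by (intro exI[of _ "2 * B"]) auto
qed

text \<open>Compactness in the pair (scale, point): the lower bound s keeps away from the
  singularity at scale 0, and outside the ball of radius t the kernel vanishes. The constant
  provides the dominating function for Fubini.\<close>

lemma mollifier_deriv_bounded:
  assumes "0 < s" obtains B where "\<And>\<tau> z. s \<le> \<tau> \<Longrightarrow> \<tau> \<le> t \<Longrightarrow> \<bar>mollifier_deriv \<tau> (z::'a::euclidean_space)\<bar> \<le> B" "0 \<le> B"
proof -
  let ?K = "{s..t} \<times> cball (0::'a) t"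
  have "continuous_on ?K (\<lambda>(\<tau>, z). mollifier_deriv \<tau> z)"
    unfolding mollifier_deriv_def split_beta using assms by (intro continuous_intros) auto
  then have "compact ((\<lambda>(\<tau>, z). mollifier_deriv \<tau> z) ` ?K)"
    by (intro compact_continuous_image compact_Times) auto
  then obtain B where B: "0 < B" "\<And>p. p \<in> ?K \<Longrightarrow> \<bar>(case p of (\<tau>, z) \<Rightarrow> mollifier_deriv \<tau> z)\<bar> \<le> B"
    by (metis bounded_pos compact_imp_bounded image_eqI real_norm_def)
  have "\<bar>mollifier_deriv \<tau> z\<bar> \<le> B" if "s \<le> \<tau>" "\<tau> \<le> t" for \<tau> and z :: 'a
  proof (cases "norm z \<le> t")
    case True
    then show ?thesis using B(2)[of "(\<tau>, z)"] that by simp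
  next
    case False
    then show ?thesis using that assms B(1) by (simp add: mollifier_deriv_eq_0)
  qed
  with that B(1) show ?thesis by force
qed

lemma convolve_mollifier_integrable:
  fixes w :: "'a::euclidean_space \<Rightarrow> real"
  assumes "t > 0" "loc_integrable w" shows "integrable lborel (\<lambda>y. mollifier t (x - y) * w y)"
proof -
  obtain C where "\<And>z::'a. mollifier t z \<le> C / t ^ DIM('a)" using mollifier_bounded assms(1) by blast
  then have "\<bar>mollifier t z\<bar> \<le> C / t ^ DIM('a)" for z :: 'a
    using mollifier_nonneg[OF assms(1), of z] by simp
  then show ?thesis using assms
    by (intro convolve_integrable_bound(1)[where r=t and B="C / t ^ DIM('a)"]) (auto simp: mollifier_eq_0)
qed

text \<open>The equation \<open>- \<Delta>u = f\<close>, tested with translates of \<open>potential t\<close>.\<close>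

definition mollified_poisson :: "('a::euclidean_space \<Rightarrow> real) \<Rightarrow> ('a \<Rightarrow> real) \<Rightarrow> bool" where
  "mollified_poisson u f \<longleftrightarrow> (\<forall>x. \<forall>t>0. convolve (mollifier_deriv t) u x = - t * convolve (potential t) f x)"

text \<open>Fubini turns the kernel identity into a formula for the difference of two mollifications.\<close>

lemma convolve_mollifier_diff:
  fixes u f :: "'a::euclidean_space \<Rightarrow> real"
  assumes u: "loc_integrable u" and weak: "mollified_poisson u f"
    and st: "0 < s" "s \<le> t"
  shows "integrable lborel (\<lambda>\<tau>. indicator {s..t} \<tau> * (\<tau> * convolve (potential \<tau>) f x))"
    and "convolve (mollifier s) u x = convolve (mollifier t) u x + (\<integral>\<tau>. indicator {s..t} \<tau> * (\<tau> * convolve (potential \<tau>) f x) \<partial>lborel)"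
proof -
  note [measurable] = loc_integrable_measurable[OF u]
  have [measurable]: "cball x t \<in> sets borel" by simp
  obtain B where B: "\<And>\<tau> z. s \<le> \<tau> \<Longrightarrow> \<tau> \<le> t \<Longrightarrow> \<bar>mollifier_deriv \<tau> (z::'a)\<bar> \<le> B" "0 \<le> B"
    using mollifier_deriv_bounded[OF st(1), where t=t] by blast
  let ?F = "\<lambda>\<tau> y. indicator {s..t} \<tau> * (mollifier_deriv \<tau> (x - y) * u y)"
  let ?H = "\<lambda>\<tau> y. indicator {s..t} \<tau> * (indicator (cball x t) y * \<bar>u y\<bar>)"
  have iu: "integrable lborel (\<lambda>y. indicator (cball x t) y * \<bar>u y\<bar>)"
    using loc_integrable_abs[OF u, of x t] by (simp add: set_integrable_def)
  have "integrable (lborel \<Otimes>\<^sub>M lborel) (case_prod ?H)"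
  proof (rule lborel_pair.Fubini_integrable)
    show "integrable lborel (\<lambda>\<tau>. \<integral>y. norm (case (\<tau>, y) of (\<tau>, y) \<Rightarrow> ?H \<tau> y) \<partial>lborel)"
      using st by (auto simp: abs_mult intro!: integrable_real_indicator)
    show "AE \<tau> in lborel. integrable lborel (\<lambda>y. case (\<tau>, y) of (\<tau>, y) \<Rightarrow> ?H \<tau> y)"
      using iu by simp
  qed measurable
  then have "integrable (lborel \<Otimes>\<^sub>M lborel) (\<lambda>p. B * case_prod ?H p)" by (rule integrable_mult_right)
  then have int: "integrable (lborel \<Otimes>\<^sub>M lborel) (case_prod ?F)"
  proof (rule Bochner_Integration.integrable_bound)
    show "AE p in lborel \<Otimes>\<^sub>M lborel. norm (case_prod ?F p) \<le> norm (B * case_prod ?H p)"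
    proof (rule AE_I2, clarify)
      fix \<tau> y
      show "norm (?F \<tau> y) \<le> norm (B * ?H \<tau> y)"
      proof (cases "\<tau> \<in> {s..t} \<and> y \<in> cball x t")
        case True
        then show ?thesis using B(1)[of \<tau> "x - y"] B(2) by (auto simp: abs_mult mult_right_mono)
      next
        case False
        then have "?F \<tau> y = 0"
          using st mollifier_deriv_eq_0[of \<tau> "x - y"] by (auto simp: indicator_def dist_norm)
        then have "norm (?F \<tau> y) = 0" by (simp only: norm_zero)
        then show ?thesis by (simp only: norm_ge_zero)
      qed
    qed
  qed measurable
  \<comment> \<open>Integrating in y first, the equation produces the potential term; integrating in
    the scale first, as in \<open>ftc\<close> below, the fundamental theorem leaves the two
    mollifiers.\<close>
  have eqF: "(\<integral>y. ?F \<tau> y \<partial>lborel) = - (indicator {s..t} \<tau> * (\<tau> * convolve (potential \<tau>) f x))" for \<tau>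
    using weak st by (auto simp: mollified_poisson_def convolve_def indicator_def)
  show "integrable lborel (\<lambda>\<tau>. indicator {s..t} \<tau> * (\<tau> * convolve (potential \<tau>) f x))"
    using lborel_pair.integrable_fst'[OF int] eqF by simp
  have ftc: "(\<integral>\<tau>. ?F \<tau> y \<partial>lborel) = mollifier t (x - y) * u y - mollifier s (x - y) * u y" for y
  proof -
    have "isCont (\<lambda>\<tau>. mollifier_deriv \<tau> (x - y)) \<tau>" if "s \<le> \<tau>" for \<tau>
      unfolding mollifier_deriv_def using that st by (intro continuous_intros isCont_o2[OF _ isCont_flat_exp]) auto
    then have "(\<integral>\<tau>. mollifier_deriv \<tau> (x - y) * indicator {s..t} \<tau> \<partial>lborel) = mollifier t (x - y) - mollifier s (x - y)"
      using st by (intro integral_FTC_Icc_real DERIV_mollifier) auto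
    then have "(\<integral>\<tau>. (indicator {s..t} \<tau> * mollifier_deriv \<tau> (x - y)) * u y \<partial>lborel) = (mollifier t (x - y) - mollifier s (x - y)) * u y"
      by (simp add: mult.commute)
    then show ?thesis by (simp add: left_diff_distrib mult.assoc)
  qed
  have "convolve (mollifier t) u x - convolve (mollifier s) u x = (\<integral>y. (\<integral>\<tau>. ?F \<tau> y \<partial>lborel) \<partial>lborel)"
    using st u convolve_mollifier_integrable[of t u x] convolve_mollifier_integrable[of s u x] unfolding ftc convolve_def by simp
  also have "\<dots> = (\<integral>\<tau>. (\<integral>y. ?F \<tau> y \<partial>lborel) \<partial>lborel)"
    by (rule lborel_pair.Fubini_integral[OF int])
  finally show "convolve (mollifier s) u x = convolve (mollifier t) u x + (\<integral>\<tau>. indicator {s..t} \<tau> * (\<tau> * convolve (potential \<tau>) f x) \<partial>lborel)"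
    unfolding eqF by simp
qed

text \<open>The kernel is not normalised, since its factor is dictated by the kernel identity. Its
  integral is the same at all scales and depends only on the space, hence the type argument.\<close>

definition mollifier_mass :: "'a::euclidean_space itself \<Rightarrow> real" where
  "mollifier_mass _ = (\<integral>z. mollifier 1 (z::'a) \<partial>lborel)"

lemma mollifier_integral:
  fixes x :: "'a::euclidean_space"
  assumes t: "t > 0"
  shows "integrable lborel (\<lambda>y. mollifier t (x - y))" "(\<integral>y. mollifier t (x - y) \<partial>lborel) = mollifier_mass TYPE('a)"
    "(\<integral>\<^sup>+y. ennreal (mollifier t (x - y)) \<partial>lborel) = mollifier_mass TYPE('a)"
proof -
  have c: "mollifier t (x - y) \<ge> 0" for y using mollifier_nonneg[OF t] .
  show i: "integrable lborel (\<lambda>y. mollifier t (x - y))"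
  proof (rule integrable_compact_support[where r="t + norm x"])
    show "continuous_on UNIV (\<lambda>y. mollifier t (x - y))"
      by (intro continuous_on_compose2[OF mollifier_continuous] continuous_intros) auto
    show "mollifier t (x - z) = 0" if "t + norm x < norm z" for z
      using that norm_triangle_ineq2[of z x] by (intro mollifier_eq_0 t) (auto simp: norm_minus_commute)
  qed
  \<comment> \<open>Substitution y = x - t z; the Jacobian cancels the factor t^(-N) of the
    kernel.\<close>
  have "(\<integral>y. mollifier t (x - y) \<partial>lborel) =
      (\<integral>y. mollifier t (x - y) \<partial>density (distr lborel borel (\<lambda>z. x + (-t) *\<^sub>R z)) (\<lambda>_. \<bar>- t\<bar> ^ DIM('a)))"
    using lborel_affine[of "-t" x] t by simp
  also have "\<dots> = (\<integral>z. t ^ DIM('a) * mollifier t (t *\<^sub>R (z::'a)) \<partial>lborel)"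
    using t by (subst integral_density; (subst integral_distr)?) (auto)
  also have "\<dots> = (\<integral>z. mollifier 1 (z::'a) \<partial>lborel)"
    using t by (intro Bochner_Integration.integral_cong) (auto simp: mollifier_def power_mult_distrib)
  finally show e: "(\<integral>y. mollifier t (x - y) \<partial>lborel) = mollifier_mass TYPE('a)" by (simp add: mollifier_mass_def)
  show "(\<integral>\<^sup>+y. ennreal (mollifier t (x - y)) \<partial>lborel) = mollifier_mass TYPE('a)"
    using nn_integral_eq_integral[OF i] c e by simp
qed

text \<open>A nonnegative kernel with integral 0 would vanish almost everywhere, but this one is
  positive on the open unit ball.\<close>

lemma mollifier_mass_pos: "mollifier_mass TYPE('a::euclidean_space) > 0"
proof -
  have nn: "0 \<le> mollifier 1 (0 - z)" for z :: 'a by (rule mollifier_nonneg) simp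
  have "mollifier_mass TYPE('a) \<ge> 0"
    unfolding mollifier_integral(2)[of 1 "0::'a", symmetric, OF zero_less_one] using nn by simp
  moreover have "mollifier_mass TYPE('a) \<noteq> 0"
  proof
    assume "mollifier_mass TYPE('a) = 0"
    then have "AE z in lborel. mollifier 1 (0 - z :: 'a) = 0"
      using integral_nonneg_eq_0_iff_AE[OF mollifier_integral(1)[of 1 "0::'a"]] nn mollifier_integral(2)[of 1 "0::'a"] by simp
    then have "AE z in lborel. (z::'a) \<notin> ball 0 1"
    proof eventually_elim
      case (elim z)
      have "norm z < 1 \<Longrightarrow> (norm z)\<^sup>2 < 1" by (simp add: power_less_one_iff)
      then show ?case using elim flat_exp_pos[of "1 - (norm z)\<^sup>2" 2] by (auto simp: mollifier_def)
    qed
    then have "emeasure lborel (ball (0::'a) 1) = 0"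
      by (subst (asm) AE_iff_measurable[of "ball 0 1"]) auto
    then show False using content_ball_pos[of 1 "0::'a"] by (simp add: measure_def)
  qed
  ultimately show ?thesis by simp
qed

subsection \<open>Almost everywhere convergence of mollifications\<close>

text \<open>Continuous functions approximate w almost everywhere, but without control of their size.
  Clamping to [-k, k] preserves continuity and repairs this: it costs little on w in L^1, and it
  gives the clamped approximants a common bound.\<close>

lemma L1_approx_continuous:
  fixes w :: "'a::euclidean_space \<Rightarrow> real"
  assumes [measurable]: "w \<in> borel_measurable borel" and w: "set_integrable lborel (cball 0 R) w" and e: "e > 0"
  obtains g where "continuous_on UNIV g" "(\<integral>\<^sup>+x. indicator (cball 0 R) x * ennreal \<bar>w x - g x\<bar> \<partial>lborel) < ennreal e"
proof -
  define cl where "cl M a = max (- M) (min M a)" for M a :: real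
  have cl_cont: "continuous_on UNIV (cl M)" for M unfolding cl_def by (intro continuous_intros)
  have [measurable]: "cl M \<in> borel_measurable borel" for M
    by (intro borel_measurable_continuous_onI cl_cont)
  let ?B = "cball (0::'a) R"
  have [measurable]: "?B \<in> sets borel" by simp
  have iw: "integrable lborel (\<lambda>x. indicator ?B x * \<bar>w x\<bar>)"
    using set_integrable_abs[OF w] by (simp add: set_integrable_def)
  have "(\<lambda>k. \<integral>x. indicator ?B x * \<bar>w x - cl (real k) (w x)\<bar> \<partial>lborel) \<longlonglongrightarrow> (\<integral>x. 0 \<partial>(lborel::'a measure))"
  proof (rule integral_dominated_convergence[OF _ _ iw])
    show "AE x in lborel. (\<lambda>k. indicator ?B x * \<bar>w x - cl (real k) (w x)\<bar>) \<longlonglongrightarrow> 0"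
    proof (rule AE_I2)
      fix x
      obtain m :: nat where m: "\<bar>w x\<bar> \<le> real m" using real_arch_simple by blast
      have "\<forall>\<^sub>F k in sequentially. 0 = indicator ?B x * \<bar>w x - cl (real k) (w x)\<bar>"
        using eventually_ge_at_top[of m] by eventually_elim (use m in \<open>auto simp: cl_def\<close>)
      then show "(\<lambda>k. indicator ?B x * \<bar>w x - cl (real k) (w x)\<bar>) \<longlonglongrightarrow> 0"
        by (rule Lim_transform_eventually[OF tendsto_const])
    qed
    show "AE x in lborel. norm (indicator ?B x * \<bar>w x - cl (real k) (w x)\<bar>) \<le> indicator ?B x * \<bar>w x\<bar>" for k
      by (intro AE_I2) (auto simp: cl_def indicator_def)
  qed measurable
  then have "\<forall>\<^sub>F k in sequentially. (\<integral>x. indicator ?B x * \<bar>w x - cl (real k) (w x)\<bar> \<partial>lborel) < e / 2"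
    using e by (intro order_tendstoD(2)) auto
  then obtain k where k: "(\<integral>x. indicator ?B x * \<bar>w x - cl (real k) (w x)\<bar> \<partial>lborel) < e / 2"
    using eventually_happens'[OF sequentially_bot] by blast
  \<comment> \<open>Unfolded below, this yields continuous functions converging to w off a
    negligible set; after clamping, the constant 2 k dominates the differences on the ball.\<close>
  have "w measurable_on UNIV"
    by (intro lebesgue_measurable_imp_measurable_on measurable_completion) auto
  then obtain N g where N: "negligible N" and g: "\<And>n. continuous_on UNIV (g n)"
    and lim: "\<And>x. x \<notin> N \<Longrightarrow> (\<lambda>n. g n x) \<longlonglongrightarrow> w x"
    unfolding measurable_on_def by auto
  have [measurable]: "g n \<in> borel_measurable borel" for n by (intro borel_measurable_continuous_onI g)
  have "AE x in lebesgue. x \<notin> N" using N negligible_iff_null_sets AE_not_in by blast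
  then have "AE x in lebesgue. (\<lambda>n. g n x) \<longlonglongrightarrow> w x" by eventually_elim (rule lim)
  then have ae: "AE x in lborel. (\<lambda>n. g n x) \<longlonglongrightarrow> w x" by (simp add: AE_completion_iff)
  have bound: "\<bar>cl (real k) a - cl (real k) b\<bar> \<le> 2 * real k" for a b by (auto simp: cl_def)
  have "(\<lambda>n. \<integral>x. indicator ?B x * \<bar>cl (real k) (w x) - cl (real k) (g n x)\<bar> \<partial>lborel) \<longlonglongrightarrow> (\<integral>x. 0 \<partial>(lborel::'a measure))"
  proof (rule integral_dominated_convergence)
    show "integrable lborel (\<lambda>x. indicator ?B x * (2 * real k))"
      by (intro integrable_mult_left integrable_real_indicator) (use emeasure_lborel_cball_finite[of "0::'a" R] in auto)
    show "AE x in lborel. (\<lambda>n. indicator ?B x * \<bar>cl (real k) (w x) - cl (real k) (g n x)\<bar>) \<longlonglongrightarrow> 0"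
      using ae
    proof eventually_elim
      case (elim x)
      have "(\<lambda>n. cl (real k) (g n x)) \<longlonglongrightarrow> cl (real k) (w x)"
        using continuous_on_tendsto_compose[OF cl_cont elim] by simp
      then have "(\<lambda>n. indicator ?B x * \<bar>cl (real k) (w x) - cl (real k) (g n x)\<bar>) \<longlonglongrightarrow> indicator ?B x * \<bar>cl (real k) (w x) - cl (real k) (w x)\<bar>"
        by (intro tendsto_intros)
      then show ?case by simp
    qed
    show "AE x in lborel. norm (indicator ?B x * \<bar>cl (real k) (w x) - cl (real k) (g n x)\<bar>) \<le> indicator ?B x * (2 * real k)" for n
      using bound by (intro AE_I2) (auto simp: indicator_def)
  qed measurable
  then have "\<forall>\<^sub>F n in sequentially. (\<integral>x. indicator ?B x * \<bar>cl (real k) (w x) - cl (real k) (g n x)\<bar> \<partial>lborel) < e / 2"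
    using e by (intro order_tendstoD(2)) auto
  then obtain n where n: "(\<integral>x. indicator ?B x * \<bar>cl (real k) (w x) - cl (real k) (g n x)\<bar> \<partial>lborel) < e / 2"
    using eventually_happens'[OF sequentially_bot] by blast
  have i1: "integrable lborel (\<lambda>x. indicator ?B x * \<bar>w x - cl (real k) (w x)\<bar>)"
    by (rule Bochner_Integration.integrable_bound[OF iw]) (auto intro!: AE_I2 simp: cl_def indicator_def)
  have "integrable lborel (\<lambda>x. indicator ?B x * (2 * real k))"
    by (intro integrable_mult_left integrable_real_indicator) (use emeasure_lborel_cball_finite[of "0::'a" R] in auto)
  then have i2: "integrable lborel (\<lambda>x. indicator ?B x * \<bar>cl (real k) (w x) - cl (real k) (g n x)\<bar>)"
    by (rule Bochner_Integration.integrable_bound) (use bound in \<open>auto intro!: AE_I2 simp: indicator_def\<close>)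
  let ?g = "\<lambda>x. cl (real k) (g n x)"
  have "(\<integral>\<^sup>+x. indicator ?B x * ennreal \<bar>w x - ?g x\<bar> \<partial>lborel)
      \<le> (\<integral>\<^sup>+x. ennreal (indicator ?B x * \<bar>w x - cl (real k) (w x)\<bar> + indicator ?B x * \<bar>cl (real k) (w x) - ?g x\<bar>) \<partial>lborel)"
  proof (intro nn_integral_mono)
    fix x
    have "ennreal (indicator ?B x * \<bar>w x - ?g x\<bar>)
      \<le> ennreal (indicator ?B x * \<bar>w x - cl (real k) (w x)\<bar> + indicator ?B x * \<bar>cl (real k) (w x) - ?g x\<bar>)"
      by (intro ennreal_leI) (auto simp: indicator_def)
    then show "indicator ?B x * ennreal \<bar>w x - ?g x\<bar>
      \<le> ennreal (indicator ?B x * \<bar>w x - cl (real k) (w x)\<bar> + indicator ?B x * \<bar>cl (real k) (w x) - ?g x\<bar>)"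
      by (simp add: ennreal_mult ennreal_indicator del: ennreal_plus)
  qed
  also have "\<dots> = ennreal (\<integral>x. indicator ?B x * \<bar>w x - cl (real k) (w x)\<bar> + indicator ?B x * \<bar>cl (real k) (w x) - ?g x\<bar> \<partial>lborel)"
    using i1 i2 by (intro nn_integral_eq_integral) auto
  also have "\<dots> < ennreal e"
    using i1 i2 k n e by (intro ennreal_lessI) (auto simp: Bochner_Integration.integral_add)
  finally have "(\<integral>\<^sup>+x. indicator ?B x * ennreal \<bar>w x - ?g x\<bar> \<partial>lborel) < ennreal e" .
  moreover have "continuous_on UNIV ?g"
    by (rule continuous_on_compose2[OF cl_cont g]) auto
  ultimately show ?thesis using that by blast
qed

lemma continuous_loc_integrable:
  fixes g :: "'a::euclidean_space \<Rightarrow> real"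
  assumes g: "continuous_on UNIV g" shows "loc_integrable g"
proof -
  have "integrable lborel (\<lambda>y. indicator (cball x r) y *\<^sub>R g y)" for x r
    by (rule borel_integrable_compact[OF compact_cball continuous_on_subset[OF g]]) simp
  moreover have "g \<in> borel_measurable borel" using g by (rule borel_measurable_continuous_onI)
  ultimately show ?thesis by (simp add: loc_integrable_def set_integrable_def)
qed

lemma loc_integrable_diff: "loc_integrable a \<Longrightarrow> loc_integrable b \<Longrightarrow> loc_integrable (\<lambda>x. a x - b x)"
  unfolding loc_integrable_def by auto

text \<open>The error is an average of g y - g x over |x - y| < t against a kernel of total mass
  \<open>mollifier_mass\<close>; scales below 1 keep y in the ball of radius R + 1, where g is
  uniformly continuous.\<close>

lemma mollify_continuous:
  fixes g :: "'a::euclidean_space \<Rightarrow> real"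
  assumes g: "continuous_on UNIV g" and e: "e > 0"
  obtains d where "d > 0" "\<And>t x. 0 < t \<Longrightarrow> t < d \<Longrightarrow> norm x \<le> R \<Longrightarrow> \<bar>convolve (mollifier t) g x - mollifier_mass TYPE('a) * g x\<bar> \<le> mollifier_mass TYPE('a) * e"
proof -
  have "uniformly_continuous_on (cball 0 (R + 1)) g"
    by (intro compact_uniformly_continuous continuous_on_subset[OF g]) auto
  then obtain d where d: "d > 0"
    "\<And>x y. x \<in> cball 0 (R + 1) \<Longrightarrow> y \<in> cball 0 (R + 1) \<Longrightarrow> dist y x < d \<Longrightarrow> dist (g y) (g x) < e"
    using e unfolding uniformly_continuous_on_def by metis
  have "\<bar>convolve (mollifier t) g x - mollifier_mass TYPE('a) * g x\<bar> \<le> mollifier_mass TYPE('a) * e"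
    if t: "0 < t" "t < min d 1" and x: "norm x \<le> R" for t x
  proof -
    have i: "integrable lborel (\<lambda>y. mollifier t (x - y) * (g y - g x))"
      by (intro convolve_mollifier_integrable t continuous_loc_integrable continuous_intros g)
    have "convolve (mollifier t) g x - mollifier_mass TYPE('a) * g x = (\<integral>y. mollifier t (x - y) * (g y - g x) \<partial>lborel)"
      using convolve_mollifier_integrable[OF t(1) continuous_loc_integrable[OF g], of x] mollifier_integral[OF t(1), of x]
      by (simp add: convolve_def right_diff_distrib)
    also have "\<bar>\<dots>\<bar> \<le> (\<integral>y. \<bar>mollifier t (x - y) * (g y - g x)\<bar> \<partial>lborel)"
      using integral_norm_bound[of lborel "\<lambda>y. mollifier t (x - y) * (g y - g x)"] by simp
    also have "\<dots> \<le> (\<integral>y. mollifier t (x - y) * e \<partial>lborel)"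
    proof (rule integral_mono)
      fix y
      show "\<bar>mollifier t (x - y) * (g y - g x)\<bar> \<le> mollifier t (x - y) * e"
      proof (cases "norm (x - y) < t")
        case True
        have "norm y \<le> norm x + norm (x - y)" by (metis add.commute norm_minus_commute norm_triangle_sub)
        then have "dist (g y) (g x) < e"
          using True t x by (intro d) (auto simp: dist_norm norm_minus_commute)
        then show ?thesis using mollifier_nonneg[OF t(1), of "x - y"]
          by (auto simp: abs_mult dist_real_def intro!: mult_left_mono)
      qed (use t in \<open>auto simp: mollifier_eq_0\<close>)
    qed (use i mollifier_integral[OF t(1), of x] in auto)
    also have "\<dots> = mollifier_mass TYPE('a) * e" using mollifier_integral[OF t(1), of x] by simp
    finally show ?thesis .
  qed
  with that[of "min d 1"] d(1) show ?thesis by simp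
qed

text \<open>A local form of Young's inequality in L^1: Tonelli, with the ball enlarged by 1 to
  contain the support of the kernel.\<close>

lemma nn_integral_convolve_mollifier:
  fixes h :: "'a::euclidean_space \<Rightarrow> real"
  assumes t: "0 < t" "t \<le> 1" and [measurable]: "h \<in> borel_measurable borel"
  shows "(\<integral>\<^sup>+x. indicator (cball 0 R) x * (\<integral>\<^sup>+y. ennreal (mollifier t (x - y) * \<bar>h y\<bar>) \<partial>lborel) \<partial>lborel)
    \<le> mollifier_mass TYPE('a) * (\<integral>\<^sup>+y. indicator (cball 0 (R + 1)) y * ennreal \<bar>h y\<bar> \<partial>lborel)"
proof -
  have [measurable]: "cball (0::'a) R \<in> sets borel" "cball (0::'a) (R + 1) \<in> sets borel" by simp_all
  have "(\<integral>\<^sup>+x. indicator (cball 0 R) x * (\<integral>\<^sup>+y. ennreal (mollifier t (x - y) * \<bar>h y\<bar>) \<partial>lborel) \<partial>lborel)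
      = (\<integral>\<^sup>+x. (\<integral>\<^sup>+y. indicator (cball 0 R) x * ennreal (mollifier t (x - y) * \<bar>h y\<bar>) \<partial>lborel) \<partial>lborel)"
    by (simp add: nn_integral_cmult)
  also have "\<dots> \<le> (\<integral>\<^sup>+x. (\<integral>\<^sup>+y. (indicator (cball 0 (R + 1)) y * ennreal \<bar>h y\<bar>) * ennreal (mollifier t (y - x)) \<partial>lborel) \<partial>lborel)"
  proof (intro nn_integral_mono)
    fix x y :: 'a
    \<comment> \<open>Evenness lets the inner integral over x be read as a mollifier centred at y
      once the order of integration is exchanged.\<close>
    have eq: "mollifier t (y - x) = mollifier t (x - y)" by (simp add: mollifier_def norm_minus_commute)
    show "indicator (cball 0 R) x * ennreal (mollifier t (x - y) * \<bar>h y\<bar>) \<le> (indicator (cball 0 (R + 1)) y * ennreal \<bar>h y\<bar>) * ennreal (mollifier t (y - x))"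
    proof (cases "norm (x - y) < t \<and> norm x \<le> R")
      case True
      have "norm y \<le> norm x + norm (x - y)" by (metis add.commute norm_minus_commute norm_triangle_sub)
      then show ?thesis using True t mollifier_nonneg[OF t(1), of "x - y"] eq
        by (simp add: ennreal_mult mult.commute)
    qed (use t in \<open>auto simp: mollifier_eq_0 not_less\<close>)
  qed
  also have "\<dots> = (\<integral>\<^sup>+y. (\<integral>\<^sup>+x. (indicator (cball 0 (R + 1)) y * ennreal \<bar>h y\<bar>) * ennreal (mollifier t (y - x)) \<partial>lborel) \<partial>lborel)"
    by (rule lborel_pair.Fubini') measurable
  also have "\<dots> = (\<integral>\<^sup>+y. (indicator (cball 0 (R + 1)) y * ennreal \<bar>h y\<bar>) * mollifier_mass TYPE('a) \<partial>lborel)"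
    by (simp add: nn_integral_cmult mollifier_integral(3)[OF t(1)])
  finally show ?thesis by (subst (asm) nn_integral_multc) (auto simp: mult.commute)
qed

text \<open>Three errors: mollifying w - g, mollifying the continuous g, and replacing g by w again.
  The outer two are controlled in L^1, the middle one uniformly.\<close>

lemma mollify_L1:
  fixes w :: "'a::euclidean_space \<Rightarrow> real"
  assumes w: "loc_integrable w" and e: "e > 0"
  obtains d where "d > 0" "\<And>t. 0 < t \<Longrightarrow> t < d \<Longrightarrow>
    (\<integral>\<^sup>+x. indicator (cball 0 R) x * ennreal \<bar>convolve (mollifier t) w x - mollifier_mass TYPE('a) * w x\<bar> \<partial>lborel) \<le> ennreal e"
proof -
  note [measurable] = loc_integrable_measurable[OF w]
  let ?c = "mollifier_mass TYPE('a)" and ?B = "cball (0::'a) R"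
  have [measurable]: "?B \<in> sets borel" "cball (0::'a) (R + 1) \<in> sets borel" by simp_all
  have c: "?c > 0" by (rule mollifier_mass_pos)
  define v where "v = measure lborel ?B"
  have v: "emeasure lborel ?B = ennreal v" "0 \<le> v"
    unfolding v_def using emeasure_lborel_cball_finite[of "0::'a" R] by (auto simp: emeasure_eq_ennreal_measure less_top)
  \<comment> \<open>The outer errors contribute mass * e1 each and the middle one mass * e1 * v,
    with v the volume of the ball; the sum is exactly e.\<close>
  define e1 where "e1 = e / (?c * (2 + v))"
  have e1: "e1 > 0" "?c * e1 * 2 + ?c * e1 * v = e"
  proof -
    have D: "?c * (2 + v) > 0" using c v(2) by (intro mult_pos_pos) auto
    then show "e1 > 0" unfolding e1_def using e by (intro divide_pos_pos)
    have "?c * e1 * 2 + ?c * e1 * v = (?c * (2 + v)) * e1" by (simp add: algebra_simps)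
    also have "\<dots> = e" unfolding e1_def using D by (metis less_irrefl nonzero_mult_div_cancel_left times_divide_eq_right)
    finally show "?c * e1 * 2 + ?c * e1 * v = e" .
  qed
  obtain g where g: "continuous_on UNIV g"
    and ge: "(\<integral>\<^sup>+x. indicator (cball 0 (R + 1)) x * ennreal \<bar>w x - g x\<bar> \<partial>lborel) < ennreal e1"
    using L1_approx_continuous[of w "R + 1" e1] w e1 unfolding loc_integrable_def by blast
  have [measurable]: "g \<in> borel_measurable borel" by (intro borel_measurable_continuous_onI g)
  obtain d where d: "d > 0" "\<And>t x. 0 < t \<Longrightarrow> t < d \<Longrightarrow> norm x \<le> R \<Longrightarrow> \<bar>convolve (mollifier t) g x - ?c * g x\<bar> \<le> ?c * e1"
    using mollify_continuous[OF g e1(1), where R=R] by blast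
  have "(\<integral>\<^sup>+x. indicator ?B x * ennreal \<bar>convolve (mollifier t) w x - ?c * w x\<bar> \<partial>lborel) \<le> ennreal e"
    if t: "0 < t" "t < min d 1" for t
  proof -
    note i = convolve_mollifier_integrable[OF t(1) w] convolve_mollifier_integrable[OF t(1) continuous_loc_integrable[OF g]]
      convolve_mollifier_integrable[OF t(1) loc_integrable_diff[OF w continuous_loc_integrable[OF g]]]
    have pt: "indicator ?B x * ennreal \<bar>convolve (mollifier t) w x - ?c * w x\<bar> \<le>
       indicator ?B x * (\<integral>\<^sup>+y. ennreal (mollifier t (x - y) * \<bar>w y - g y\<bar>) \<partial>lborel)
       + (ennreal (?c * e1) * indicator ?B x + ennreal ?c * (indicator (cball 0 (R + 1)) x * ennreal \<bar>w x - g x\<bar>))" for x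
    proof (cases "x \<in> ?B")
      case True
      have "convolve (mollifier t) w x - convolve (mollifier t) g x = convolve (mollifier t) (\<lambda>y. w y - g y) x"
        unfolding convolve_def using i by (simp add: right_diff_distrib)
      also have "\<bar>\<dots>\<bar> \<le> (\<integral>y. mollifier t (x - y) * \<bar>w y - g y\<bar> \<partial>lborel)"
        unfolding convolve_def using integral_norm_bound[of lborel "\<lambda>y. mollifier t (x - y) * (w y - g y)"]
        by (simp add: abs_mult mollifier_nonneg[OF t(1)])
      finally have "\<bar>convolve (mollifier t) w x - ?c * w x\<bar> \<le> (\<integral>y. mollifier t (x - y) * \<bar>w y - g y\<bar> \<partial>lborel) + (?c * e1 + ?c * \<bar>w x - g x\<bar>)"
      proof -
        assume 1: "\<bar>convolve (mollifier t) w x - convolve (mollifier t) g x\<bar> \<le> (\<integral>y. mollifier t (x - y) * \<bar>w y - g y\<bar> \<partial>lborel)"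
        have 2: "\<bar>convolve (mollifier t) g x - ?c * g x\<bar> \<le> ?c * e1" using d(2)[of t x] t True by simp
        have 3: "\<bar>?c * g x - ?c * w x\<bar> = ?c * \<bar>w x - g x\<bar>"
          using c by (simp add: right_diff_distrib[symmetric] abs_mult)
        show ?thesis using 1 2 3 by linarith
      qed
      then have "ennreal \<bar>convolve (mollifier t) w x - ?c * w x\<bar> \<le> ennreal ((\<integral>y. mollifier t (x - y) * \<bar>w y - g y\<bar> \<partial>lborel) + (?c * e1 + ?c * \<bar>w x - g x\<bar>))"
        by (rule ennreal_leI)
      also have "\<dots> = ennreal (\<integral>y. mollifier t (x - y) * \<bar>w y - g y\<bar> \<partial>lborel) + (ennreal (?c * e1) + ennreal ?c * ennreal \<bar>w x - g x\<bar>)"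
      proof -
        have "0 \<le> (\<integral>y. mollifier t (x - y) * \<bar>w y - g y\<bar> \<partial>lborel)"
          by (intro Bochner_Integration.integral_nonneg mult_nonneg_nonneg mollifier_nonneg t) auto
        moreover have "0 \<le> ?c * e1" "0 \<le> ?c * \<bar>w x - g x\<bar>" using c e1(1) by simp_all
        ultimately show ?thesis using c by (simp add: ennreal_mult)
      qed
      also have "ennreal (\<integral>y. mollifier t (x - y) * \<bar>w y - g y\<bar> \<partial>lborel) = (\<integral>\<^sup>+y. ennreal (mollifier t (x - y) * \<bar>w y - g y\<bar>) \<partial>lborel)"
      proof (rule nn_integral_eq_integral[symmetric])
        show "integrable lborel (\<lambda>y. mollifier t (x - y) * \<bar>w y - g y\<bar>)"
          using integrable_abs[OF i(3)[of x]] by (simp add: abs_mult mollifier_nonneg[OF t(1)])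
      qed (auto intro!: AE_I2 mult_nonneg_nonneg mollifier_nonneg t)
      finally show ?thesis using True by simp
    qed simp
    have "(\<integral>\<^sup>+x. indicator ?B x * ennreal \<bar>convolve (mollifier t) w x - ?c * w x\<bar> \<partial>lborel)
      \<le> (\<integral>\<^sup>+x. indicator ?B x * (\<integral>\<^sup>+y. ennreal (mollifier t (x - y) * \<bar>w y - g y\<bar>) \<partial>lborel) \<partial>lborel)
        + ((\<integral>\<^sup>+x. ennreal (?c * e1) * indicator ?B x \<partial>lborel) + (\<integral>\<^sup>+x. ennreal ?c * (indicator (cball 0 (R + 1)) x * ennreal \<bar>w x - g x\<bar>) \<partial>lborel))"
      by (rule order_trans[OF nn_integral_mono[OF pt]]) (simp add: nn_integral_add)
    also have "\<dots> \<le> ennreal ?c * ennreal e1 + (ennreal (?c * e1) * ennreal v + ennreal ?c * ennreal e1)"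
    proof (intro add_mono)
      show "(\<integral>\<^sup>+x. indicator ?B x * (\<integral>\<^sup>+y. ennreal (mollifier t (x - y) * \<bar>w y - g y\<bar>) \<partial>lborel) \<partial>lborel) \<le> ennreal ?c * ennreal e1"
        using t less_imp_le[OF ge] by (intro order_trans[OF nn_integral_convolve_mollifier] mult_left_mono) auto
      show "(\<integral>\<^sup>+x. ennreal (?c * e1) * indicator ?B x \<partial>lborel) \<le> ennreal (?c * e1) * ennreal v"
        by (simp add: nn_integral_cmult v)
      show "(\<integral>\<^sup>+x. ennreal ?c * (indicator (cball 0 (R + 1)) x * ennreal \<bar>w x - g x\<bar>) \<partial>lborel) \<le> ennreal ?c * ennreal e1"
        using less_imp_le[OF ge] by (subst nn_integral_cmult) (auto intro!: mult_left_mono)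
    qed
    also have "\<dots> = ennreal e"
      using c e1(1) v(2) unfolding e1(2)[symmetric]
      by (simp add: ennreal_mult[symmetric] ennreal_plus[symmetric] mult_ac del: ennreal_plus)
    finally show ?thesis .
  qed
  with that[of "min d 1"] d(1) show ?thesis by simp
qed

lemma convolve_mollifier_measurable: "loc_integrable w \<Longrightarrow> t > 0 \<Longrightarrow> convolve (mollifier t) w \<in> borel_measurable borel"
  by (intro borel_measurable_continuous_onI convolve_continuous[where r=t] mollifier_continuous) (auto simp: mollifier_eq_0)

text \<open>L^1 convergence yields an almost everywhere convergent subsequence. One sequence of
  scales per ball is enough, because it is used only to pass to limits in statements that do not
  mention it.\<close>

lemma mollify_AE:
  fixes w :: "'a::euclidean_space \<Rightarrow> real"
  assumes w: "loc_integrable w"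
  obtains s :: "nat \<Rightarrow> real" where "\<And>n. 0 < s n" "s \<longlonglongrightarrow> 0"
    "AE x in lborel. norm x \<le> R \<longrightarrow> (\<lambda>n. convolve (mollifier (s n)) w x) \<longlonglongrightarrow> mollifier_mass TYPE('a) * w x"
proof -
  note [measurable] = loc_integrable_measurable[OF w]
  let ?c = "mollifier_mass TYPE('a)" and ?B = "cball (0::'a) R"
  have [measurable]: "?B \<in> sets borel" "cball (0::'a) (R + 1) \<in> sets borel" by simp_all
  have "\<exists>d>0. \<forall>t. 0 < t \<and> t < d \<longrightarrow>
    (\<integral>\<^sup>+x. indicator ?B x * ennreal \<bar>convolve (mollifier t) w x - ?c * w x\<bar> \<partial>lborel) \<le> ennreal (1 / Suc n)" for n
  proof -
    have "0 < 1 / real (Suc n)" by simp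
    then show ?thesis
    proof (rule mollify_L1[OF w, where R=R])
      fix d assume "0 < d" "\<And>t. 0 < t \<Longrightarrow> t < d \<Longrightarrow>
        (\<integral>\<^sup>+x. indicator ?B x * ennreal \<bar>convolve (mollifier t) w x - ?c * w x\<bar> \<partial>lborel) \<le> ennreal (1 / real (Suc n))"
      then show ?thesis by (intro exI[of _ d] conjI allI impI) blast+
    qed
  qed
  then obtain d where d: "\<And>n. d n > 0" "\<And>n t. 0 < t \<Longrightarrow> t < d n \<Longrightarrow>
    (\<integral>\<^sup>+x. indicator ?B x * ennreal \<bar>convolve (mollifier t) w x - ?c * w x\<bar> \<partial>lborel) \<le> ennreal (1 / Suc n)" by metis
  \<comment> \<open>The term 1 / Suc n forces convergence to 0, and halving makes the inequalities
    strict.\<close>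
  define s where "s n = min (d n) (1 / Suc n) / 2" for n
  have s: "0 < s n" "s n < d n" "s n < 1 / Suc n" for n
    using d(1)[of n] by (auto simp: s_def min_def field_simps)
  have s0: "s \<longlonglongrightarrow> 0"
    by (rule tendsto_sandwich[OF _ _ tendsto_const LIMSEQ_inverse_real_of_nat])
      (use s in \<open>auto simp: inverse_eq_divide less_imp_le\<close>)
  let ?F = "\<lambda>n x. indicator ?B x * \<bar>convolve (mollifier (s n)) w x - ?c * w x\<bar>"
  have [measurable]: "convolve (mollifier (s n)) w \<in> borel_measurable borel" for n
    using convolve_mollifier_measurable[OF w s(1)] .
  have Fle: "(\<integral>\<^sup>+x. ennreal (?F n x) \<partial>lborel) \<le> ennreal (1 / Suc n)" for n
    using d(2)[OF s(1,2), of n] by (simp add: ennreal_mult ennreal_indicator)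
  have Fi: "integrable lborel (?F n)" for n
    using Fle[of n] by (intro integrableI_nonneg) (auto simp: le_less_trans[OF _ ennreal_less_top])
  have "(\<lambda>n. \<integral>x. norm (?F n x) \<partial>lborel) \<longlonglongrightarrow> 0"
  proof (rule tendsto_sandwich[OF _ _ tendsto_const LIMSEQ_inverse_real_of_nat])
    have "(\<integral>x. norm (?F n x) \<partial>lborel) \<le> inverse (real (Suc n))" for n
    proof -
      have "ennreal (\<integral>x. ?F n x \<partial>lborel) \<le> ennreal (1 / Suc n)"
        using Fle[of n] nn_integral_eq_integral[OF Fi, of n] by simp
      then show ?thesis by (subst (asm) ennreal_le_iff) (auto simp: inverse_eq_divide)
    qed
    then show "\<forall>\<^sub>F n in sequentially. (\<integral>x. norm (?F n x) \<partial>lborel) \<le> inverse (real (Suc n))" by simp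
  qed simp
  from tendsto_L1_AE_subseq[OF Fi this] obtain r :: "nat \<Rightarrow> nat" where r: "strict_mono r"
    "AE x in lborel. (\<lambda>n. ?F (r n) x) \<longlonglongrightarrow> 0" by blast
  show ?thesis
  proof (rule that[of "s \<circ> r"])
    show "AE x in lborel. norm x \<le> R \<longrightarrow> (\<lambda>n. convolve (mollifier ((s \<circ> r) n)) w x) \<longlonglongrightarrow> ?c * w x"
      using r(2)
    proof eventually_elim
      case (elim x)
      show ?case
      proof
        assume "norm x \<le> R"
        then have "(\<lambda>n. \<bar>convolve (mollifier (s (r n))) w x - ?c * w x\<bar>) \<longlonglongrightarrow> 0" using elim by simp
        then show "(\<lambda>n. convolve (mollifier ((s \<circ> r) n)) w x) \<longlonglongrightarrow> ?c * w x"
          by (simp add: tendsto_rabs_zero_iff LIM_zero_iff)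
      qed
    qed
    show "(s \<circ> r) \<longlonglongrightarrow> 0" using LIMSEQ_subseq_LIMSEQ[OF s0 r(1)] .
  qed (use s in auto)
qed

subsection \<open>Boundedness\<close>

text \<open>For N >= 3 the integral over all scales would be a multiple of |z|^(2 - N), the
  Newtonian kernel. Cutting at r localises it and treats all dimensions alike. The values lie in
  \<open>ennreal\<close> because the kernel is infinite at 0 for N >= 2.\<close>

definition parametrix :: "real \<Rightarrow> 'a::euclidean_space \<Rightarrow> ennreal" where
  "parametrix r z = (\<integral>\<^sup>+\<tau>. indicator {0<..r} \<tau> * ennreal (\<tau> * potential \<tau> z) \<partial>lborel)"

definition parametrix_op :: "real \<Rightarrow> ('a::euclidean_space \<Rightarrow> ennreal) \<Rightarrow> 'a \<Rightarrow> ennreal" where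
  "parametrix_op r h x = (\<integral>\<^sup>+y. parametrix r (x - y) * h y \<partial>lborel)"

lemma parametrix_measurable [measurable]: "parametrix r \<in> borel_measurable borel"
  unfolding parametrix_def[abs_def] by measurable

text \<open>Tonelli turns the operator into a superposition of scales, each of which sees a single
  ball.\<close>

lemma parametrix_op_eq:
  assumes [measurable]: "h \<in> borel_measurable borel"
  shows "parametrix_op r h x = (\<integral>\<^sup>+\<tau>. indicator {0<..r} \<tau> * (\<integral>\<^sup>+y. ennreal (\<tau> * potential \<tau> (x - y)) * h y \<partial>lborel) \<partial>lborel)"
proof -
  have "parametrix_op r h x = (\<integral>\<^sup>+y. (\<integral>\<^sup>+\<tau>. indicator {0<..r} \<tau> * (ennreal (\<tau> * potential \<tau> (x - y)) * h y) \<partial>lborel) \<partial>lborel)"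
    unfolding parametrix_op_def parametrix_def
    by (intro nn_integral_cong, subst nn_integral_multc[symmetric]) (auto simp: mult.assoc)
  also have "\<dots> = (\<integral>\<^sup>+\<tau>. (\<integral>\<^sup>+y. indicator {0<..r} \<tau> * (ennreal (\<tau> * potential \<tau> (x - y)) * h y) \<partial>lborel) \<partial>lborel)"
    by (rule lborel_pair.Fubini') measurable
  also have "\<dots> = (\<integral>\<^sup>+\<tau>. indicator {0<..r} \<tau> * (\<integral>\<^sup>+y. ennreal (\<tau> * potential \<tau> (x - y)) * h y \<partial>lborel) \<partial>lborel)"
    by (intro nn_integral_cong nn_integral_cmult) measurable
  finally show ?thesis .
qed

text \<open>The kernel is radial. This lets a pointwise bound on the operator applied to Q control
  integrals in which it acts on Q w.\<close>

lemma parametrix_op_symmetric: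
  assumes [measurable]: "h \<in> borel_measurable borel" "k \<in> borel_measurable borel"
  shows "(\<integral>\<^sup>+x. k x * parametrix_op r h x \<partial>lborel) = (\<integral>\<^sup>+y. h y * parametrix_op r k y \<partial>lborel)"
proof -
  have K: "parametrix r (x - y) = parametrix r (y - x)" for x y :: 'a
    by (simp add: parametrix_def potential_def norm_minus_commute)
  have "(\<integral>\<^sup>+x. k x * parametrix_op r h x \<partial>lborel) = (\<integral>\<^sup>+x. (\<integral>\<^sup>+y. k x * (parametrix r (x - y) * h y) \<partial>lborel) \<partial>lborel)"
    unfolding parametrix_op_def by (simp add: nn_integral_cmult)
  also have "\<dots> = (\<integral>\<^sup>+y. (\<integral>\<^sup>+x. k x * (parametrix r (x - y) * h y) \<partial>lborel) \<partial>lborel)"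
    by (rule lborel_pair.Fubini') measurable
  also have "\<dots> = (\<integral>\<^sup>+y. (\<integral>\<^sup>+x. h y * (parametrix r (y - x) * k x) \<partial>lborel) \<partial>lborel)"
    by (intro nn_integral_cong) (metis K mult.assoc mult.commute)
  also have "\<dots> = (\<integral>\<^sup>+y. h y * parametrix_op r k y \<partial>lborel)"
    unfolding parametrix_op_def by (simp add: nn_integral_cmult)
  finally show ?thesis .
qed

lemma parametrix_op_mono_AE:
  assumes "AE y in lborel. h y \<le> k y" shows "parametrix_op r h x \<le> parametrix_op r k x"
  unfolding parametrix_op_def
proof (rule nn_integral_mono_AE)
  show "AE y in lborel. parametrix r (x - y) * h y \<le> parametrix r (x - y) * k y"
    using assms by eventually_elim (simp add: mult_left_mono)
qed

lemma parametrix_op_add_cmult: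
  assumes [measurable]: "h \<in> borel_measurable borel" "k \<in> borel_measurable borel"
  shows "parametrix_op r (\<lambda>y. h y + c * k y) x = parametrix_op r h x + c * parametrix_op r k x"
proof -
  have "parametrix_op r (\<lambda>y. h y + c * k y) x = (\<integral>\<^sup>+y. parametrix r (x - y) * h y + c * (parametrix r (x - y) * k y) \<partial>lborel)"
    unfolding parametrix_op_def by (intro nn_integral_cong) (simp add: distrib_left mult.left_commute)
  also have "\<dots> = parametrix_op r h x + c * parametrix_op r k x"
    unfolding parametrix_op_def by (simp add: nn_integral_add nn_integral_cmult)
  finally show ?thesis .
qed

lemma potential_bounded: "\<exists>B>0. \<forall>t>0. \<forall>z::'a::euclidean_space. potential t z \<le> B / t ^ DIM('a)"
proof -
  obtain B where B: "\<And>r. r \<le> 1 \<Longrightarrow> \<bar>flat_exp 0 r\<bar> \<le> B" using flat_exp_bounded by blast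
  have "potential t z \<le> (B + 1) / t ^ DIM('a)" if "t > 0" for t and z :: 'a
    using B[of "1 - (norm z)\<^sup>2 / t\<^sup>2"] that by (simp add: potential_def divide_right_mono)
  moreover have "0 \<le> B" using B[of 0] by simp
  ultimately show ?thesis by (intro exI[of _ "B + 1"]) auto
qed

lemma nn_integral_powr:
  assumes "a > -1" "0 \<le> r" "0 \<le> c"
  shows "(\<integral>\<^sup>+\<tau>. indicator {0<..r} \<tau> * ennreal (c * \<tau> powr a) \<partial>lborel) \<le> ennreal (c * (r powr (a + 1) / (a + 1)))"
proof -
  have "(\<integral>\<^sup>+\<tau>. ennreal (indicator {0..r} \<tau> * (c * \<tau> powr a)) \<partial>lborel) = ennreal (c * (r powr (a + 1) / (a + 1)))"
    using assms by (intro nn_integral_has_integral_lebesgue has_integral_mult_right has_integral_powr_from_0) auto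
  moreover have "(\<integral>\<^sup>+\<tau>. indicator {0<..r} \<tau> * ennreal (c * \<tau> powr a) \<partial>lborel)
      \<le> (\<integral>\<^sup>+\<tau>. ennreal (indicator {0..r} \<tau> * (c * \<tau> powr a)) \<partial>lborel)"
    by (intro nn_integral_mono) (auto simp: indicator_def)
  ultimately show ?thesis by simp
qed

text \<open>The smallness of this bound for small \<open>r\<close> is what makes the iteration operator a contraction.\<close>

lemma parametrix_op_bound:
  fixes Q :: "'a::euclidean_space \<Rightarrow> real"
  assumes [measurable]: "Q \<in> borel_measurable borel"
    and mass: "\<And>x r. 0 < r \<Longrightarrow> r \<le> 1 \<Longrightarrow>
      (\<integral>\<^sup>+y. indicator (cball x r) y * ennreal (Q y) \<partial>lborel) \<le> ennreal (A * r powr (real DIM('a) - \<beta>))"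
    and beta: "\<beta> < 2" and A: "A \<ge> 0"
  obtains C where "C \<ge> 0" "\<And>x r. 0 < r \<Longrightarrow> r \<le> 1 \<Longrightarrow> parametrix_op r (\<lambda>y. ennreal (Q y)) x \<le> ennreal (C * r powr (2 - \<beta>))"
proof -
  obtain B where B: "B > 0" "\<And>t z::'a. t > 0 \<Longrightarrow> potential t z \<le> B / t ^ DIM('a)" using potential_bounded by blast
  have "parametrix_op r (\<lambda>y. ennreal (Q y)) x \<le> ennreal (B * A / (2 - \<beta>) * r powr (2 - \<beta>))" if r: "0 < r" "r \<le> 1" for x r
  proof -
    have inner: "(\<integral>\<^sup>+y. ennreal (\<tau> * potential \<tau> (x - y)) * ennreal (Q y) \<partial>lborel) \<le> ennreal (B * A * \<tau> powr (1 - \<beta>))"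
      if t: "0 < \<tau>" "\<tau> \<le> r" for \<tau>
    proof -
      have [measurable]: "cball x \<tau> \<in> sets borel" by simp
      have "(\<integral>\<^sup>+y. ennreal (\<tau> * potential \<tau> (x - y)) * ennreal (Q y) \<partial>lborel)
          \<le> (\<integral>\<^sup>+y. ennreal (\<tau> * (B / \<tau> ^ DIM('a))) * (indicator (cball x \<tau>) y * ennreal (Q y)) \<partial>lborel)"
      proof (intro nn_integral_mono)
        fix y
        show "ennreal (\<tau> * potential \<tau> (x - y)) * ennreal (Q y) \<le> ennreal (\<tau> * (B / \<tau> ^ DIM('a))) * (indicator (cball x \<tau>) y * ennreal (Q y))"
        proof (cases "norm (x - y) \<le> \<tau>")
          case True
          have "\<tau> * potential \<tau> (x - y) \<le> \<tau> * (B / \<tau> ^ DIM('a))" using B(2) t by (intro mult_left_mono) auto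
          then show ?thesis using True by (auto simp: dist_norm intro!: mult_right_mono ennreal_leI)
        qed (use t in \<open>simp add: potential_eq_0\<close>)
      qed
      also have "\<dots> = ennreal (\<tau> * (B / \<tau> ^ DIM('a))) * (\<integral>\<^sup>+y. indicator (cball x \<tau>) y * ennreal (Q y) \<partial>lborel)"
        by (intro nn_integral_cmult) measurable
      also have "\<dots> \<le> ennreal (\<tau> * (B / \<tau> ^ DIM('a))) * ennreal (A * \<tau> powr (real DIM('a) - \<beta>))"
        using t r by (intro mult_left_mono mass) auto
      also have "\<dots> = ennreal ((\<tau> * (B / \<tau> ^ DIM('a))) * (A * \<tau> powr (real DIM('a) - \<beta>)))"
        using t B(1) A by (intro ennreal_mult[symmetric]) auto
      \<comment> \<open>The count of powers: the kernel contributes the exponent 1 - N and the mass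
        N - \<beta>. The resulting 1 - \<beta> exceeds -1 since \<beta> < 2.\<close>
      also have "(\<tau> * (B / \<tau> ^ DIM('a))) * (A * \<tau> powr (real DIM('a) - \<beta>)) = B * A * \<tau> powr (1 - \<beta>)"
        using t by (simp add: powr_diff powr_realpow)
      finally show ?thesis .
    qed
    have "parametrix_op r (\<lambda>y. ennreal (Q y)) x \<le> (\<integral>\<^sup>+\<tau>. indicator {0<..r} \<tau> * ennreal (B * A * \<tau> powr (1 - \<beta>)) \<partial>lborel)"
      by (subst parametrix_op_eq, simp, intro nn_integral_mono) (auto simp: indicator_def inner)
    also have "\<dots> \<le> ennreal (B * A * (r powr (1 - \<beta> + 1) / (1 - \<beta> + 1)))"
      using beta r B(1) A by (intro nn_integral_powr) auto
    finally show ?thesis by (simp add: algebra_simps)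
  qed
  moreover have "B * A / (2 - \<beta>) \<ge> 0" using B A beta by auto
  ultimately show ?thesis using that by blast
qed

text \<open>Absolute values in the mollification formula, with the scales extended from [s, t] to
  all of (0, t]; the right-hand side is then free of s.\<close>

lemma convolve_mollifier_le_parametrix_op:
  fixes u f :: "'a::euclidean_space \<Rightarrow> real"
  assumes u: "loc_integrable u" and [measurable]: "f \<in> borel_measurable borel"
    and weak: "mollified_poisson u f"
    and st: "0 < s" "s \<le> t"
  shows "ennreal \<bar>convolve (mollifier s) u x\<bar> \<le> ennreal \<bar>convolve (mollifier t) u x\<bar> + parametrix_op t (\<lambda>y. ennreal \<bar>f y\<bar>) x"
proof -
  let ?I = "\<integral>\<tau>. indicator {s..t} \<tau> * (\<tau> * convolve (potential \<tau>) f x) \<partial>lborel"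
  note d = convolve_mollifier_diff[OF u weak st]
  have pt: "ennreal \<bar>indicator {s..t} \<tau> * (\<tau> * convolve (potential \<tau>) f x)\<bar> \<le>
      indicator {0<..t} \<tau> * (\<integral>\<^sup>+y. ennreal (\<tau> * potential \<tau> (x - y)) * ennreal \<bar>f y\<bar> \<partial>lborel)" for \<tau>
  proof (cases "\<tau> \<in> {s..t}")
    case True
    then have t0: "\<tau> > 0" using st by auto
    \<comment> \<open>If the product is not integrable, the Bochner integral on the left is 0 by
      convention and the inequality still holds.\<close>
    have "ennreal \<bar>convolve (potential \<tau>) f x\<bar> \<le> (\<integral>\<^sup>+y. ennreal \<bar>potential \<tau> (x - y) * f y\<bar> \<partial>lborel)"
      unfolding convolve_def
      using integral_norm_bound_ennreal[of lborel "\<lambda>y. potential \<tau> (x - y) * f y"]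
      by (cases "integrable lborel (\<lambda>y. potential \<tau> (x - y) * f y)") (auto simp: not_integrable_integral_eq)
    then have "ennreal \<tau> * ennreal \<bar>convolve (potential \<tau>) f x\<bar> \<le> ennreal \<tau> * (\<integral>\<^sup>+y. ennreal \<bar>potential \<tau> (x - y) * f y\<bar> \<partial>lborel)"
      by (rule mult_left_mono) simp
    also have "\<dots> = (\<integral>\<^sup>+y. ennreal \<tau> * ennreal \<bar>potential \<tau> (x - y) * f y\<bar> \<partial>lborel)"
      by (rule nn_integral_cmult[symmetric]) measurable
    also have "\<dots> = (\<integral>\<^sup>+y. ennreal (\<tau> * potential \<tau> (x - y)) * ennreal \<bar>f y\<bar> \<partial>lborel)"
      using t0 by (intro nn_integral_cong) (simp add: abs_mult ennreal_mult potential_nonneg mult.assoc)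
    finally show ?thesis using True t0 by (simp add: abs_mult ennreal_mult)
  qed simp
  have "ennreal \<bar>?I\<bar> \<le> (\<integral>\<^sup>+\<tau>. ennreal \<bar>indicator {s..t} \<tau> * (\<tau> * convolve (potential \<tau>) f x)\<bar> \<partial>lborel)"
    using integral_norm_bound_ennreal[OF d(1)[of x]] by simp
  also have "\<dots> \<le> parametrix_op t (\<lambda>y. ennreal \<bar>f y\<bar>) x"
    by (subst parametrix_op_eq) (simp, intro nn_integral_mono pt)
  finally have I: "ennreal \<bar>?I\<bar> \<le> parametrix_op t (\<lambda>y. ennreal \<bar>f y\<bar>) x" .
  have "ennreal \<bar>convolve (mollifier s) u x\<bar> \<le> ennreal (\<bar>convolve (mollifier t) u x\<bar> + \<bar>?I\<bar>)"
    using d(2)[of x] by (intro ennreal_leI) simp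
  also have "\<dots> = ennreal \<bar>convolve (mollifier t) u x\<bar> + ennreal \<bar>?I\<bar>" by simp
  also have "\<dots> \<le> ennreal \<bar>convolve (mollifier t) u x\<bar> + parametrix_op t (\<lambda>y. ennreal \<bar>f y\<bar>) x" using I by (rule add_left_mono)
  finally show ?thesis .
qed

lemma abs_le_parametrix_op:
  fixes u f :: "'a::euclidean_space \<Rightarrow> real"
  assumes u: "loc_integrable u" and f: "f \<in> borel_measurable borel"
    and weak: "mollified_poisson u f" and t: "t > 0"
  shows "AE x in lborel. ennreal (mollifier_mass TYPE('a) * \<bar>u x\<bar>) \<le> ennreal \<bar>convolve (mollifier t) u x\<bar> + parametrix_op t (\<lambda>y. ennreal \<bar>f y\<bar>) x"
proof -
  \<comment> \<open>The scales supplied by \<open>mollify_AE\<close> depend on the radius. The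
    inequality does not mention them, so countably many integer radii exhaust the space.\<close>
  have "AE x in lborel. norm x \<le> real m \<longrightarrow>
    ennreal (mollifier_mass TYPE('a) * \<bar>u x\<bar>) \<le> ennreal \<bar>convolve (mollifier t) u x\<bar> + parametrix_op t (\<lambda>y. ennreal \<bar>f y\<bar>) x" for m :: nat
  proof (rule mollify_AE[OF u, of "real m"])
    fix s :: "nat \<Rightarrow> real"
    assume s: "\<And>n. 0 < s n" "s \<longlonglongrightarrow> 0"
      and ae: "AE x in lborel. norm x \<le> real m \<longrightarrow> (\<lambda>n. convolve (mollifier (s n)) u x) \<longlonglongrightarrow> mollifier_mass TYPE('a) * u x"
    from ae show ?thesis
    proof eventually_elim
      case (elim x)
      show ?case
      proof
        assume "norm x \<le> real m"
        with elim have "(\<lambda>n. ennreal \<bar>convolve (mollifier (s n)) u x\<bar>) \<longlonglongrightarrow> ennreal \<bar>mollifier_mass TYPE('a) * u x\<bar>"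
          by (intro tendsto_ennrealI tendsto_rabs) auto
        moreover have "eventually (\<lambda>n. s n < t) sequentially"
          using s(2) t by (rule order_tendstoD)
        then have "eventually (\<lambda>n. ennreal \<bar>convolve (mollifier (s n)) u x\<bar> \<le> ennreal \<bar>convolve (mollifier t) u x\<bar> + parametrix_op t (\<lambda>y. ennreal \<bar>f y\<bar>) x) sequentially"
          by eventually_elim (use convolve_mollifier_le_parametrix_op[OF u f weak s(1)] in auto)
        ultimately have "ennreal \<bar>mollifier_mass TYPE('a) * u x\<bar> \<le> ennreal \<bar>convolve (mollifier t) u x\<bar> + parametrix_op t (\<lambda>y. ennreal \<bar>f y\<bar>) x"
          by (rule tendsto_upperbound) simp
        then show "ennreal (mollifier_mass TYPE('a) * \<bar>u x\<bar>) \<le> ennreal \<bar>convolve (mollifier t) u x\<bar> + parametrix_op t (\<lambda>y. ennreal \<bar>f y\<bar>) x"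
          using mollifier_mass_pos[where 'a='a] by (simp add: abs_mult)
      qed
    qed
  qed
  then have "AE x in lborel. \<forall>m::nat. norm x \<le> real m \<longrightarrow>
    ennreal (mollifier_mass TYPE('a) * \<bar>u x\<bar>) \<le> ennreal \<bar>convolve (mollifier t) u x\<bar> + parametrix_op t (\<lambda>y. ennreal \<bar>f y\<bar>) x"
    unfolding AE_all_countable by blast
  then show ?thesis by eventually_elim (use real_arch_simple in blast)
qed

text \<open>Halving the weighted integral of the excess proves it zero only because it is finite,
  which is the purpose of \<open>fin\<close>. The normalisation Q >= 1 then turns a vanishing
  weighted integral into a vanishing excess.\<close>

lemma mollified_poisson_bounded:
  fixes u f Q :: "'a::euclidean_space \<Rightarrow> real"
  assumes u: "loc_integrable u" and f: "f \<in> borel_measurable borel" and [measurable]: "Q \<in> borel_measurable borel"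
    and weak: "mollified_poisson u f"
    and fQ: "AE y in lborel. \<bar>f y\<bar> \<le> Q y * \<bar>u y\<bar>" and Q1: "\<And>y. 1 \<le> Q y"
    and mass: "\<And>x r. 0 < r \<Longrightarrow> r \<le> 1 \<Longrightarrow>
      (\<integral>\<^sup>+y. indicator (cball x r) y * ennreal (Q y) \<partial>lborel) \<le> ennreal (A * r powr (real DIM('a) - \<beta>))"
    and beta: "\<beta> < 2" and A: "A \<ge> 0"
    and umass: "\<And>x. ball_mass u x 1 \<le> L"
    and fin: "\<And>M. M \<ge> 1 \<Longrightarrow> (\<integral>\<^sup>+y. ennreal (Q y * max 0 (\<bar>u y\<bar> - M)) \<partial>lborel) < \<infinity>"
  shows "\<exists>M\<ge>0. AE y in lborel. \<bar>u y\<bar> \<le> M"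
proof -
  note [measurable] = loc_integrable_measurable[OF u]
  let ?c = "mollifier_mass TYPE('a)"
  have c: "?c > 0" by (rule mollifier_mass_pos)
  obtain C where C: "C \<ge> 0" "\<And>x r. 0 < r \<Longrightarrow> r \<le> 1 \<Longrightarrow> parametrix_op r (\<lambda>y. ennreal (Q y)) x \<le> ennreal (C * r powr (2 - \<beta>))"
    using parametrix_op_bound[OF _ mass beta A] by auto
  \<comment> \<open>Solves C r^(2 - \<beta>) <= mass / 2, with C + 1 in place of C to avoid division
    by 0; the minimum with 1 stays in the range of the mass bound.\<close>
  define r where "r = min 1 ((?c / (2 * (C + 1))) powr (1 / (2 - \<beta>)))"
  have r: "0 < r" "r \<le> 1" using c C(1) by (auto simp: r_def)
  have small: "parametrix_op r (\<lambda>y. ennreal (Q y)) x \<le> ennreal (?c / 2)" for x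
  proof -
    have "r powr (2 - \<beta>) \<le> ((?c / (2 * (C + 1))) powr (1 / (2 - \<beta>))) powr (2 - \<beta>)"
      using r beta by (intro powr_mono2) (auto simp: r_def)
    also have "\<dots> = ?c / (2 * (C + 1))" using c C(1) beta by (simp add: powr_powr)
    finally have "C * r powr (2 - \<beta>) \<le> C * (?c / (2 * (C + 1)))" using C(1) by (rule mult_left_mono)
    also have "\<dots> \<le> ?c / 2" using C(1) c by (simp add: field_simps)
    finally show ?thesis using C(2)[OF r, of x] by (meson ennreal_leI order_trans)
  qed
  obtain Bt where Bt: "Bt \<ge> 0" "\<And>t z::'a. t > 0 \<Longrightarrow> mollifier t z \<le> Bt / t ^ DIM('a)" using mollifier_bounded by blast
  define B where "B = Bt / r ^ DIM('a) * L"
  have "ball_mass u x r \<le> L" for x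
  proof -
    have "ball_mass u x r \<le> ball_mass u x 1" using u r(2) by (rule ball_mass_mono)
    then show ?thesis using umass[of x] by simp
  qed
  then have B: "\<bar>convolve (mollifier r) u x\<bar> \<le> B" for x
  proof -
    have "\<bar>convolve (mollifier r) u x\<bar> \<le> Bt / r ^ DIM('a) * ball_mass u x r"
      using Bt(2)[OF r(1)] r u
      by (intro convolve_integrable_bound(2)) (auto simp: mollifier_eq_0 mollifier_nonneg)
    also have "\<dots> \<le> B" unfolding B_def using \<open>ball_mass u x r \<le> L\<close> Bt(1) r by (intro mult_left_mono) auto
    finally show ?thesis .
  qed
  \<comment> \<open>The mollified term then costs at most M * mass / 2, and so does the operator
    applied to M Q. Together they make up the M * mass that is subtracted when |u| is replaced by
    its excess over M.\<close>
  define M where "M = max 1 (2 * B / ?c)"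
  have M: "M \<ge> 1" "B \<le> M * ?c / 2"
    using c by (auto simp: M_def max_def field_simps)
  define w where "w y = max 0 (\<bar>u y\<bar> - M)" for y
  have w0: "w y \<ge> 0" for y by (simp add: w_def)
  have [measurable]: "w \<in> borel_measurable borel" unfolding w_def by measurable
  let ?Qw = "\<lambda>y. ennreal (Q y * w y)"
  have "AE x in lborel. ennreal (?c * w x) \<le> parametrix_op r ?Qw x"
    using abs_le_parametrix_op[OF u f weak r(1)]
  proof eventually_elim
    case (elim x)
    have "parametrix_op r (\<lambda>y. ennreal \<bar>f y\<bar>) x \<le> parametrix_op r (\<lambda>y. ?Qw y + ennreal M * ennreal (Q y)) x"
    proof (rule parametrix_op_mono_AE)
      show "AE y in lborel. ennreal \<bar>f y\<bar> \<le> ?Qw y + ennreal M * ennreal (Q y)"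
        using fQ
      proof eventually_elim
        case (elim y)
        have q: "Q y \<ge> 0" using Q1[of y] by simp
        have "Q y * \<bar>u y\<bar> \<le> Q y * (w y + M)" using q by (intro mult_left_mono) (auto simp: w_def)
        then have "ennreal \<bar>f y\<bar> \<le> ennreal (Q y * w y + M * Q y)"
          using elim by (intro ennreal_leI) (simp add: algebra_simps)
        also have "\<dots> = ?Qw y + ennreal M * ennreal (Q y)"
          using q w0[of y] M(1) by (simp add: ennreal_mult)
        finally show ?case .
      qed
    qed
    also have "\<dots> = parametrix_op r ?Qw x + ennreal M * parametrix_op r (\<lambda>y. ennreal (Q y)) x"
      by (rule parametrix_op_add_cmult) measurable
    also have "\<dots> \<le> parametrix_op r ?Qw x + ennreal M * ennreal (?c / 2)"
      using small[of x] by (intro add_left_mono mult_left_mono) auto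
    also have "\<dots> = parametrix_op r ?Qw x + ennreal (M * ?c / 2)"
      using M(1) c by (simp add: ennreal_mult[symmetric])
    finally have 1: "parametrix_op r (\<lambda>y. ennreal \<bar>f y\<bar>) x \<le> parametrix_op r ?Qw x + ennreal (M * ?c / 2)" .
    have "ennreal (?c * \<bar>u x\<bar>) \<le> ennreal (M * ?c / 2) + (parametrix_op r ?Qw x + ennreal (M * ?c / 2))"
      using elim by (rule order_trans) (intro add_mono 1 ennreal_leI order_trans[OF B M(2)])
    also have "\<dots> = parametrix_op r ?Qw x + ennreal (M * ?c)"
      using M(1) c by (simp add: ennreal_plus[symmetric] add.left_commute del: ennreal_plus)
    finally have 2: "ennreal (?c * \<bar>u x\<bar>) \<le> parametrix_op r ?Qw x + ennreal (M * ?c)" .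
    show ?case
    \<comment> \<open>Below the level M the excess is 0; above it, the finite summand M * mass
      cancels.\<close>
    proof (cases "\<bar>u x\<bar> \<le> M")
      case False
      then have "?c * \<bar>u x\<bar> = ?c * w x + M * ?c" by (simp add: w_def algebra_simps)
      then have "ennreal (?c * w x) + ennreal (M * ?c) \<le> parametrix_op r ?Qw x + ennreal (M * ?c)"
        using 2 c M(1) w0[of x] by (simp add: ennreal_plus[symmetric] del: ennreal_plus)
      then show ?thesis by (simp add: ennreal_add_left_cancel_le add.commute)
    qed (simp add: w_def)
  qed
  define X where "X = (\<integral>\<^sup>+y. ?Qw y \<partial>lborel)"
  have X: "X < \<infinity>" unfolding X_def w_def using fin[OF M(1)] .
  have "ennreal ?c * X = (\<integral>\<^sup>+x. ennreal (Q x) * ennreal (?c * w x) \<partial>lborel)"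
    unfolding X_def using c w0 Q1
    by (subst nn_integral_cmult[symmetric]) (auto intro!: nn_integral_cong simp: ennreal_mult[symmetric] order_trans[OF zero_le_one] mult.left_commute)
  also have "\<dots> \<le> (\<integral>\<^sup>+x. ennreal (Q x) * parametrix_op r ?Qw x \<partial>lborel)"
  proof (rule nn_integral_mono_AE)
    show "AE x in lborel. ennreal (Q x) * ennreal (?c * w x) \<le> ennreal (Q x) * parametrix_op r ?Qw x"
      using \<open>AE x in lborel. ennreal (?c * w x) \<le> parametrix_op r ?Qw x\<close>
      by eventually_elim (simp add: mult_left_mono)
  qed
  also have "\<dots> = (\<integral>\<^sup>+y. ?Qw y * parametrix_op r (\<lambda>y. ennreal (Q y)) y \<partial>lborel)"
    by (rule parametrix_op_symmetric) measurable
  also have "\<dots> \<le> (\<integral>\<^sup>+y. ?Qw y * ennreal (?c / 2) \<partial>lborel)"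
    by (intro nn_integral_mono mult_left_mono small) auto
  also have "\<dots> = X * ennreal (?c / 2)" unfolding X_def by (rule nn_integral_multc) measurable
  finally have le: "ennreal ?c * X \<le> X * ennreal (?c / 2)" .
  obtain x where x: "X = ennreal x" "x \<ge> 0" using X by (cases X) auto
  have "?c * x \<le> x * (?c / 2)" using le x c by (simp add: ennreal_mult[symmetric])
  then have "x = 0" using x(2) c mult_pos_pos[of "?c" x] by (cases "x > 0") (auto simp: field_simps)
  then have "AE y in lborel. ?Qw y = 0"
    using x(1) nn_integral_0_iff_AE[of ?Qw lborel] unfolding X_def by simp
  then have "AE y in lborel. \<bar>u y\<bar> \<le> M"
  proof eventually_elim
    case (elim y)
    have "Q y * w y \<le> 0" using elim by (simp add: ennreal_eq_0_iff)
    then have "w y \<le> 0" using Q1[of y] by (simp add: mult_le_0_iff)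
    then show ?case by (simp add: w_def)
  qed
  with M(1) show ?thesis by (intro exI[of _ M]) auto
qed

subsection \<open>Continuity and differentiability\<close>

text \<open>The bound does not involve s, so it survives letting the lower scale tend to 0.\<close>

lemma powr_integral_bound:
  fixes g :: "real \<Rightarrow> real"
  assumes st: "0 < s" "s \<le> t" and a: "a > -1" and C: "C \<ge> 0"
    and i: "integrable lborel (\<lambda>\<tau>. indicator {s..t} \<tau> * g \<tau>)"
    and g: "\<And>\<tau>. s \<le> \<tau> \<Longrightarrow> \<tau> \<le> t \<Longrightarrow> \<bar>g \<tau>\<bar> \<le> C * \<tau> powr a"
  shows "\<bar>\<integral>\<tau>. indicator {s..t} \<tau> * g \<tau> \<partial>lborel\<bar> \<le> C * (t powr (a + 1) / (a + 1))"
proof -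
  have "ennreal \<bar>\<integral>\<tau>. indicator {s..t} \<tau> * g \<tau> \<partial>lborel\<bar> \<le> (\<integral>\<^sup>+\<tau>. ennreal \<bar>indicator {s..t} \<tau> * g \<tau>\<bar> \<partial>lborel)"
    using integral_norm_bound_ennreal[OF i] by simp
  also have "\<dots> \<le> (\<integral>\<^sup>+\<tau>. indicator {0<..t} \<tau> * ennreal (C * \<tau> powr a) \<partial>lborel)"
    using st g by (intro nn_integral_mono) (auto simp: indicator_def intro!: ennreal_leI)
  also have "\<dots> \<le> ennreal (C * (t powr (a + 1) / (a + 1)))"
    using st a C by (intro nn_integral_powr) auto
  finally show ?thesis using a C by (subst (asm) ennreal_le_iff) auto
qed

text \<open>Rescaling of the Lipschitz constant at scale 1. Compared with
  \<open>potential_bounded\<close> there is one more factor 1/t, which is why differentiability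
  needs \<beta> < 1 instead of \<beta> < 2.\<close>

lemma potential_lipschitz: "\<exists>C>0. \<forall>t>0. \<forall>z h :: 'a::euclidean_space. \<bar>potential t (z + h) - potential t z\<bar> \<le> C / t ^ (DIM('a) + 1) * norm h"
proof -
  have "(\<lambda>y::'a. potential 1 (0 - y)) \<in> C_k 1" by (intro smooth_gen_C_k potential_smooth)
  moreover have "(\<lambda>y::'a. potential 1 (0 - y)) = potential 1" by (auto simp: potential_def)
  ultimately have C1: "(potential 1 :: 'a \<Rightarrow> real) \<in> C_k 1" by metis
  note g = C_1_has_gradient[OF C1]
  have g0: "grad (potential 1) z = 0" if "1 < norm z" for z :: 'a
    using that by (intro gradient_support[of "potential 1" _ z 1] g) (auto simp: potential_eq_0)
  have "continuous_on UNIV (\<lambda>z::'a. norm (grad (potential 1) z))" by (intro continuous_intros g)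
  then obtain B where B: "\<And>z::'a. \<bar>norm (grad (potential 1) z)\<bar> \<le> B" "0 \<le> B"
    by (rule bounded_of_compact_support[of _ 1]) (auto simp: g0)
  have L: "\<bar>potential 1 a - potential 1 b\<bar> \<le> B * norm (a - b)" for a b :: 'a
  proof -
    have "norm (potential 1 a - potential 1 b) \<le> B * norm (a - b)"
    proof (rule differentiable_bound[where S=UNIV and f'="\<lambda>x h. grad (potential 1) x \<bullet> h"])
      show "(potential 1 has_derivative (\<bullet>) (grad (potential 1) x)) (at x within UNIV)" for x :: 'a using g(1)[of x] .
      show "onorm ((\<bullet>) (grad (potential 1) x)) \<le> B" for x :: 'a
      proof (rule onorm_le)
        fix v
        have "norm (grad (potential 1) x \<bullet> v) \<le> norm (grad (potential 1) x) * norm v" by (simp add: Cauchy_Schwarz_ineq2)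
        also have "\<dots> \<le> B * norm v" using B(1)[of x] by (intro mult_right_mono) auto
        finally show "norm (grad (potential 1) x \<bullet> v) \<le> B * norm v" .
      qed
    qed auto
    then show ?thesis by simp
  qed
  have "\<bar>potential t (z + h) - potential t z\<bar> \<le> (B + 1) / t ^ (DIM('a) + 1) * norm h" if t: "t > 0" for t and z h :: 'a
  proof -
    have sc: "potential t z = potential 1 (z /\<^sub>R t) / t ^ DIM('a)" for z :: 'a
      using t by (simp add: potential_def power_mult_distrib divide_inverse power_inverse mult.commute)
    have "\<bar>potential t (z + h) - potential t z\<bar> = \<bar>potential 1 ((z + h) /\<^sub>R t) - potential 1 (z /\<^sub>R t)\<bar> / t ^ DIM('a)"
      using t by (simp add: sc diff_divide_distrib[symmetric])
    also have "\<dots> \<le> (B * norm ((z + h) /\<^sub>R t - z /\<^sub>R t)) / t ^ DIM('a)"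
      using t by (intro divide_right_mono L) auto
    also have "(z + h) /\<^sub>R t - z /\<^sub>R t = h /\<^sub>R t" by (simp add: scaleR_add_right)
    also have "(B * norm (h /\<^sub>R t)) / t ^ DIM('a) = B / t ^ (DIM('a) + 1) * norm h"
      using t by (simp add: field_simps)
    also have "\<dots> \<le> (B + 1) / t ^ (DIM('a) + 1) * norm h"
      using t by (intro mult_right_mono divide_right_mono) auto
    finally show ?thesis .
  qed
  with B(2) show ?thesis by (intro exI[of _ "B + 1"]) auto
qed

text \<open>Converts estimates of increments, available only for |h| below the smaller scale, into
  estimates of derivatives.\<close>

lemma derivative_le_lipschitz:
  fixes F :: "'a::real_normed_vector \<Rightarrow> real"
  assumes D: "(F has_derivative D) (at x)" and d: "d > 0"
    and lip: "\<And>h. norm h < d \<Longrightarrow> \<bar>F (x + h) - F x\<bar> \<le> L * norm h"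
  shows "\<bar>D h\<bar> \<le> L * norm h"
proof (cases "h = 0")
  case True
  then show ?thesis using has_derivative_bounded_linear[OF D] by (simp add: bounded_linear.axioms(1) linear_0)
next
  case h: False
  interpret D: bounded_linear D using D by (rule has_derivative_bounded_linear)
  show ?thesis
  proof (rule field_le_epsilon)
    fix e :: real assume e: "e > 0"
    then have "e / norm h > 0" using h by simp
    then obtain d' where d': "d' > 0" "\<And>y. norm (y - x) < d' \<Longrightarrow> norm (F y - F x - D (y - x)) \<le> e / norm h * norm (y - x)"
      using D unfolding has_derivative_at_alt by blast
    \<comment> \<open>Shrinks h into the range of both estimates; the factor 1/2 makes the
      inequalities strict.\<close>
    define r where "r = min d d' / (2 * norm h)"
    have r: "r > 0" "r * norm h < d" "r * norm h < d'"
      using d d'(1) h by (auto simp: r_def min_def)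
    have "norm (F (x + r *\<^sub>R h) - F x - D (r *\<^sub>R h)) \<le> e / norm h * norm (r *\<^sub>R h)"
      using d'(2)[of "x + r *\<^sub>R h"] r by simp
    moreover have "\<bar>F (x + r *\<^sub>R h) - F x\<bar> \<le> L * norm (r *\<^sub>R h)" using lip[of "r *\<^sub>R h"] r by simp
    ultimately have "\<bar>D (r *\<^sub>R h)\<bar> \<le> L * norm (r *\<^sub>R h) + e / norm h * norm (r *\<^sub>R h)" by simp
    also have "\<dots> = r * (L * norm h + e)" using r h by (simp add: algebra_simps)
    also have "\<bar>D (r *\<^sub>R h)\<bar> = r * \<bar>D h\<bar>" using r by (simp add: D.scaleR abs_mult)
    finally show "\<bar>D h\<bar> \<le> L * norm h + e" using r(1) by simp
  qed
qed

lemma tendsto_mult_powr_0: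
  fixes s :: "nat \<Rightarrow> real"
  assumes "s \<longlonglongrightarrow> 0" "\<And>n. 0 < s n" "\<gamma> > 0"
  shows "(\<lambda>n. K * s n powr \<gamma>) \<longlonglongrightarrow> 0"
proof -
  have "(\<lambda>n. s n powr \<gamma>) \<longlonglongrightarrow> 0 powr \<gamma>"
    using assms by (intro tendsto_powr2 tendsto_const) (auto intro!: always_eventually less_imp_le)
  then show ?thesis using tendsto_mult[OF tendsto_const[of K]] by force
qed

text \<open>The modulus depends on the larger scale only, so letting the smaller one tend to 0 gives
  an explicit rate. The rate yields uniform convergence and, at one fixed scale, boundedness of the
  limit.\<close>

lemma uniform_Cauchy_limit:
  fixes F :: "real \<Rightarrow> 'a::euclidean_space \<Rightarrow> real"
  assumes a: "0 < a" and gam: "\<gamma> > 0" and C: "C \<ge> 0"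
    and cont: "\<And>s. 0 < s \<Longrightarrow> s \<le> a \<Longrightarrow> continuous_on UNIV (F s)"
    and bound: "\<And>s t x. 0 < s \<Longrightarrow> s \<le> t \<Longrightarrow> t \<le> a \<Longrightarrow> \<bar>F s x - F t x\<bar> \<le> C * t powr \<gamma>"
  obtains l where "continuous_on UNIV l" "\<And>s x. 0 < s \<Longrightarrow> s \<le> a \<Longrightarrow> \<bar>F s x - l x\<bar> \<le> C * s powr \<gamma>"
proof -
  define s where "s n = a / real (Suc n)" for n
  have s: "0 < s n" "s n \<le> a" for n using a by (auto simp: s_def field_simps)
  have sm: "s n \<le> s m" if "m \<le> n" for m n using a that by (auto simp: s_def intro!: divide_left_mono)
  have s0: "s \<longlonglongrightarrow> 0"
    unfolding s_def using tendsto_mult[OF tendsto_const[of a] LIMSEQ_inverse_real_of_nat]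
    by (simp add: divide_inverse)
  have p0: "(\<lambda>n. C * s n powr \<gamma>) \<longlonglongrightarrow> 0"
    using s0 s(1) gam by (rule tendsto_mult_powr_0)
  have "Cauchy (\<lambda>n. F (s n) x)" for x
  proof (rule CauchyI)
    fix e :: real assume e: "e > 0"
    then obtain N where N: "\<And>n. n \<ge> N \<Longrightarrow> C * s n powr \<gamma> < e"
      using order_tendstoD(2)[OF p0 e] unfolding eventually_sequentially by blast
    have "\<bar>F (s m) x - F (s n) x\<bar> < e" if "N \<le> n" "n \<le> m" for m n
      using bound[OF s(1) sm[OF that(2)] s(2), of x] N[OF that(1)] by simp
    then have "norm (F (s m) x - F (s n) x) < e" if "N \<le> n" "N \<le> m" for m n
      using that by (metis abs_minus_commute linear real_norm_def)
    then show "\<exists>M. \<forall>m\<ge>M. \<forall>n\<ge>M. norm (F (s m) x - F (s n) x) < e" by blast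
  qed
  then have "\<exists>l. (\<lambda>n. F (s n) x) \<longlonglongrightarrow> l" for x using Cauchy_convergent convergent_def by blast
  then obtain l where l: "\<And>x. (\<lambda>n. F (s n) x) \<longlonglongrightarrow> l x" by metis
  have b: "\<bar>F t x - l x\<bar> \<le> C * t powr \<gamma>" if t: "0 < t" "t \<le> a" for t x
  proof -
    have "eventually (\<lambda>n. s n < t) sequentially" using s0 t(1) by (rule order_tendstoD)
    then have "eventually (\<lambda>n. \<bar>F t x - F (s n) x\<bar> \<le> C * t powr \<gamma>) sequentially"
      by eventually_elim (use bound[OF s(1) _ t(2)] in \<open>simp add: abs_minus_commute\<close>)
    moreover have "(\<lambda>n. \<bar>F t x - F (s n) x\<bar>) \<longlonglongrightarrow> \<bar>F t x - l x\<bar>" by (intro tendsto_intros l)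
    ultimately show ?thesis by (intro tendsto_upperbound[of _ "\<bar>F t x - l x\<bar>" sequentially]) auto
  qed
  have "uniform_limit UNIV (\<lambda>n. F (s n)) l sequentially"
  proof (rule uniform_limitI)
    fix e :: real assume e: "e > 0"
    show "\<forall>\<^sub>F n in sequentially. \<forall>x\<in>UNIV. dist (F (s n) x) (l x) < e"
      using order_tendstoD(2)[OF p0 e]
      by eventually_elim (use b[OF s] in \<open>auto simp: dist_real_def intro: le_less_trans\<close>)
  qed
  then have "continuous_on UNIV l"
    by (intro uniform_limit_theorem[of _ _ sequentially]) (use cont s in auto)
  with b that show ?thesis by blast
qed

section \<open>Poisson's equation with a right-hand side of Morrey type\<close>

context
  fixes u f :: "'a::euclidean_space \<Rightarrow> real" and D L \<beta> :: real
  assumes u: "loc_integrable u" and f: "loc_integrable f"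
    and weak: "mollified_poisson u f"
    and fmass: "\<And>x r. 0 < r \<Longrightarrow> r \<le> 1 \<Longrightarrow> ball_mass f x r \<le> D * r powr (real DIM('a) - \<beta>)"
    and umass: "\<And>x. ball_mass u x 1 \<le> L"
    and D: "D \<ge> 0"
begin

lemma convolve_potential_integrable: "t > 0 \<Longrightarrow> integrable lborel (\<lambda>y. potential t (x - y) * f y)"
proof -
  assume t: "t > 0"
  obtain B where B: "B > 0" "\<And>t z::'a. t > 0 \<Longrightarrow> potential t z \<le> B / t ^ DIM('a)" using potential_bounded by blast
  show ?thesis using t B(2)[OF t] f
    by (intro convolve_integrable_bound(1)[where r=t and B="B / t ^ DIM('a)"])
      (auto simp: potential_eq_0 potential_nonneg intro!: borel_measurable_continuous_onI potential_continuous)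
qed

text \<open>Scale by scale, kernel size times ball mass times tau gives tau^(1 - \<beta>), whose
  integral from 0 to t is of order t^(2 - \<beta>).\<close>

lemma convolve_mollifier_Cauchy:
  assumes beta: "\<beta> < 2"
  obtains C where "C \<ge> 0" "\<And>s t x. 0 < s \<Longrightarrow> s \<le> t \<Longrightarrow> t \<le> 1 \<Longrightarrow> \<bar>convolve (mollifier s) u x - convolve (mollifier t) u x\<bar> \<le> C * t powr (2 - \<beta>)"
proof -
  obtain B where B: "B > 0" "\<And>t z::'a. t > 0 \<Longrightarrow> potential t z \<le> B / t ^ DIM('a)" using potential_bounded by blast
  have "\<bar>convolve (mollifier s) u x - convolve (mollifier t) u x\<bar> \<le> (B * D / (2 - \<beta>)) * t powr (2 - \<beta>)"
    if st: "0 < s" "s \<le> t" "t \<le> 1" for s t x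
  proof -
    have "\<bar>\<tau> * convolve (potential \<tau>) f x\<bar> \<le> B * D * \<tau> powr (1 - \<beta>)" if t: "s \<le> \<tau>" "\<tau> \<le> t" for \<tau>
    proof -
      have t0: "\<tau> > 0" "\<tau> \<le> 1" using t st by auto
      have "\<bar>convolve (potential \<tau>) f x\<bar> \<le> B / \<tau> ^ DIM('a) * ball_mass f x \<tau>"
        using B(2)[OF t0(1)] t0 f
        by (intro convolve_integrable_bound(2))
          (auto simp: potential_eq_0 potential_nonneg intro!: borel_measurable_continuous_onI potential_continuous)
      also have "\<dots> \<le> B / \<tau> ^ DIM('a) * (D * \<tau> powr (real DIM('a) - \<beta>))"
        using t0 B(1) by (intro mult_left_mono fmass) auto
      finally have "\<tau> * \<bar>convolve (potential \<tau>) f x\<bar> \<le> \<tau> * (B / \<tau> ^ DIM('a) * (D * \<tau> powr (real DIM('a) - \<beta>)))"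
        using t0 by (intro mult_left_mono) auto
      also have "\<dots> = B * D * \<tau> powr (1 - \<beta>)" using t0 by (simp add: powr_diff powr_realpow)
      finally show ?thesis using t0 by (simp add: abs_mult)
    qed
    then have "\<bar>\<integral>\<tau>. indicator {s..t} \<tau> * (\<tau> * convolve (potential \<tau>) f x) \<partial>lborel\<bar> \<le> B * D * (t powr (1 - \<beta> + 1) / (1 - \<beta> + 1))"
      using st beta B(1) D by (intro powr_integral_bound convolve_mollifier_diff(1)[OF u weak]) auto
    then show ?thesis using convolve_mollifier_diff(2)[OF u weak st(1,2), of x] by (simp add: algebra_simps)
  qed
  moreover have "B * D / (2 - \<beta>) \<ge> 0" using B D beta by auto
  ultimately show ?thesis using that by blast
qed

text \<open>Increments of the potentials replace their gradients, so no differentiation under the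
  scale integral occurs. The condition |h| <= s keeps both translates in a ball of radius 2 tau, and
  t <= 1/2 keeps that radius within the range of \<open>fmass\<close>.\<close>

lemma convolve_mollifier_lipschitz:
  assumes beta: "\<beta> < 1"
  obtains C where "C \<ge> 0" "\<And>s t x h. 0 < s \<Longrightarrow> s \<le> t \<Longrightarrow> t \<le> 1 / 2 \<Longrightarrow> norm h \<le> s \<Longrightarrow>
    \<bar>(convolve (mollifier s) u (x + h) - convolve (mollifier t) u (x + h)) - (convolve (mollifier s) u x - convolve (mollifier t) u x)\<bar> \<le> C * t powr (1 - \<beta>) * norm h"
proof -
  obtain B where B: "B > 0" "\<And>t (z::'a) h. t > 0 \<Longrightarrow> \<bar>potential t (z + h) - potential t z\<bar> \<le> B / t ^ (DIM('a) + 1) * norm h"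
    using potential_lipschitz[where 'a='a] by blast
  \<comment> \<open>The power of 2 comes from measuring the mass on the ball of doubled
    radius.\<close>
  define E where "E = B * D * 2 powr (real DIM('a) - \<beta>)"
  have E: "E \<ge> 0" using B D by (simp add: E_def)
  have "\<bar>(convolve (mollifier s) u (x + h) - convolve (mollifier t) u (x + h)) - (convolve (mollifier s) u x - convolve (mollifier t) u x)\<bar> \<le> (E / (1 - \<beta>)) * t powr (1 - \<beta>) * norm h"
    if st: "0 < s" "s \<le> t" "t \<le> 1 / 2" and h: "norm h \<le> s" for s t x h
  proof -
    let ?G = "\<lambda>\<tau>. \<tau> * convolve (potential \<tau>) f (x + h) - \<tau> * convolve (potential \<tau>) f x"
    have G: "\<bar>?G \<tau>\<bar> \<le> (E * norm h) * \<tau> powr (- \<beta>)" if t: "s \<le> \<tau>" "\<tau> \<le> t" for \<tau>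
    proof -
      have t0: "\<tau> > 0" "2 * \<tau> \<le> 1" using t st by auto
      have "convolve (potential \<tau>) f (x + h) - convolve (potential \<tau>) f x = convolve (\<lambda>z. potential \<tau> (z + h) - potential \<tau> z) f x"
        unfolding convolve_def using convolve_potential_integrable[OF t0(1), of "x + h"] convolve_potential_integrable[OF t0(1), of x]
        by (simp add: left_diff_distrib algebra_simps)
      also have "\<bar>\<dots>\<bar> \<le> (B / \<tau> ^ (DIM('a) + 1) * norm h) * ball_mass f x (2 * \<tau>)"
      proof (rule convolve_integrable_bound(2)[OF _ B(2)[OF t0(1)] _ f])
        show "(\<lambda>z. potential \<tau> (z + h) - potential \<tau> z) \<in> borel_measurable borel" by measurable
        show "potential \<tau> (z + h) - potential \<tau> z = 0" if "2 * \<tau> < norm z" for z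
          using that t0 t h norm_diff_ineq[of z h] by (simp add: potential_eq_0)
      qed
      also have "\<dots> \<le> (B / \<tau> ^ (DIM('a) + 1) * norm h) * (D * (2 * \<tau>) powr (real DIM('a) - \<beta>))"
        using t0 B(1) by (intro mult_left_mono fmass) auto
      finally have "\<tau> * \<bar>convolve (potential \<tau>) f (x + h) - convolve (potential \<tau>) f x\<bar> \<le> \<tau> * ((B / \<tau> ^ (DIM('a) + 1) * norm h) * (D * (2 * \<tau>) powr (real DIM('a) - \<beta>)))"
        using t0 by (intro mult_left_mono) auto
      also have "(2 * \<tau>) powr (real DIM('a) - \<beta>) = 2 powr (real DIM('a) - \<beta>) * (\<tau> ^ DIM('a) * \<tau> powr (- \<beta>))"
        using t0 by (simp add: powr_mult powr_diff powr_realpow powr_minus divide_inverse)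
      also have "\<tau> * ((B / \<tau> ^ (DIM('a) + 1) * norm h) * (D * (2 powr (real DIM('a) - \<beta>) * (\<tau> ^ DIM('a) * \<tau> powr (- \<beta>)))))
          = (E * norm h) * \<tau> powr (- \<beta>)"
        using t0 by (simp add: E_def)
      finally show ?thesis using t0 by (simp add: abs_mult flip: right_diff_distrib)
    qed
    note i = convolve_mollifier_diff(1)[OF u weak st(1,2)]
    have iG: "integrable lborel (\<lambda>\<tau>. indicator {s..t} \<tau> * ?G \<tau>)"
      using Bochner_Integration.integrable_diff[OF i[of "x + h"] i[of x]] by (simp add: right_diff_distrib)
    have "(\<integral>\<tau>. indicator {s..t} \<tau> * ?G \<tau> \<partial>lborel) =
      (convolve (mollifier s) u (x + h) - convolve (mollifier t) u (x + h)) - (convolve (mollifier s) u x - convolve (mollifier t) u x)"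
      using convolve_mollifier_diff(2)[OF u weak st(1,2), of "x + h"] convolve_mollifier_diff(2)[OF u weak st(1,2), of x]
        Bochner_Integration.integral_diff[OF i[of "x + h"] i[of x]] by (simp add: right_diff_distrib)
    moreover have "\<bar>\<integral>\<tau>. indicator {s..t} \<tau> * ?G \<tau> \<partial>lborel\<bar> \<le> (E * norm h) * (t powr (- \<beta> + 1) / (- \<beta> + 1))"
      using st beta E by (intro powr_integral_bound iG G) auto
    ultimately show ?thesis by (simp add: mult_ac)
  qed
  moreover have "E / (1 - \<beta>) \<ge> 0" using E beta by auto
  ultimately show ?thesis using that by blast
qed

text \<open>The uniform limit must agree with the almost everywhere limit along the scales of
  \<open>mollify_AE\<close>; dividing by the mass undoes the missing normalisation.\<close>

lemma AE_limit_eq: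
  assumes gam: "\<gamma> > 0" and l: "\<And>s x. 0 < s \<Longrightarrow> s \<le> a \<Longrightarrow> \<bar>convolve (mollifier s) u x - l x\<bar> \<le> C * s powr \<gamma>" and a: "a > 0"
  shows "AE x in lborel. l x / mollifier_mass TYPE('a) = u x"
proof -
  have "AE x in lborel. norm x \<le> real m \<longrightarrow> l x / mollifier_mass TYPE('a) = u x" for m :: nat
  proof (rule mollify_AE[OF u, of "real m"])
    fix s :: "nat \<Rightarrow> real"
    assume s: "\<And>n. 0 < s n" "s \<longlonglongrightarrow> 0"
      and ae: "AE x in lborel. norm x \<le> real m \<longrightarrow> (\<lambda>n. convolve (mollifier (s n)) u x) \<longlonglongrightarrow> mollifier_mass TYPE('a) * u x"
    have p0: "(\<lambda>n. C * s n powr \<gamma>) \<longlonglongrightarrow> 0"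
      using s(2,1) gam by (rule tendsto_mult_powr_0)
    have "(\<lambda>n. convolve (mollifier (s n)) u x) \<longlonglongrightarrow> l x" for x
    proof -
      have "eventually (\<lambda>n. s n < a) sequentially" using s(2) a by (rule order_tendstoD)
      then have "eventually (\<lambda>n. norm (convolve (mollifier (s n)) u x - l x) \<le> C * s n powr \<gamma>) sequentially"
        by eventually_elim (use l[OF s(1)] in auto)
      then have "(\<lambda>n. convolve (mollifier (s n)) u x - l x) \<longlonglongrightarrow> 0"
        using p0 by (rule Lim_null_comparison)
      then show ?thesis by (simp add: LIM_zero_iff)
    qed
    with ae show ?thesis
    proof eventually_elim
      case (elim x)
      then have "(\<lambda>n. convolve (mollifier (s n)) u x) \<longlonglongrightarrow> mollifier_mass TYPE('a) * u x" by simp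
      then have "l x = mollifier_mass TYPE('a) * u x" using \<open>(\<lambda>n. convolve (mollifier (s n)) u x) \<longlonglongrightarrow> l x\<close> LIMSEQ_unique by blast
      then show ?case using mollifier_mass_pos[where 'a='a] by simp
    qed
  qed
  then have "AE x in lborel. \<forall>m::nat. norm x \<le> real m \<longrightarrow> l x / mollifier_mass TYPE('a) = u x"
    unfolding AE_all_countable by blast
  then show ?thesis by eventually_elim (use real_arch_simple in blast)
qed

lemma convolve_compact_bounded:
  assumes k: "continuous_on UNIV k" and r: "\<And>z. 1 < norm z \<Longrightarrow> k z = 0"
  obtains B where "\<And>x. \<bar>convolve k u x\<bar> \<le> B"
proof -
  obtain B where B: "\<And>z. \<bar>k z\<bar> \<le> B" "0 \<le> B" using bounded_of_compact_support[OF k r] by blast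
  have "\<bar>convolve k u x\<bar> \<le> B * L" for x
  proof -
    have "\<bar>convolve k u x\<bar> \<le> B * ball_mass u x 1"
      by (intro convolve_integrable_bound(2) borel_measurable_continuous_onI k B r u)
    also have "\<dots> \<le> B * L" by (intro mult_left_mono umass B)
    finally show ?thesis .
  qed
  then show ?thesis using that by blast
qed

lemma representative_C_B_0:
  assumes beta: "\<beta> < 2"
  shows "\<exists>v\<in>C_B 0. AE x in lborel. v x = u x"
proof -
  obtain C where C: "C \<ge> 0" "\<And>s t x. 0 < s \<Longrightarrow> s \<le> t \<Longrightarrow> t \<le> 1 \<Longrightarrow> \<bar>convolve (mollifier s) u x - convolve (mollifier t) u x\<bar> \<le> C * t powr (2 - \<beta>)"
    using convolve_mollifier_Cauchy[OF beta] by blast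
  have cont: "continuous_on UNIV (convolve (mollifier s) u)" if "0 < s" for s
    using that by (intro convolve_continuous[where r=s] mollifier_continuous u) (auto simp: mollifier_eq_0)
  obtain l where l: "continuous_on UNIV l" "\<And>s x. 0 < s \<Longrightarrow> s \<le> 1 \<Longrightarrow> \<bar>convolve (mollifier s) u x - l x\<bar> \<le> C * s powr (2 - \<beta>)"
  proof (rule uniform_Cauchy_limit[of 1 "2 - \<beta>" C "\<lambda>s. convolve (mollifier s) u"])
  qed (use C beta cont in auto)
  obtain B where B: "\<And>x. \<bar>convolve (mollifier 1) u x\<bar> \<le> B"
  proof (rule convolve_compact_bounded[of "mollifier 1"])
  qed (auto simp: mollifier_eq_0 intro: mollifier_continuous)
  \<comment> \<open>The rate at scale 1 compares l with one fixed mollification, which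
    \<open>umass\<close> bounds.\<close>
  have "\<bar>l x / mollifier_mass TYPE('a)\<bar> \<le> (B + C) / mollifier_mass TYPE('a)" for x
    using l(2)[of 1 x] B[of x] mollifier_mass_pos[where 'a='a] by (simp add: divide_right_mono)
  then have "bounded (range (\<lambda>x. l x / mollifier_mass TYPE('a)))" unfolding bounded_iff by auto
  moreover have "continuous_on UNIV (\<lambda>x. l x / mollifier_mass TYPE('a))"
    using mollifier_mass_pos[where 'a='a] by (intro continuous_intros l) auto
  ultimately have "(\<lambda>x. l x / mollifier_mass TYPE('a)) \<in> C_B 0"
    by (simp add: C_B_def C_k_def partial_derivs_def)
  moreover have "AE x in lborel. l x / mollifier_mass TYPE('a) = u x"
    using beta by (intro AE_limit_eq[of "2 - \<beta>" 1 l C] l(2)) auto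
  ultimately show ?thesis by (intro bexI[of _ "\<lambda>x. l x / mollifier_mass TYPE('a)"])
qed

text \<open>The gradients of the mollifications converge uniformly too, so the limit may be
  differentiated term by term; comparison with the gradient at scale 1/2 bounds its
  derivatives.\<close>

lemma representative_C_B_1:
  assumes beta: "\<beta> < 1"
  shows "\<exists>v\<in>C_B 1. AE x in lborel. v x = u x"
proof -
  let ?c = "mollifier_mass TYPE('a)"
  have c: "?c > 0" by (rule mollifier_mass_pos)
  obtain C where C: "C \<ge> 0" "\<And>s t x. 0 < s \<Longrightarrow> s \<le> t \<Longrightarrow> t \<le> 1 \<Longrightarrow> \<bar>convolve (mollifier s) u x - convolve (mollifier t) u x\<bar> \<le> C * t powr (2 - \<beta>)"
  proof (rule convolve_mollifier_Cauchy)
  qed (use beta in auto)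
  obtain C' where C': "C' \<ge> 0" "\<And>s t x h. 0 < s \<Longrightarrow> s \<le> t \<Longrightarrow> t \<le> 1 / 2 \<Longrightarrow> norm h \<le> s \<Longrightarrow>
    \<bar>(convolve (mollifier s) u (x + h) - convolve (mollifier t) u (x + h)) - (convolve (mollifier s) u x - convolve (mollifier t) u x)\<bar> \<le> C' * t powr (1 - \<beta>) * norm h"
    using convolve_mollifier_lipschitz[OF beta] by blast
  have cont: "continuous_on UNIV (convolve (mollifier s) u)" if "0 < s" for s
    using that by (intro convolve_continuous[where r=s] mollifier_continuous u) (auto simp: mollifier_eq_0)
  obtain l where l: "continuous_on UNIV l" "\<And>s x. 0 < s \<Longrightarrow> s \<le> 1 \<Longrightarrow> \<bar>convolve (mollifier s) u x - l x\<bar> \<le> C * s powr (2 - \<beta>)"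
  proof (rule uniform_Cauchy_limit[of 1 "2 - \<beta>" C "\<lambda>s. convolve (mollifier s) u"])
  qed (use C beta cont in auto)
  have g: "((mollifier s :: 'a \<Rightarrow> real) has_derivative (\<lambda>h. grad (mollifier s) z \<bullet> h)) (at z)" "continuous_on UNIV (grad (mollifier s :: 'a \<Rightarrow> real))" for s z
    using C_1_has_gradient[OF smooth_gen_C_k[OF mollifier_smooth]] by auto
  have g0: "grad (mollifier s) z = 0" if "0 < s" "s < norm z" for s and z :: 'a
    using that by (intro gradient_support[of "mollifier s" _ z s] g) (auto simp: mollifier_eq_0)
  define G where "G s b x = convolve (\<lambda>z. grad (mollifier s) z \<bullet> b) u x" for s b x
  have dG: "(convolve (mollifier s) u has_derivative (\<lambda>h. \<Sum>b\<in>Basis. G s b x * (h \<bullet> b))) (at x)" if "0 < s" for s x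
    unfolding G_def using that by (intro convolve_has_derivative[where r=s] g u) (auto simp: mollifier_eq_0)
  have contG: "continuous_on UNIV (G s b)" if "0 < s" for s b
    unfolding G_def[abs_def] using that
    by (intro convolve_continuous[where r=s] u continuous_intros g) (auto simp: g0)
  \<comment> \<open>The Lipschitz bound for the difference of two mollifications holds for |h| <= s,
    which is enough to bound its derivative in the direction b.\<close>
  have Gbound: "\<bar>G s b x - G t b x\<bar> \<le> C' * t powr (1 - \<beta>)" if st: "0 < s" "s \<le> t" "t \<le> 1 / 2" and b: "b \<in> Basis" for s t b x
  proof -
    let ?F = "\<lambda>x. convolve (mollifier s) u x - convolve (mollifier t) u x"
    let ?D = "\<lambda>h. (\<Sum>b\<in>Basis. G s b x * (h \<bullet> b)) - (\<Sum>b\<in>Basis. G t b x * (h \<bullet> b))"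
    have "(?F has_derivative ?D) (at x)" using st by (intro has_derivative_diff dG) auto
    then have "\<bar>?D b\<bar> \<le> (C' * t powr (1 - \<beta>)) * norm b"
      by (rule derivative_le_lipschitz[OF _ st(1)]) (use C'(2)[OF st] in auto)
    then show ?thesis using b by (simp add: inner_Basis if_distrib cong: if_cong)
  qed
  have "\<exists>m. continuous_on UNIV m \<and> (\<forall>s x. 0 < s \<longrightarrow> s \<le> 1 / 2 \<longrightarrow> \<bar>G s b x - m x\<bar> \<le> C' * s powr (1 - \<beta>))" if b: "b \<in> Basis" for b
  proof (rule uniform_Cauchy_limit[of "1 / 2" "1 - \<beta>" C' "\<lambda>s. G s b"])
  qed (use C' beta contG Gbound b in auto)
  then obtain m where m: "\<And>b. b \<in> Basis \<Longrightarrow> continuous_on UNIV (m b)"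
    "\<And>b s x. b \<in> Basis \<Longrightarrow> 0 < s \<Longrightarrow> s \<le> 1 / 2 \<Longrightarrow> \<bar>G s b x - m b x\<bar> \<le> C' * s powr (1 - \<beta>)"
    by metis
  \<comment> \<open>Starts at 1/2, the largest scale at which the rate for the gradients is
    available.\<close>
  define s where "s n = 1 / real (Suc (Suc n))" for n
  have s: "0 < s n" "s n \<le> 1 / 2" for n by (auto simp: s_def field_simps)
  have s0: "s \<longlonglongrightarrow> 0"
    unfolding s_def using LIMSEQ_Suc[OF LIMSEQ_inverse_real_of_nat] by (simp add: inverse_eq_divide)
  note pz = tendsto_mult_powr_0[OF s0 s(1)]
  have liml: "(\<lambda>n. convolve (mollifier (s n)) u x) \<longlonglongrightarrow> l x" for x
  proof -
    have "(\<lambda>n. convolve (mollifier (s n)) u x - l x) \<longlonglongrightarrow> 0"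
    proof (rule Lim_null_comparison)
      show "\<forall>\<^sub>F n in sequentially. norm (convolve (mollifier (s n)) u x - l x) \<le> C * s n powr (2 - \<beta>)"
      proof (intro always_eventually allI)
        fix n
        have "s n \<le> 1" using s(2)[of n] by linarith
        then show "norm (convolve (mollifier (s n)) u x - l x) \<le> C * s n powr (2 - \<beta>)" using l(2)[OF s(1)] by simp
      qed
      show "(\<lambda>n. C * s n powr (2 - \<beta>)) \<longlonglongrightarrow> 0" using beta by (intro pz) simp
    qed
    then show ?thesis by (simp add: LIM_zero_iff)
  qed
  \<comment> \<open>Uniform convergence of derivatives and convergence at one point yield some
    differentiable limit, which is identified with l afterwards.\<close>
  have "\<exists>g. \<forall>x\<in>UNIV. (\<lambda>n. convolve (mollifier (s n)) u x) \<longlonglongrightarrow> g x \<and> (g has_derivative (\<lambda>h. \<Sum>b\<in>Basis. m b x * (h \<bullet> b))) (at x within UNIV)"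
  proof (rule has_derivative_sequence)
    show "(convolve (mollifier (s n)) u has_derivative (\<lambda>h. \<Sum>b\<in>Basis. G (s n) b x * (h \<bullet> b))) (at x within UNIV)" for n x
      using dG[OF s(1)] by simp
    fix e :: real assume e: "e > 0"
    have "(\<lambda>n. (real DIM('a) * C') * s n powr (1 - \<beta>)) \<longlonglongrightarrow> 0" using beta by (intro pz) simp
    from order_tendstoD(2)[OF this e]
    show "\<forall>\<^sub>F n in sequentially. \<forall>x\<in>UNIV. \<forall>h. norm ((\<Sum>b\<in>Basis. G (s n) b x * (h \<bullet> b)) - (\<Sum>b\<in>Basis. m b x * (h \<bullet> b))) \<le> e * norm h"
    proof eventually_elim
      case (elim n)
      show ?case
      proof (intro ballI allI)
        fix x h :: 'a
        have "norm ((\<Sum>b\<in>Basis. G (s n) b x * (h \<bullet> b)) - (\<Sum>b\<in>Basis. m b x * (h \<bullet> b)))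
          = norm (\<Sum>b\<in>Basis. (G (s n) b x - m b x) * (h \<bullet> b))"
          by (simp add: sum_subtractf left_diff_distrib)
        also have "\<dots> \<le> (\<Sum>b\<in>(Basis::'a set). C' * s n powr (1 - \<beta>) * norm h)"
        proof (rule sum_norm_le)
          fix b :: 'a assume b: "b \<in> Basis"
          show "norm ((G (s n) b x - m b x) * (h \<bullet> b)) \<le> C' * s n powr (1 - \<beta>) * norm h"
            unfolding real_norm_def abs_mult using m(2)[OF b s] C'(1) Basis_le_norm[OF b, of h]
            by (intro mult_mono) auto
        qed
        also have "\<dots> = (real DIM('a) * C') * s n powr (1 - \<beta>) * norm h" by simp
        also have "\<dots> \<le> e * norm h" using elim by (intro mult_right_mono) auto
        finally show "norm ((\<Sum>b\<in>Basis. G (s n) b x * (h \<bullet> b)) - (\<Sum>b\<in>Basis. m b x * (h \<bullet> b))) \<le> e * norm h" .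
      qed
    qed
  next
    show "(\<lambda>n. convolve (mollifier (s n)) u 0) \<longlonglongrightarrow> l 0" by (rule liml)
  qed auto
  then obtain g where "\<And>x. (\<lambda>n. convolve (mollifier (s n)) u x) \<longlonglongrightarrow> g x" "\<And>x. (g has_derivative (\<lambda>h. \<Sum>b\<in>Basis. m b x * (h \<bullet> b))) (at x)"
    by auto
  moreover from this(1) have "g = l" using liml LIMSEQ_unique by blast
  ultimately have dl: "(l has_derivative (\<lambda>h. \<Sum>b\<in>Basis. m b x * (h \<bullet> b))) (at x)" for x by simp
  let ?v = "\<lambda>x. l x / ?c"
  have dv: "(?v has_derivative (\<lambda>h. (\<Sum>b\<in>Basis. m b x * (h \<bullet> b)) / ?c)) (at x)" for x
    using has_derivative_mult_right[OF dl, of "1 / ?c" x] by simp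
  have pd: "partial_deriv b ?v = (\<lambda>x. m b x / ?c)" if "b \<in> Basis" for b
    using partial_deriv_eq[OF dv] that by (auto simp: inner_Basis if_distrib cong: if_cong)
  obtain B where B: "\<And>x. \<bar>convolve (mollifier 1) u x\<bar> \<le> B"
  proof (rule convolve_compact_bounded[of "mollifier 1"])
  qed (auto simp: mollifier_eq_0 intro: mollifier_continuous)
  have "\<bar>l x / ?c\<bar> \<le> (B + C) / ?c" for x
    using l(2)[of 1 x] B[of x] c by (simp add: divide_right_mono)
  then have bv: "bounded (range ?v)" unfolding bounded_iff by auto
  have bm: "bounded (range (\<lambda>x. m b x / ?c))" if b: "b \<in> Basis" for b
  proof -
    obtain B where B: "\<And>x. \<bar>G (1 / 2) b x\<bar> \<le> B"
    proof (rule convolve_compact_bounded[of "\<lambda>z. grad (mollifier (1 / 2)) z \<bullet> b"])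
      show "continuous_on UNIV (\<lambda>z. grad (mollifier (1 / 2)) z \<bullet> b)" by (intro continuous_intros g)
    qed (auto simp: g0 G_def)
    have "\<bar>m b x / ?c\<bar> \<le> (B + C' * (1 / 2) powr (1 - \<beta>)) / ?c" for x
      using m(2)[OF b, of "1 / 2" x] B[of x] c by (simp add: divide_right_mono)
    then show ?thesis unfolding bounded_iff by auto
  qed
  have diff: "?v differentiable_on UNIV"
    using dv by (auto simp: differentiable_on_def differentiable_def)
  have cm: "continuous_on UNIV (\<lambda>x. m b x / ?c)" if "b \<in> Basis" for b
    using c m(1)[OF that] by (intro continuous_intros) auto
  have lists: "bs = [] \<or> (\<exists>b\<in>Basis. bs = [b])" if "set bs \<subseteq> Basis" "length bs \<le> 1" for bs :: "'a list"
    using that by (cases bs) auto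
  have "?v \<in> C_B 1"
    unfolding C_B_def C_k_def mem_Collect_eq
  proof (intro conjI allI impI)
    fix bs :: "'a list" assume "set bs \<subseteq> Basis \<and> length bs < 1"
    then show "partial_derivs bs ?v differentiable_on UNIV" using diff by (simp add: partial_derivs_def)
  next
    fix bs :: "'a list" assume "set bs \<subseteq> Basis \<and> length bs \<le> 1"
    then show "continuous_on UNIV (partial_derivs bs ?v)"
      using lists[of bs] differentiable_imp_continuous_on[OF diff] cm pd by (auto simp: partial_derivs_def)
  next
    fix bs :: "'a list" assume "set bs \<subseteq> Basis \<and> length bs \<le> 1"
    then show "bounded (range (partial_derivs bs ?v))"
      using lists[of bs] bv bm pd by (auto simp: partial_derivs_def)
  qed
  moreover have "AE x in lborel. l x / ?c = u x"
    using beta by (intro AE_limit_eq[of "2 - \<beta>" 1 l C] l(2)) auto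
  ultimately show ?thesis by (intro bexI[of _ "\<lambda>x. l x / mollifier_mass TYPE('a)"])
qed

end

subsection \<open>Schroedinger equations with Kato--Rellich potentials\<close>

lemma loc_integrable_dominated:
  fixes w h :: "'a::euclidean_space \<Rightarrow> real"
  assumes w: "w \<in> borel_measurable borel" and h: "integrable lborel h" and le: "AE y in lborel. \<bar>w y\<bar> \<le> k + h y"
  shows "loc_integrable w"
proof -
  have "set_integrable lborel (cball x r) w" for x r
    unfolding set_integrable_def
  proof (rule Bochner_Integration.integrable_bound)
    show "integrable lborel (\<lambda>y. indicator (cball x r) y * \<bar>k\<bar> + \<bar>h y\<bar>)"
      using h by (intro Bochner_Integration.integrable_add integrable_mult_left integrable_real_indicator integrable_abs)
        (use emeasure_lborel_cball_finite[of x r] in auto)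
    show "AE y in lborel. norm (indicator (cball x r) y *\<^sub>R w y) \<le> norm (indicator (cball x r) y * \<bar>k\<bar> + \<bar>h y\<bar>)"
      using le by eventually_elim (auto simp: indicator_def)
    show "(\<lambda>y. indicator (cball x r) y *\<^sub>R w y) \<in> borel_measurable lborel"
    proof -
      note [measurable] = w
      have [measurable]: "cball x r \<in> sets borel" by simp
      show ?thesis by measurable
    qed
  qed
  with w show ?thesis by (simp add: loc_integrable_def)
qed

section \<open>Passage between Lebesgue measurable functions and Borel representatives\<close>

lemma loc_integrable_lebesgue:
  fixes w w' :: "'a::euclidean_space \<Rightarrow> real"
  assumes w': "loc_integrable w'" and w: "w \<in> borel_measurable lebesgue" and ae: "AE x in lborel. w x = w' x"
  shows "set_integrable lebesgue (cball x r) w"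
proof -
  have [measurable]: "cball x r \<in> sets borel" "w' \<in> borel_measurable borel"
    using loc_integrable_measurable[OF w'] by simp_all
  have "integrable lborel (\<lambda>y. indicator (cball x r) y *\<^sub>R w' y)"
    using w' by (simp add: loc_integrable_def set_integrable_def)
  moreover have m: "(\<lambda>y. indicator (cball x r) y *\<^sub>R w' y) \<in> borel_measurable lborel" by measurable
  ultimately have "integrable lebesgue (\<lambda>y. indicator (cball x r) y *\<^sub>R w' y)"
    by (subst integrable_completion)
  moreover have "integrable lebesgue (\<lambda>y. indicator (cball x r) y *\<^sub>R w y) \<longleftrightarrow> integrable lebesgue (\<lambda>y. indicator (cball x r) y *\<^sub>R w' y)"
  proof (rule integrable_cong_AE)
    show "(\<lambda>y. indicator (cball x r) y *\<^sub>R w y) \<in> borel_measurable lebesgue"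
      using w by (intro borel_measurable_scaleR borel_measurable_indicator) auto
    show "(\<lambda>y. indicator (cball x r) y *\<^sub>R w' y) \<in> borel_measurable lebesgue"
      using m by (rule measurable_completion)
    show "AE y in lebesgue. indicator (cball x r) y *\<^sub>R w y = indicator (cball x r) y *\<^sub>R w' y"
      using AE_completion[OF ae] by eventually_elim simp
  qed
  ultimately show ?thesis by (simp add: set_integrable_def)
qed

lemma lebesgue_integral_eq_lborel:
  fixes w w' k :: "'a::euclidean_space \<Rightarrow> real"
  assumes [measurable]: "w' \<in> borel_measurable borel" "k \<in> borel_measurable borel"
    and w: "w \<in> borel_measurable lebesgue" and ae: "AE x in lborel. w x = w' x"
  shows "(\<integral>x. w x * k x \<partial>lebesgue) = (\<integral>x. w' x * k x \<partial>lborel)"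
proof -
  have "(\<integral>x. w x * k x \<partial>lebesgue) = (\<integral>x. w' x * k x \<partial>lebesgue)"
  proof (rule integral_cong_AE)
    have k: "k \<in> borel_measurable lebesgue" by (rule measurable_completion) simp
    show "(\<lambda>x. w x * k x) \<in> borel_measurable lebesgue" using w k by (rule borel_measurable_times)
    have "w' \<in> borel_measurable lebesgue" by (rule measurable_completion) simp
    then show "(\<lambda>x. w' x * k x) \<in> borel_measurable lebesgue" using k by (rule borel_measurable_times)
    show "AE x in lebesgue. w x * k x = w' x * k x" using AE_completion[OF ae] by eventually_elim simp
  qed
  also have "\<dots> = (\<integral>x. w' x * k x \<partial>lborel)" by (rule integral_completion) measurable
  finally show ?thesis .
qed

lemma Lp_borel:
  fixes w :: "'a::euclidean_space \<Rightarrow> real"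
  assumes "w \<in> Lp q"
  obtains w' where "w' \<in> borel_measurable borel" "AE x in lborel. w x = w' x" "integrable lborel (\<lambda>x. \<bar>w' x\<bar> powr q)"
proof -
  have w: "w \<in> borel_measurable lebesgue" "integrable lebesgue (\<lambda>x. \<bar>w x\<bar> powr q)"
    using assms by (auto simp: Lp_def)
  obtain w' where w': "w' \<in> borel_measurable lborel" "AE x in lborel. w x = w' x"
    using completion_ex_borel_measurable_real[OF w(1)] by blast
  have m: "(\<lambda>x. \<bar>w' x\<bar> powr q) \<in> borel_measurable lborel" using w'(1) by measurable
  have "integrable lebesgue (\<lambda>x. \<bar>w x\<bar> powr q) \<longleftrightarrow> integrable lebesgue (\<lambda>x. \<bar>w' x\<bar> powr q)"
  proof (rule integrable_cong_AE)
    show "(\<lambda>x. \<bar>w' x\<bar> powr q) \<in> borel_measurable lebesgue" using m by (rule measurable_completion)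
    show "AE x in lebesgue. \<bar>w x\<bar> powr q = \<bar>w' x\<bar> powr q"
      using AE_completion[OF w'(2)] by eventually_elim simp
  qed (use w(2) in auto)
  then have "integrable lborel (\<lambda>x. \<bar>w' x\<bar> powr q)" using w(2) m by (simp add: integrable_completion)
  with w' that show ?thesis by simp
qed

text \<open>The elementary bound \<open>a \<le> s (1 + (a / s)\<^sup>q)\<close> with \<open>s = r powr (- N / q)\<close> replaces Hoelder's inequality.\<close>

lemma Lp_ball_mass:
  fixes W :: "'a::euclidean_space \<Rightarrow> real"
  assumes [measurable]: "W \<in> borel_measurable borel" and W: "integrable lborel (\<lambda>x. \<bar>W x\<bar> powr q)"
    and q: "q \<ge> 1" and r: "0 < r"
  shows "(\<integral>\<^sup>+y. indicator (cball x r) y * ennreal \<bar>W y\<bar> \<partial>lborel)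
    \<le> ennreal ((unit_ball_vol (real DIM('a)) + (\<integral>x. \<bar>W x\<bar> powr q \<partial>lborel)) * r powr (real DIM('a) - real DIM('a) / q))"
proof -
  let ?N = "real DIM('a)" and ?I = "\<integral>x. \<bar>W x\<bar> powr q \<partial>lborel"
  have [measurable]: "cball x r \<in> sets borel" by simp
  \<comment> \<open>This s balances the two terms: s r^N and s powr (1 - q) are both r powr (N -
    N/q).\<close>
  define s where "s = r powr (- ?N / q)"
  have s: "s > 0" using r by (simp add: s_def)
  have I: "?I \<ge> 0" by simp
  have key: "a \<le> s + s powr (1 - q) * a powr q" if a: "a \<ge> 0" for a
  proof (cases "a \<le> s")
    case True
    moreover have "0 \<le> s powr (1 - q) * a powr q" by simp
    ultimately show ?thesis by linarith
  next
    case False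
    then have "1 \<le> (a / s) powr (q - 1)" using s q by (intro ge_one_powr_ge_zero) auto
    then have "a \<le> a * (a / s) powr (q - 1)" using a by (simp add: mult_le_cancel_left1)
    also have "\<dots> = s powr (1 - q) * a powr q"
      using False s by (simp add: powr_divide powr_diff powr_minus divide_simps)
    finally show ?thesis using s by linarith
  qed
  have "(\<integral>\<^sup>+y. indicator (cball x r) y * ennreal \<bar>W y\<bar> \<partial>lborel)
      \<le> (\<integral>\<^sup>+y. ennreal s * indicator (cball x r) y + ennreal (s powr (1 - q)) * ennreal (\<bar>W y\<bar> powr q) \<partial>lborel)"
  proof (rule nn_integral_mono)
    fix y
    have "ennreal \<bar>W y\<bar> \<le> ennreal (s + s powr (1 - q) * \<bar>W y\<bar> powr q)" by (intro ennreal_leI key) simp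
    also have "\<dots> = ennreal s + ennreal (s powr (1 - q)) * ennreal (\<bar>W y\<bar> powr q)"
      using s by (simp add: ennreal_mult)
    finally show "indicator (cball x r) y * ennreal \<bar>W y\<bar> \<le> ennreal s * indicator (cball x r) y + ennreal (s powr (1 - q)) * ennreal (\<bar>W y\<bar> powr q)"
      by (auto simp: indicator_def)
  qed
  also have "\<dots> = ennreal s * emeasure lborel (cball x r) + ennreal (s powr (1 - q)) * ennreal ?I"
    using W by (simp add: nn_integral_add nn_integral_cmult nn_integral_eq_integral)
  also have "\<dots> = ennreal (s * (unit_ball_vol ?N * r ^ DIM('a)) + s powr (1 - q) * ?I)"
    using s I r by (simp add: emeasure_cball ennreal_mult)
  also have "s * (unit_ball_vol ?N * r ^ DIM('a)) + s powr (1 - q) * ?I = (unit_ball_vol ?N + ?I) * r powr (?N - ?N / q)"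
  proof -
    have 1: "s * r ^ DIM('a) = r powr (?N - ?N / q)"
      using r by (simp add: s_def powr_realpow[symmetric] powr_add[symmetric])
    have "- ?N / q * (1 - q) = ?N - ?N / q" using q by (simp add: field_simps)
    then have 2: "s powr (1 - q) = r powr (?N - ?N / q)" by (simp add: s_def powr_powr)
    have "s * (unit_ball_vol ?N * r ^ DIM('a)) = unit_ball_vol ?N * (s * r ^ DIM('a))" by simp
    then show ?thesis unfolding 1 2 by (simp add: distrib_right)
  qed
  finally show ?thesis .
qed

text \<open>Reduces the Schroedinger equation to the abstract setting, with f = a - b for a = l u' +
  g(u') and b = (W + Z) u'. Since q >= 2, W^2 is bounded by 1 + |W|^q, which makes W u' locally
  integrable.\<close>

lemma kato_rellich_data:
  fixes u V V1 V2 :: "'a::euclidean_space \<Rightarrow> real"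
  assumes V: "\<And>x. V x = V1 x + V2 x" and V1: "V1 \<in> Lp q" and V2: "V2 \<in> Linfty" and q: "q \<ge> 2"
    and g: "continuous_on UNIV g" and gC: "\<And>t. \<bar>g t\<bar> \<le> C * \<bar>t\<bar>"
    and sol: "weak_solution V l g u"
  obtains u' f Q A L where "loc_integrable u'" "loc_integrable f" "Q \<in> borel_measurable borel" "mollified_poisson u' f"
    "AE y in lborel. \<bar>f y\<bar> \<le> Q y * \<bar>u' y\<bar>" "\<And>y. 1 \<le> Q y" "A \<ge> 0"
    "\<And>x r. 0 < r \<Longrightarrow> r \<le> 1 \<Longrightarrow>
      (\<integral>\<^sup>+y. indicator (cball x r) y * ennreal (Q y) \<partial>lborel) \<le> ennreal (A * r powr (real DIM('a) - real DIM('a) / q))"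
    "\<And>x. ball_mass u' x 1 \<le> L"
    "\<And>M. M \<ge> 1 \<Longrightarrow> (\<integral>\<^sup>+y. ennreal (Q y * max 0 (\<bar>u' y\<bar> - M)) \<partial>lborel) < \<infinity>"
    "AE x in lborel. u x = u' x"
proof -
  let ?N = "real DIM('a)"
  have uL: "u \<in> Lp 2" using sol by (simp add: weak_solution_def H1_def)
  obtain u' where u'[measurable]: "u' \<in> borel_measurable borel" and uu: "AE x in lborel. u x = u' x"
    and u2: "integrable lborel (\<lambda>x. \<bar>u' x\<bar> powr 2)" using Lp_borel[OF uL] by blast
  then have u2: "integrable lborel (\<lambda>x. (u' x)\<^sup>2)" by simp
  obtain W where W[measurable]: "W \<in> borel_measurable borel" and VW: "AE x in lborel. V1 x = W x"
    and Wq: "integrable lborel (\<lambda>x. \<bar>W x\<bar> powr q)" using Lp_borel[OF V1] by blast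
  have V2m: "V2 \<in> borel_measurable lebesgue" using V2 by (simp add: Linfty_def)
  obtain Z where Z[measurable]: "Z \<in> borel_measurable lborel" and VZ: "AE x in lborel. V2 x = Z x"
    using completion_ex_borel_measurable_real[OF V2m] by blast
  have [measurable]: "Z \<in> borel_measurable borel" using Z by simp
  obtain K where "AE x in lebesgue. \<bar>V2 x\<bar> \<le> K" using V2 by (auto simp: Linfty_def)
  then have "AE x in lborel. \<bar>V2 x\<bar> \<le> K" by (simp add: AE_completion_iff)
  with VZ have ZK: "AE x in lborel. \<bar>Z x\<bar> \<le> \<bar>K\<bar>" by eventually_elim auto
  have gm[measurable]: "g \<in> borel_measurable borel" using g by (rule borel_measurable_continuous_onI)
  have C: "C \<ge> 0" using gC[of 1] by simp
  \<comment> \<open>One summand for each bounded coefficient: the spectral parameter, the growth of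
    g and the bounded potential. The final 1 ensures Q >= 1.\<close>
  define c where "c = \<bar>l\<bar> + C + \<bar>K\<bar> + 1"
  have c1: "c \<ge> 1" using C by (simp add: c_def)
  define Q where "Q y = c + \<bar>W y\<bar>" for y
  define a where "a y = l * u' y + g (u' y)" for y
  define b where "b y = (W y + Z y) * u' y" for y
  have am: "a \<in> borel_measurable borel" and bm: "b \<in> borel_measurable borel" and Qm: "Q \<in> borel_measurable borel"
    unfolding a_def[abs_def] b_def[abs_def] Q_def[abs_def] by measurable
  have aQ: "\<bar>a y\<bar> \<le> (\<bar>l\<bar> + C) * \<bar>u' y\<bar>" for y
  proof -
    have "\<bar>a y\<bar> \<le> \<bar>l * u' y\<bar> + \<bar>g (u' y)\<bar>" unfolding a_def by (rule abs_triangle_ineq)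
    also have "\<dots> \<le> (\<bar>l\<bar> + C) * \<bar>u' y\<bar>" using gC[of "u' y"] by (simp add: abs_mult distrib_right)
    finally show ?thesis .
  qed
  have bQ: "AE y in lborel. \<bar>b y\<bar> \<le> (\<bar>W y\<bar> + \<bar>K\<bar>) * \<bar>u' y\<bar>"
    using ZK
  proof eventually_elim
    case (elim y)
    have "\<bar>W y + Z y\<bar> \<le> \<bar>W y\<bar> + \<bar>K\<bar>" using elim by linarith
    then show ?case unfolding b_def abs_mult by (rule mult_right_mono) simp
  qed
  have fQ: "AE y in lborel. \<bar>a y - b y\<bar> \<le> Q y * \<bar>u' y\<bar>"
    using bQ
  proof eventually_elim
    case (elim y)
    have "\<bar>a y - b y\<bar> \<le> (\<bar>l\<bar> + C) * \<bar>u' y\<bar> + (\<bar>W y\<bar> + \<bar>K\<bar>) * \<bar>u' y\<bar>"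
      using elim aQ[of y] abs_triangle_ineq4[of "a y" "b y"] by linarith
    also have "\<dots> \<le> Q y * \<bar>u' y\<bar>" by (simp add: Q_def c_def algebra_simps)
    finally show ?case .
  qed
  have abs_sq: "\<bar>x\<bar> \<le> 1 + x\<^sup>2" for x :: real
    using sum_squares_ge_zero[of "\<bar>x\<bar> - 1" 0] by (auto simp: power2_eq_square algebra_simps abs_if split: if_splits)
  have powr2: "x\<^sup>2 \<le> 1 + \<bar>x\<bar> powr q" for x :: real
  proof (cases "\<bar>x\<bar> \<le> 1")
    case True
    then have "x\<^sup>2 \<le> 1" by (simp add: abs_square_le_1)
    then show ?thesis by (smt (verit) powr_ge_zero)
  next
    case False
    then have "\<bar>x\<bar> powr 2 \<le> \<bar>x\<bar> powr q" using q by (intro powr_mono) auto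
    then show ?thesis by simp
  qed
  \<comment> \<open>One integrable majorant for two purposes: after adding a constant it gives local
    integrability, and by itself it dominates the excess above M in \<open>fin\<close>.\<close>
  let ?H = "\<lambda>y. (c + 1) * (u' y)\<^sup>2 + \<bar>W y\<bar> powr q"
  have H: "integrable lborel ?H" using u2 Wq by (intro Bochner_Integration.integrable_add integrable_mult_right)
  have QH: "Q y * \<bar>u' y\<bar> \<le> (c + 1) + ?H y" for y
  proof -
    have "c * \<bar>u' y\<bar> \<le> c * (1 + (u' y)\<^sup>2)" using c1 abs_sq by (intro mult_left_mono) auto
    moreover have "\<bar>W y\<bar> * \<bar>u' y\<bar> \<le> (W y)\<^sup>2 + (u' y)\<^sup>2"
    proof -
      have "0 \<le> (\<bar>W y\<bar> - \<bar>u' y\<bar>)\<^sup>2" by simp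
      then have "2 * (\<bar>W y\<bar> * \<bar>u' y\<bar>) \<le> (W y)\<^sup>2 + (u' y)\<^sup>2" by (simp add: power2_diff)
      then show ?thesis using mult_nonneg_nonneg[OF abs_ge_zero abs_ge_zero, of "W y" "u' y"] by linarith
    qed
    ultimately show ?thesis using powr2[of "W y"] by (simp add: Q_def algebra_simps)
  qed
  have Qn: "Q y \<ge> 1" for y using c1 by (simp add: Q_def)
  have la: "loc_integrable a"
  proof (rule loc_integrable_dominated[OF am H])
    have "(\<bar>l\<bar> + C) * \<bar>u' y\<bar> \<le> Q y * \<bar>u' y\<bar>" for y by (intro mult_right_mono) (auto simp: Q_def c_def)
    then show "AE y in lborel. \<bar>a y\<bar> \<le> (c + 1) + ?H y" using aQ QH by (intro AE_I2) (meson order_trans)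
  qed
  have lb: "loc_integrable b"
  proof (rule loc_integrable_dominated[OF bm H])
    have "(\<bar>W y\<bar> + \<bar>K\<bar>) * \<bar>u' y\<bar> \<le> Q y * \<bar>u' y\<bar>" for y using C by (intro mult_right_mono) (auto simp: Q_def c_def)
    note le = this
    show "AE y in lborel. \<bar>b y\<bar> \<le> (c + 1) + ?H y"
      using bQ
    proof eventually_elim
      case (elim y)
      then show ?case using le[of y] QH[of y] by linarith
    qed
  qed
  have lu: "loc_integrable u'"
    by (rule loc_integrable_dominated[OF u' u2, of 1]) (use abs_sq in auto)
  have umeas: "u \<in> borel_measurable lebesgue" and V1meas: "V1 \<in> borel_measurable lebesgue"
    using uL V1 by (auto simp: Lp_def)
  have gum: "(\<lambda>x. l * u x + g (u x)) \<in> borel_measurable lebesgue"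
    using umeas gm by (intro borel_measurable_add borel_measurable_times measurable_compose[OF umeas]) auto
  have Vum: "(\<lambda>x. V x * u x) \<in> borel_measurable lebesgue"
    unfolding V using umeas V1meas V2m by (intro borel_measurable_add borel_measurable_times)
  have Vb: "AE x in lborel. V x * u x = b x"
    using uu VW VZ by eventually_elim (simp add: V b_def)
  have ga: "AE x in lborel. l * u x + g (u x) = a x"
    using uu by eventually_elim (simp add: a_def)
  have poisson: "mollified_poisson u' (\<lambda>y. a y - b y)"
    unfolding mollified_poisson_def
  proof (intro allI impI)
    fix x :: 'a and t :: real assume t: "t > 0"
    let ?S = "\<lambda>y. \<Sum>b\<in>Basis. partial_deriv b (partial_deriv b (\<lambda>y. potential t (x - y))) y"
    \<comment> \<open>The Laplacian of the potential is 1/t times the kernel; this 1/t reappears as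
      the factor t in \<open>mollified_poisson\<close>.\<close>
    have S: "?S = (\<lambda>y. mollifier_deriv t (x - y) / t)" using potential_laplacian[OF t, of x] t by (auto simp: field_simps)
    have "(\<integral>y. u y * (mollifier_deriv t (x - y) / t) \<partial>lebesgue) = - (\<integral>y. (l * u y + g (u y) - V y * u y) * potential t (x - y) \<partial>lebesgue)"
      using weak_solution_test[OF sol loc_integrable_lebesgue[OF lb Vum Vb] loc_integrable_lebesgue[OF la gum ga] potential_test_function[OF t, of x]]
      by (simp add: S[unfolded fun_eq_iff, rule_format])
    also have "(\<integral>y. u y * (mollifier_deriv t (x - y) / t) \<partial>lebesgue) = (\<integral>y. u' y * (mollifier_deriv t (x - y) / t) \<partial>lborel)"
      by (rule lebesgue_integral_eq_lborel[OF u' _ umeas uu]) measurable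
    also have "(\<integral>y. (l * u y + g (u y) - V y * u y) * potential t (x - y) \<partial>lebesgue) = (\<integral>y. (a y - b y) * potential t (x - y) \<partial>lborel)"
    proof (rule lebesgue_integral_eq_lborel)
      show "(\<lambda>y. a y - b y) \<in> borel_measurable borel" using am bm by measurable
      show "(\<lambda>y. potential t (x - y)) \<in> borel_measurable borel" by measurable
      show "(\<lambda>y. l * u y + g (u y) - V y * u y) \<in> borel_measurable lebesgue" using gum Vum by (rule borel_measurable_diff)
      show "AE y in lborel. l * u y + g (u y) - V y * u y = a y - b y" using ga Vb by eventually_elim simp
    qed
    finally have "(\<integral>y. u' y * (mollifier_deriv t (x - y) / t) \<partial>lborel) = - convolve (potential t) (\<lambda>y. a y - b y) x"
      by (simp add: convolve_def mult.commute)
    moreover have "(\<integral>y. u' y * (mollifier_deriv t (x - y) / t) \<partial>lborel) = convolve (mollifier_deriv t) u' x / t"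
      by (simp add: convolve_def mult.commute)
    ultimately show "convolve (mollifier_deriv t) u' x = - t * convolve (potential t) (\<lambda>y. a y - b y) x"
      using t by (simp add: field_simps)
  qed
  define A where "A = c * unit_ball_vol ?N + (unit_ball_vol ?N + (\<integral>x. \<bar>W x\<bar> powr q \<partial>lborel))"
  have mass: "(\<integral>\<^sup>+y. indicator (cball x r) y * ennreal (Q y) \<partial>lborel) \<le> ennreal (A * r powr (?N - ?N / q))"
    if r: "0 < r" "r \<le> 1" for x r
  proof -
    have [measurable]: "cball x r \<in> sets borel" by simp
    have "(\<integral>\<^sup>+y. indicator (cball x r) y * ennreal (Q y) \<partial>lborel)
      = (\<integral>\<^sup>+y. ennreal c * indicator (cball x r) y + indicator (cball x r) y * ennreal \<bar>W y\<bar> \<partial>lborel)"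
      using c1 by (intro nn_integral_cong) (auto simp: indicator_def Q_def)
    also have "\<dots> = ennreal c * emeasure lborel (cball x r) + (\<integral>\<^sup>+y. indicator (cball x r) y * ennreal \<bar>W y\<bar> \<partial>lborel)"
      by (simp add: nn_integral_add nn_integral_cmult)
    also have "\<dots> \<le> ennreal (c * unit_ball_vol ?N * r powr (?N - ?N / q)) +
        ennreal ((unit_ball_vol ?N + (\<integral>x. \<bar>W x\<bar> powr q \<partial>lborel)) * r powr (?N - ?N / q))"
    proof (intro add_mono)
      \<comment> \<open>For r <= 1 the constant part of Q, of mass r^N, obeys the weaker rate of its
        L^q part.\<close>
      have "r ^ DIM('a) = r powr ?N" using r by (simp add: powr_realpow)
      also have "\<dots> \<le> r powr (?N - ?N / q)" using r q by (intro powr_mono') auto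
      finally have "c * (unit_ball_vol ?N * r ^ DIM('a)) \<le> c * (unit_ball_vol ?N * r powr (?N - ?N / q))"
        using c1 by (intro mult_left_mono) auto
      then show "ennreal c * emeasure lborel (cball x r) \<le> ennreal (c * unit_ball_vol ?N * r powr (?N - ?N / q))"
        using r c1 by (simp add: emeasure_cball ennreal_mult[symmetric] mult.assoc ennreal_leI)
    qed (use Wq q r in \<open>intro Lp_ball_mass; simp\<close>)
    also have "\<dots> = ennreal (A * r powr (?N - ?N / q))"
      using c1 by (simp add: A_def ennreal_plus[symmetric] distrib_right del: ennreal_plus)
    finally show ?thesis .
  qed
  have umass: "ball_mass u' x 1 \<le> unit_ball_vol ?N + (\<integral>y. (u' y)\<^sup>2 \<partial>lborel)" for x
  proof -
    have [measurable]: "cball x 1 \<in> sets borel" by simp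
    have i: "integrable lborel (\<lambda>y. indicator (cball x 1) y :: real)"
      by (intro integrable_real_indicator) (use emeasure_lborel_cball_finite[of x 1] in auto)
    have "ball_mass u' x 1 \<le> (\<integral>y. indicator (cball x 1) y + (u' y)\<^sup>2 \<partial>lborel)"
      unfolding ball_mass_def set_lebesgue_integral_def
    proof (rule integral_mono)
      show "integrable lborel (\<lambda>y. indicator (cball x 1) y *\<^sub>R \<bar>u' y\<bar>)"
        using loc_integrable_abs[OF lu] by (simp add: set_integrable_def)
      show "indicator (cball x 1) y *\<^sub>R \<bar>u' y\<bar> \<le> indicator (cball x 1) y + (u' y)\<^sup>2" for y
        using abs_sq[of "u' y"] by (auto simp: indicator_def)
    qed (use i u2 in auto)
    also have "\<dots> = unit_ball_vol ?N + (\<integral>y. (u' y)\<^sup>2 \<partial>lborel)"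
      using i u2 content_cball[of 1 x] by simp
    finally show ?thesis .
  qed
  have fin: "(\<integral>\<^sup>+y. ennreal (Q y * max 0 (\<bar>u' y\<bar> - M)) \<partial>lborel) < \<infinity>" if M: "M \<ge> 1" for M
  proof -
    \<comment> \<open>Only points with |u'| > M >= 1 matter. There |u'| <= u'^2, and |W| |u'| is at
      most u'^2 if |W| <= |u'|, else at most W^2 <= |W|^q because |W| > 1; no additive constant
      appears.\<close>
    have "Q y * max 0 (\<bar>u' y\<bar> - M) \<le> ?H y" for y
    proof (cases "\<bar>u' y\<bar> \<le> M")
      case True
      then show ?thesis using c1 by simp
    next
      case False
      then have u1: "1 \<le> \<bar>u' y\<bar>" using M by simp
      have "Q y * max 0 (\<bar>u' y\<bar> - M) \<le> Q y * \<bar>u' y\<bar>" using False M Qn[of y] by (intro mult_left_mono) auto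
      also have "\<dots> = c * \<bar>u' y\<bar> + \<bar>W y\<bar> * \<bar>u' y\<bar>" by (simp add: Q_def algebra_simps)
      also have "\<dots> \<le> c * (u' y)\<^sup>2 + ((u' y)\<^sup>2 + \<bar>W y\<bar> powr q)"
      proof (intro add_mono mult_left_mono)
        show "\<bar>u' y\<bar> \<le> (u' y)\<^sup>2" using u1 mult_left_mono[OF u1, of "\<bar>u' y\<bar>"] by (simp add: power2_eq_square abs_mult_self_eq)
        show "\<bar>W y\<bar> * \<bar>u' y\<bar> \<le> (u' y)\<^sup>2 + \<bar>W y\<bar> powr q"
        proof (cases "\<bar>W y\<bar> \<le> \<bar>u' y\<bar>")
          case True
          then have "\<bar>W y\<bar> * \<bar>u' y\<bar> \<le> \<bar>u' y\<bar> * \<bar>u' y\<bar>" by (intro mult_right_mono) auto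
          also have "\<dots> = (u' y)\<^sup>2" by (simp add: power2_eq_square)
          finally show ?thesis by (smt (verit) powr_ge_zero)
        next
          case False
          then have "\<bar>W y\<bar> * \<bar>u' y\<bar> \<le> \<bar>W y\<bar> * \<bar>W y\<bar>" by (intro mult_left_mono) auto
          also have "\<dots> = \<bar>W y\<bar> powr 2" by (simp add: power2_eq_square)
          also have "\<dots> \<le> \<bar>W y\<bar> powr q" using False u1 q by (intro powr_mono) auto
          finally show ?thesis by (smt (verit) zero_le_power2)
        qed
      qed (use c1 in auto)
      also have "\<dots> = ?H y" by (simp add: algebra_simps)
      finally show ?thesis .
    qed
    then have "(\<integral>\<^sup>+y. ennreal (Q y * max 0 (\<bar>u' y\<bar> - M)) \<partial>lborel) \<le> (\<integral>\<^sup>+y. ennreal (?H y) \<partial>lborel)"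
      by (intro nn_integral_mono ennreal_leI)
    also have "\<dots> = ennreal (\<integral>y. ?H y \<partial>lborel)" using c1 by (intro nn_integral_eq_integral H) auto
    finally show ?thesis by (simp add: le_less_trans)
  qed
  have "A \<ge> 0" using c1 by (simp add: A_def)
  show ?thesis
    by (rule that[OF lu loc_integrable_diff[OF la lb] Qm poisson fQ Qn \<open>A \<ge> 0\<close> mass umass fin uu])
qed

text \<open>The exponent q is kept free so that a potential with V1 = 0 can be treated with q > N.
  The essential bound is recorded for the two-dimensional case, where it is interpolated with
  L^2.\<close>

lemma weak_solution_regularity:
  fixes u V V1 V2 :: "'a::euclidean_space \<Rightarrow> real"
  assumes V: "\<And>x. V x = V1 x + V2 x" and V1: "V1 \<in> Lp q" and V2: "V2 \<in> Linfty"
    and q: "q \<ge> 2" "q > real DIM('a) / 2"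
    and g: "continuous_on UNIV g" and gC: "\<And>t. \<bar>g t\<bar> \<le> C * \<bar>t\<bar>"
    and sol: "weak_solution V l g u"
  shows "has_representative_in u (C_B 0)" "q > real DIM('a) \<Longrightarrow> has_representative_in u (C_B 1)"
    "\<exists>M. AE x in lebesgue. \<bar>u x\<bar> \<le> M"
proof -
  let ?\<beta> = "real DIM('a) / q"
  have beta: "?\<beta> < 2" using q by (simp add: field_simps)
  obtain u' f Q A L where u': "loc_integrable u'" and f: "loc_integrable f" and Q: "Q \<in> borel_measurable borel" and
    poisson: "mollified_poisson u' f" and
    fQ: "AE y in lborel. \<bar>f y\<bar> \<le> Q y * \<bar>u' y\<bar>" and Q1: "\<And>y. 1 \<le> Q y" and A: "A \<ge> 0" and
    mass: "\<And>x r. 0 < r \<Longrightarrow> r \<le> 1 \<Longrightarrow>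
      (\<integral>\<^sup>+y. indicator (cball x r) y * ennreal (Q y) \<partial>lborel) \<le> ennreal (A * r powr (real DIM('a) - ?\<beta>))" and
    umass: "\<And>x. ball_mass u' x 1 \<le> L" and
    fin: "\<And>M. M \<ge> 1 \<Longrightarrow> (\<integral>\<^sup>+y. ennreal (Q y * max 0 (\<bar>u' y\<bar> - M)) \<partial>lborel) < \<infinity>" and
    uu: "AE x in lborel. u x = u' x"
    using kato_rellich_data[OF V V1 V2 q(1) g gC sol] by blast
  obtain M where M: "M \<ge> 0" "AE y in lborel. \<bar>u' y\<bar> \<le> M"
    using mollified_poisson_bounded[OF u' loc_integrable_measurable[OF f] Q poisson fQ Q1 mass beta A umass fin] by blast
  have "AE x in lborel. \<bar>u x\<bar> \<le> M" using M(2) uu by eventually_elim simp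
  then show "\<exists>M. AE x in lebesgue. \<bar>u x\<bar> \<le> M" using AE_completion by blast
  have fmass: "ball_mass f x r \<le> (M * A) * r powr (real DIM('a) - ?\<beta>)" if r: "0 < r" "r \<le> 1" for x r
  proof -
    note [measurable] = Q loc_integrable_measurable[OF f]
    have [measurable]: "cball x r \<in> sets borel" by simp
    have i: "integrable lborel (\<lambda>y. indicator (cball x r) y * \<bar>f y\<bar>)"
      using loc_integrable_abs[OF f] by (simp add: set_integrable_def)
    have "ennreal (ball_mass f x r) = (\<integral>\<^sup>+y. ennreal (indicator (cball x r) y * \<bar>f y\<bar>) \<partial>lborel)"
      unfolding ball_mass_def set_lebesgue_integral_def using i by (subst nn_integral_eq_integral) auto
    also have "\<dots> \<le> (\<integral>\<^sup>+y. ennreal M * (indicator (cball x r) y * ennreal (Q y)) \<partial>lborel)"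
    proof (rule nn_integral_mono_AE)
      show "AE y in lborel. ennreal (indicator (cball x r) y * \<bar>f y\<bar>) \<le> ennreal M * (indicator (cball x r) y * ennreal (Q y))"
        using fQ M(2)
      proof eventually_elim
        case (elim y)
        have q0: "Q y \<ge> 0" using Q1[of y] by simp
        have "\<bar>f y\<bar> \<le> M * Q y" using elim mult_left_mono[OF elim(2) q0] by (simp add: mult.commute)
        then have "ennreal \<bar>f y\<bar> \<le> ennreal M * ennreal (Q y)"
          using M(1) q0 by (simp add: ennreal_mult[symmetric] ennreal_leI)
        then show ?case by (auto simp: indicator_def)
      qed
    qed
    also have "\<dots> = ennreal M * (\<integral>\<^sup>+y. indicator (cball x r) y * ennreal (Q y) \<partial>lborel)"
      by (rule nn_integral_cmult) measurable
    also have "\<dots> \<le> ennreal M * ennreal (A * r powr (real DIM('a) - ?\<beta>))"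
      by (intro mult_left_mono mass r) simp
    also have "\<dots> = ennreal ((M * A) * r powr (real DIM('a) - ?\<beta>))"
      using M(1) A by (simp add: ennreal_mult[symmetric] mult.assoc)
    finally show ?thesis using M(1) A by (subst (asm) ennreal_le_iff) auto
  qed
  have MA: "M * A \<ge> 0" using M(1) A by simp
  have lift: "has_representative_in u S" if ex: "\<exists>v\<in>S. AE x in lborel. v x = u' x" for S
  proof -
    obtain v where v: "v \<in> S" "AE x in lborel. v x = u' x" using ex by blast
    have "AE x in lborel. v x = u x" using v(2) uu by eventually_elim simp
    then show ?thesis using v(1) AE_completion unfolding has_representative_in_def by blast
  qed
  show "has_representative_in u (C_B 0)"
    by (rule lift, rule representative_C_B_0[OF u' f poisson fmass umass MA beta])
  show "has_representative_in u (C_B 1)" if "q > real DIM('a)"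
  proof -
    have "?\<beta> < 1" using that q by (simp add: field_simps)
    then show ?thesis by (intro lift representative_C_B_1[OF u' f poisson fmass umass MA])
  qed
qed

theorem theorem2p2:
  fixes l p :: real
    and V V1 V2 u :: "real ^ 'n \<Rightarrow> real"
    and g :: "real \<Rightarrow> real"
  assumes V_split: "\<And>x. V x = V1 x + V2 x"
    and V1: "V1 \<in> Lp p"
    and V2: "V2 \<in> Linfty"
    and p_low: "CARD('n) \<le> 3 \<Longrightarrow> p = 2"
    and p_high: "CARD('n) \<ge> 4 \<Longrightarrow> p > real CARD('n) / 2"
    and g_cont: "continuous_on UNIV g"
    and g_growth: "\<exists>C>0. \<forall>t. \<bar>g t\<bar> \<le> C * \<bar>t\<bar>"
    and solution: "weak_solution V l g u"
    and nontrivial: "\<not> (AE x in lebesgue. u x = 0)"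
    and decay: "has_representative_in u {v. (v \<longlongrightarrow> 0) at_infinity}"
  shows "((AE x in lebesgue. V1 x = 0) \<longrightarrow> has_representative_in u (C_B 1)) \<and>
    (Lp_norm p V1 > 0 \<longrightarrow>
      ((p > real CARD('n) \<and> CARD('n) \<ge> 4 \<or> p = 2 \<and> CARD('n) = 1)
         \<longrightarrow> has_representative_in u (C_B 1)) \<and>
      ((real CARD('n) / 2 < p \<and> p \<le> real CARD('n) \<and> CARD('n) \<ge> 4 \<or> p = 2 \<and> CARD('n) = 3)
         \<longrightarrow> has_representative_in u (C_B 0)) \<and>
      ((p = real CARD('n) \<and> CARD('n) = 2) \<longrightarrow> (\<forall>q\<ge>2. u \<in> Lp q)))"
proof (intro conjI impI allI)
  have dim: "DIM(real ^ 'n) = CARD('n)" by simp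
  \<comment> \<open>For N <= 3 one has N/2 < 2 = p, and for N >= 4 one has p > N/2 >= 2, so both
    bounds hold in every dimension.\<close>
  have pN: "p > real CARD('n) / 2" and p2: "p \<ge> 2"
    using p_low p_high by (cases "CARD('n) \<le> 3"; simp)+
  obtain C where C: "\<And>t. \<bar>g t\<bar> \<le> C * \<bar>t\<bar>" using g_growth by blast
  note reg = weak_solution_regularity[OF V_split V1 V2 p2 _ g_cont C solution, unfolded dim, OF pN]
  show "has_representative_in u (C_B 0)" using reg(1) .
  show "has_representative_in u (C_B 1)"
    if "p > real CARD('n) \<and> CARD('n) \<ge> 4 \<or> p = 2 \<and> CARD('n) = 1"
    using reg(2) that by auto
  show "has_representative_in u (C_B 1)" if V1_0: "AE x in lebesgue. V1 x = 0"
  proof -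
    \<comment> \<open>The zero potential lies in every L^q, so any exponent that is at least 2 and
      exceeds N will do.\<close>
    let ?q = "real CARD('n) + 2"
    have V1m: "V1 \<in> borel_measurable lebesgue" using V1 by (simp add: Lp_def)
    have "integrable lebesgue (\<lambda>x. \<bar>V1 x\<bar> powr ?q) \<longleftrightarrow> integrable lebesgue (\<lambda>x::real ^ 'n. 0::real)"
    proof (rule integrable_cong_AE)
      show "(\<lambda>x. \<bar>V1 x\<bar> powr ?q) \<in> borel_measurable lebesgue" using V1m by measurable
      show "AE x in lebesgue. \<bar>V1 x\<bar> powr ?q = 0" using V1_0 by eventually_elim simp
    qed simp
    then have "V1 \<in> Lp ?q" using V1m by (simp add: Lp_def)
    from weak_solution_regularity(2)[OF V_split this V2 _ _ g_cont C solution] show ?thesis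
      by (simp add: dim)
  qed
  show "u \<in> Lp q" if "q \<ge> 2" for q
  proof -
    obtain M where M: "AE x in lebesgue. \<bar>u x\<bar> \<le> M" using reg(3) by blast
    have u2: "u \<in> borel_measurable lebesgue" "integrable lebesgue (\<lambda>x. \<bar>u x\<bar> powr 2)"
      using solution by (auto simp: weak_solution_def H1_def Lp_def)
    have "integrable lebesgue (\<lambda>x. \<bar>u x\<bar> powr q)"
    proof (rule Bochner_Integration.integrable_bound)
      show "integrable lebesgue (\<lambda>x. M powr (q - 2) * \<bar>u x\<bar> powr 2)" using u2(2) by (rule integrable_mult_right)
      show "(\<lambda>x. \<bar>u x\<bar> powr q) \<in> borel_measurable lebesgue" using u2(1) by measurable
      show "AE x in lebesgue. norm (\<bar>u x\<bar> powr q) \<le> norm (M powr (q - 2) * \<bar>u x\<bar> powr 2)"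
        using M
      proof eventually_elim
        case (elim x)
        \<comment> \<open>Interpolation between L^2 and the essential bound. At u x = 0 the identity
          persists because 0 powr y is 0 for every y, including y = 0.\<close>
        have "\<bar>u x\<bar> powr q = \<bar>u x\<bar> powr (q - 2) * \<bar>u x\<bar> powr 2" by (simp only: powr_add[symmetric]) simp
        also have "\<dots> \<le> M powr (q - 2) * \<bar>u x\<bar> powr 2"
          using elim that by (intro mult_right_mono powr_mono2) auto
        finally show ?case by simp
      qed
    qed
    then show ?thesis using u2(1) by (simp add: Lp_def)
  qed
qed

end
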